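(* Let $\mathfrak{M}=(V,\langle\cdot,\cdot\rangle,A)$ be a conformally flat curvature model. There exist a real analytic conformally flat pseudo-Riemannian manifold $\mathcal{M}=(M,g)$ and a point $P$ of $M$ such that $\mathcal{M}$ has constant scalar curvature and such that $\mathfrak{M}$ is isomorphic to the curvature model $\mathfrak{M}(\mathcal{M},P):=(T_PM,g_P,R_P)$.
   Context: Let $V$ be a finite dimensional real vector space of dimension $m$. A tensor $A\in\otimes^4(V^* )$ is an algebraic curvature tensor on $V$ if for all $x,y,z,w\in V$: $A(x,y,z,w)=-A(y,x,z,w)=A(z,w,x,y)$ and $A(x,y,z,w)+A(y,z,x,w)+A(z,x,y,w)=0$. A curvature model is a triple $(V,\langle\cdot,\cdot\rangle,A)$ where $A$ is an algebraic curvature tensor on $V$ and $\langle\cdot,\cdot\rangle$ is a non-degenerate symmetric bilinear form of some signature $(p,q)$ on $V$. Two curvature models $(V_1,\langle\cdot,\cdot\rangle_1,A_1)$ and $(V_2,\langle\cdot,\cdot\rangle_2,A_2)$ are isomorphic if there is a linear isomorphism $\phi:V_1\to V_2$ with $\phi^*\langle\cdot,\cdot\rangle_2=\langle\cdot,\cdot\rangle_1$ and $\phi^*A_2=A_1$. For a basis $\{e_i\}$ of $V$ put $\varepsilon_{ij}=\langle e_i,e_j\rangle$, $A_{ijkl}=A(e_i,e_j,e_k,e_l)$, and let $\varepsilon^{ij}$ be the inverse matrix. Summing over repeated indices, the Ricci tensor is $\rho_{il}=\varepsilon^{jk}A_{ijkl}$ and the scalar curvature is $\tau=\varepsilon^{il}\varepsilon^{jk}A_{ijkl}$.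 The Weyl conformal curvature tensor $W$ of the model is, for $m\ge 3$, $$W_{ijkl}=A_{ijkl}-\tfrac{1}{m-2}\left(\rho_{il}\varepsilon_{jk}-\rho_{ik}\varepsilon_{jl}+\varepsilon_{il}\rho_{jk}-\varepsilon_{ik}\rho_{jl}\right)+\tfrac{\tau}{(m-1)(m-2)}\left(\varepsilon_{il}\varepsilon_{jk}-\varepsilon_{ik}\varepsilon_{jl}\right),$$ and $W=0$ by convention for $m\le 2$. The curvature model is conformally flat if $W=0$. For a pseudo-Riemannian manifold $\mathcal{M}=(M,g)$ with Levi-Civita connection $\nabla$, the curvature tensor is $R(x,y,z,w)=g((\nabla_x\nabla_y-\nabla_y\nabla_x-\nabla_{[x,y]})z,w)$, and the scalar curvature of $\mathcal{M}$ at a point $Q$ is that of the curvature model $(T_QM,g_Q,R_Q)$. A pseudo-Riemannian manifold is conformally flat if every point has a neighborhood on which the metric is a positive smooth function times a flat metric. *)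

theory Defs
  imports "HOL-Analysis.Analysis" "HOL-Library.Function_Algebras"
begin

section \<open>Linear algebra on subspaces\<close>

text \<open>
  Pointwise real vector space structure on functions. Coordinate vectors are functions
  \<open>nat \<Rightarrow> real\<close>, and tangent vectors below are functions from charts to coordinate vectors.
\<close>

instantiation "fun" :: (type, real_vector) real_vector
begin

definition scaleR_fun_def: "scaleR c f = (\<lambda>x. c *\<^sub>R f x)"

instance
  by standard (simp_all add: scaleR_fun_def fun_eq_iff scaleR_add_right scaleR_add_left)

end

definition fin_dim_space :: "'a::real_vector set \<Rightarrow> bool" where
  "fin_dim_space V \<longleftrightarrow> (\<exists>B. finite B \<and> span B = V)"

definition linear_on :: "'a::real_vector set \<Rightarrow> ('a \<Rightarrow> 'b::real_vector) \<Rightarrow> bool" where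
  "linear_on V f \<longleftrightarrow>
     (\<forall>x\<in>V. \<forall>y\<in>V. f (x + y) = f x + f y) \<and> (\<forall>c. \<forall>x\<in>V. f (c *\<^sub>R x) = c *\<^sub>R f x)"

definition is_basis :: "'a::real_vector set \<Rightarrow> (nat \<Rightarrow> 'a) \<Rightarrow> bool" where
  "is_basis V e \<longleftrightarrow>
     inj_on e {..<dim V} \<and> independent (e ` {..<dim V}) \<and> span (e ` {..<dim V}) = V"

text \<open>An arbitrary basis; it is only used to form contractions, which do not depend on it.\<close>

definition frame :: "'a::real_vector set \<Rightarrow> nat \<Rightarrow> 'a" where
  "frame V = (SOME e. is_basis V e)"

text \<open>
  Inverse of the \<open>m \<times> m\<close> matrix \<open>(a i j)\<close>, \<open>i, j < m\<close>. If the matrix is invertible, the entries with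
  indices below \<open>m\<close> are uniquely determined; no others are used.
\<close>

definition inv_matrix :: "nat \<Rightarrow> (nat \<Rightarrow> nat \<Rightarrow> real) \<Rightarrow> nat \<Rightarrow> nat \<Rightarrow> real" where
  "inv_matrix m a =
     (SOME b. \<forall>i<m. \<forall>j<m. (\<Sum>k<m. a i k * b k j) = (if i = j then 1 else 0))"

definition nondegenerate_form :: "'a::real_vector set \<Rightarrow> ('a \<Rightarrow> 'a \<Rightarrow> real) \<Rightarrow> bool" where
  "nondegenerate_form V ip \<longleftrightarrow>
     (\<forall>y\<in>V. linear_on V (\<lambda>x. ip x y)) \<and>
     (\<forall>x\<in>V. linear_on V (\<lambda>y. ip x y)) \<and>
     (\<forall>x\<in>V. \<forall>y\<in>V. ip x y = ip y x) \<and>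
     (\<forall>x\<in>V. (\<forall>y\<in>V. ip x y = 0) \<longrightarrow> x = 0)"

definition has_signature ::
    "'a::real_vector set \<Rightarrow> ('a \<Rightarrow> 'a \<Rightarrow> real) \<Rightarrow> nat \<Rightarrow> nat \<Rightarrow> bool" where
  "has_signature V ip p q \<longleftrightarrow> p + q = dim V \<and>
     (\<exists>e. is_basis V e \<and>
        (\<forall>i<dim V. \<forall>j<dim V. ip (e i) (e j) = (if i \<noteq> j then 0 else if i < p then -1 else 1)))"

section \<open>Curvature models\<close>

definition algebraic_curvature_tensor ::
    "'a::real_vector set \<Rightarrow> ('a \<Rightarrow> 'a \<Rightarrow> 'a \<Rightarrow> 'a \<Rightarrow> real) \<Rightarrow> bool" where
  "algebraic_curvature_tensor V A \<longleftrightarrow>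
     (\<forall>x\<in>V. \<forall>y\<in>V. \<forall>z\<in>V.
        linear_on V (\<lambda>w. A w x y z) \<and> linear_on V (\<lambda>w. A x w y z) \<and>
        linear_on V (\<lambda>w. A x y w z) \<and> linear_on V (\<lambda>w. A x y z w)) \<and>
     (\<forall>x\<in>V. \<forall>y\<in>V. \<forall>z\<in>V. \<forall>w\<in>V.
        A x y z w = - A y x z w \<and>
        A x y z w = A z w x y \<and>
        A x y z w + A y z x w + A z x y w = 0)"

text \<open>
  The signature of the form is left implicit: every non-degenerate symmetric bilinear form on a
  finite-dimensional space has one.
\<close>

definition curvature_model ::
    "'a::real_vector set \<Rightarrow> ('a \<Rightarrow> 'a \<Rightarrow> real) \<Rightarrow> ('a \<Rightarrow> 'a \<Rightarrow> 'a \<Rightarrow> 'a \<Rightarrow> real) \<Rightarrow> bool" where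
  "curvature_model V ip A \<longleftrightarrow>
     fin_dim_space V \<and> nondegenerate_form V ip \<and> algebraic_curvature_tensor V A"

definition isomorphic_models ::
    "'a::real_vector set \<Rightarrow> ('a \<Rightarrow> 'a \<Rightarrow> real) \<Rightarrow> ('a \<Rightarrow> 'a \<Rightarrow> 'a \<Rightarrow> 'a \<Rightarrow> real) \<Rightarrow>
     'b::real_vector set \<Rightarrow> ('b \<Rightarrow> 'b \<Rightarrow> real) \<Rightarrow> ('b \<Rightarrow> 'b \<Rightarrow> 'b \<Rightarrow> 'b \<Rightarrow> real) \<Rightarrow> bool" where
  "isomorphic_models V\<^sub>1 ip\<^sub>1 A\<^sub>1 V\<^sub>2 ip\<^sub>2 A\<^sub>2 \<longleftrightarrow>
     (\<exists>\<phi>. linear_on V\<^sub>1 \<phi> \<and> bij_betw \<phi> V\<^sub>1 V\<^sub>2 \<and>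
        (\<forall>x\<in>V\<^sub>1. \<forall>y\<in>V\<^sub>1. ip\<^sub>2 (\<phi> x) (\<phi> y) = ip\<^sub>1 x y) \<and>
        (\<forall>x\<in>V\<^sub>1. \<forall>y\<in>V\<^sub>1. \<forall>z\<in>V\<^sub>1. \<forall>w\<in>V\<^sub>1. A\<^sub>2 (\<phi> x) (\<phi> y) (\<phi> z) (\<phi> w) = A\<^sub>1 x y z w))"

definition inv_gram :: "'a::real_vector set \<Rightarrow> ('a \<Rightarrow> 'a \<Rightarrow> real) \<Rightarrow> nat \<Rightarrow> nat \<Rightarrow> real" where
  "inv_gram V ip = inv_matrix (dim V) (\<lambda>i j. ip (frame V i) (frame V j))"

definition ricci_tensor ::
    "'a::real_vector set \<Rightarrow> ('a \<Rightarrow> 'a \<Rightarrow> real) \<Rightarrow> ('a \<Rightarrow> 'a \<Rightarrow> 'a \<Rightarrow> 'a \<Rightarrow> real) \<Rightarrow> 'a \<Rightarrow> 'a \<Rightarrow> real" where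
  "ricci_tensor V ip A x w =
     (\<Sum>j<dim V. \<Sum>k<dim V. inv_gram V ip j k * A x (frame V j) (frame V k) w)"

definition scalar_curvature ::
    "'a::real_vector set \<Rightarrow> ('a \<Rightarrow> 'a \<Rightarrow> real) \<Rightarrow> ('a \<Rightarrow> 'a \<Rightarrow> 'a \<Rightarrow> 'a \<Rightarrow> real) \<Rightarrow> real" where
  "scalar_curvature V ip A =
     (\<Sum>i<dim V. \<Sum>l<dim V. inv_gram V ip i l * ricci_tensor V ip A (frame V i) (frame V l))"

definition weyl_tensor ::
    "'a::real_vector set \<Rightarrow> ('a \<Rightarrow> 'a \<Rightarrow> real) \<Rightarrow> ('a \<Rightarrow> 'a \<Rightarrow> 'a \<Rightarrow> 'a \<Rightarrow> real) \<Rightarrow>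
     'a \<Rightarrow> 'a \<Rightarrow> 'a \<Rightarrow> 'a \<Rightarrow> real" where
  "weyl_tensor V ip A x y z w =
     (let m = real (dim V); \<rho> = ricci_tensor V ip A; \<tau> = scalar_curvature V ip A in
      if dim V \<le> 2 then 0
      else A x y z w
        - 1 / (m - 2) * (\<rho> x w * ip y z - \<rho> x z * ip y w + ip x w * \<rho> y z - ip x z * \<rho> y w)
        + \<tau> / ((m - 1) * (m - 2)) * (ip x w * ip y z - ip x z * ip y w))"

definition conformally_flat_model ::
    "'a::real_vector set \<Rightarrow> ('a \<Rightarrow> 'a \<Rightarrow> real) \<Rightarrow> ('a \<Rightarrow> 'a \<Rightarrow> 'a \<Rightarrow> 'a \<Rightarrow> real) \<Rightarrow> bool" where
  "conformally_flat_model V ip A \<longleftrightarrow>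
     (\<forall>x\<in>V. \<forall>y\<in>V. \<forall>z\<in>V. \<forall>w\<in>V. weyl_tensor V ip A x y z w = 0)"

section \<open>Smooth and real analytic functions of \<open>n\<close> variables\<close>

text \<open>
  \<open>\<real>\<^sup>n\<close> is the library's \<^const>\<open>Euclidean_space\<close> \<open>n\<close>, whose points are the functions
  \<open>nat \<Rightarrow> real\<close> vanishing at all indices \<open>\<ge> n\<close>. The dimension \<open>n = 0\<close> is thereby included.
  The sets \<open>U\<close> below are meant to be open in \<open>Euclidean_space n\<close>.
\<close>

type_synonym coords = "nat \<Rightarrow> real"

definition partial_deriv :: "nat \<Rightarrow> (coords \<Rightarrow> real) \<Rightarrow> coords \<Rightarrow> real" where
  "partial_deriv i f x = deriv (\<lambda>t. f (x(i := t))) (x i)"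

text \<open>Locally the sum of a power series, summed unconditionally over the multi-indices.\<close>

definition real_analytic_on :: "nat \<Rightarrow> coords set \<Rightarrow> (coords \<Rightarrow> real) \<Rightarrow> bool" where
  "real_analytic_on n U f \<longleftrightarrow>
     (\<forall>a\<in>U. \<exists>(c :: (nat \<Rightarrow> nat) \<Rightarrow> real) r. r > 0 \<and>
        (\<forall>x\<in>U. (\<forall>i<n. \<bar>x i - a i\<bar> < r) \<longrightarrow>
           ((\<lambda>\<alpha>. c \<alpha> * (\<Prod>i<n. (x i - a i) ^ \<alpha> i)) has_sum f x) {\<alpha>. \<forall>i\<ge>n. \<alpha> i = 0}))"

text \<open>All iterated partial derivatives exist and are continuous.\<close>

definition smooth_fun_on :: "nat \<Rightarrow> coords set \<Rightarrow> (coords \<Rightarrow> real) \<Rightarrow> bool" where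
  "smooth_fun_on n U f \<longleftrightarrow>
     (\<forall>is. set is \<subseteq> {..<n} \<longrightarrow>
        continuous_map (subtopology (Euclidean_space n) U) euclideanreal (foldr partial_deriv is f) \<and>
        (\<forall>i<n. \<forall>x\<in>U. (\<lambda>t. foldr partial_deriv is f (x(i := t))) differentiable (at (x i))))"

section \<open>Real analytic manifolds\<close>

text \<open>A chart is an open set together with a coordinate map, only used on that set.\<close>

type_synonym 'p chart = "'p set \<times> ('p \<Rightarrow> coords)"

definition transition :: "'p chart \<Rightarrow> 'p chart \<Rightarrow> coords \<Rightarrow> coords" where
  "transition c d x = snd d (inv_into (fst c) (snd c) x)"

definition analytic_manifold :: "nat \<Rightarrow> 'p topology \<Rightarrow> 'p chart set \<Rightarrow> bool" where
  "analytic_manifold n X C \<longleftrightarrow>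
     Hausdorff_space X \<and> second_countable X \<and>
     (\<Union>c\<in>C. fst c) = topspace X \<and>
     (\<forall>(U, \<phi>)\<in>C. openin X U \<and> openin (Euclidean_space n) (\<phi> ` U) \<and>
        homeomorphic_map (subtopology X U) (subtopology (Euclidean_space n) (\<phi> ` U)) \<phi>) \<and>
     (\<forall>c\<in>C. \<forall>d\<in>C. \<forall>k<n.
        real_analytic_on n (snd c ` (fst c \<inter> fst d)) (\<lambda>x. transition c d x k))"

text \<open>
  A tangent vector at \<open>P\<close> is a family of coordinate vectors, one for each chart around \<open>P\<close>, which are
  related by the Jacobians of the transition maps; at all other charts it is set to zero.
\<close>

type_synonym 'p tangent = "'p chart \<Rightarrow> coords"

definition tangent_space :: "nat \<Rightarrow> 'p chart set \<Rightarrow> 'p \<Rightarrow> 'p tangent set" where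
  "tangent_space n C P = {v.
     (\<forall>c. c \<notin> C \<or> P \<notin> fst c \<longrightarrow> v c = 0) \<and>
     (\<forall>c\<in>C. \<forall>k\<ge>n. v c k = 0) \<and>
     (\<forall>c\<in>C. \<forall>d\<in>C. P \<in> fst c \<inter> fst d \<longrightarrow>
        (\<forall>k<n. v d k =
           (\<Sum>i<n. partial_deriv i (\<lambda>x. transition c d x k) (snd c P) * v c i)))}"

text \<open>The coordinate vector field \<open>\<partial>\<^sub>i\<close> of the chart \<open>c\<close> at the point \<open>P\<close>.\<close>

definition coord_vector :: "nat \<Rightarrow> 'p chart set \<Rightarrow> 'p chart \<Rightarrow> nat \<Rightarrow> 'p \<Rightarrow> 'p tangent" where
  "coord_vector n C c i P = (\<lambda>d k.
     if d \<in> C \<and> P \<in> fst d \<and> k < n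
     then partial_deriv i (\<lambda>x. transition c d x k) (snd c P) else 0)"

section \<open>Pseudo-Riemannian metrics\<close>

type_synonym 'p metric_field = "'p \<Rightarrow> 'p tangent \<Rightarrow> 'p tangent \<Rightarrow> real"

definition metric_coeff ::
    "nat \<Rightarrow> 'p chart set \<Rightarrow> 'p metric_field \<Rightarrow> 'p chart \<Rightarrow> nat \<Rightarrow> nat \<Rightarrow> coords \<Rightarrow> real" where
  "metric_coeff n C g c i j x =
     (let P = inv_into (fst c) (snd c) x in g P (coord_vector n C c i P) (coord_vector n C c j P))"

text \<open>
  Metrics on an open set \<open>S\<close> of the manifold; the parameter \<open>reg\<close> is the regularity class required of
  the coefficient functions, and will be \<^const>\<open>real_analytic_on\<close> or \<^const>\<open>smooth_fun_on\<close>.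
\<close>

definition pseudo_riemannian_metric_on ::
    "(nat \<Rightarrow> coords set \<Rightarrow> (coords \<Rightarrow> real) \<Rightarrow> bool) \<Rightarrow>
     nat \<Rightarrow> 'p chart set \<Rightarrow> 'p set \<Rightarrow> 'p metric_field \<Rightarrow> bool" where
  "pseudo_riemannian_metric_on reg n C S g \<longleftrightarrow>
     (\<forall>P\<in>S. nondegenerate_form (tangent_space n C P) (g P)) \<and>
     (\<exists>p q. \<forall>P\<in>S. has_signature (tangent_space n C P) (g P) p q) \<and>
     (\<forall>c\<in>C. \<forall>i<n. \<forall>j<n. reg n (snd c ` (fst c \<inter> S)) (metric_coeff n C g c i j))"

subsection \<open>The Levi-Civita connection and curvature in a coordinate system\<close>

text \<open>
  Here \<open>G i j\<close> are the coefficient functions of a metric on an open set of \<open>\<real>\<^sup>n\<close>, and vector fields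
  are given by their component functions.
\<close>

definition christoffel ::
    "nat \<Rightarrow> (nat \<Rightarrow> nat \<Rightarrow> coords \<Rightarrow> real) \<Rightarrow> nat \<Rightarrow> nat \<Rightarrow> nat \<Rightarrow> coords \<Rightarrow> real" where
  "christoffel n G i j k x =
     (\<Sum>l<n. 1 / 2 * inv_matrix n (\<lambda>a b. G a b x) k l *
        (partial_deriv i (G j l) x + partial_deriv j (G i l) x - partial_deriv l (G i j) x))"

definition levi_civita ::
    "nat \<Rightarrow> (nat \<Rightarrow> nat \<Rightarrow> coords \<Rightarrow> real) \<Rightarrow>
     (coords \<Rightarrow> coords) \<Rightarrow> (coords \<Rightarrow> coords) \<Rightarrow> (coords \<Rightarrow> coords)" where
  "levi_civita n G X Y = (\<lambda>x k.
     \<Sum>i<n. X x i * (partial_deriv i (\<lambda>u. Y u k) x + (\<Sum>j<n. christoffel n G i j k x * Y x j)))"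

definition lie_bracket ::
    "nat \<Rightarrow> (coords \<Rightarrow> coords) \<Rightarrow> (coords \<Rightarrow> coords) \<Rightarrow> (coords \<Rightarrow> coords)" where
  "lie_bracket n X Y = (\<lambda>x k.
     \<Sum>i<n. X x i * partial_deriv i (\<lambda>u. Y u k) x - Y x i * partial_deriv i (\<lambda>u. X u k) x)"

definition curvature_operator ::
    "nat \<Rightarrow> (nat \<Rightarrow> nat \<Rightarrow> coords \<Rightarrow> real) \<Rightarrow>
     (coords \<Rightarrow> coords) \<Rightarrow> (coords \<Rightarrow> coords) \<Rightarrow> (coords \<Rightarrow> coords) \<Rightarrow> (coords \<Rightarrow> coords)" where
  "curvature_operator n G X Y Z =
     levi_civita n G X (levi_civita n G Y Z) - levi_civita n G Y (levi_civita n G X Z)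
       - levi_civita n G (lie_bracket n X Y) Z"

subsection \<open>The curvature tensor\<close>

text \<open>
  \<open>R(x, y, z, w) = g((\<nabla>\<^sub>x \<nabla>\<^sub>y - \<nabla>\<^sub>y \<nabla>\<^sub>x - \<nabla>\<^bsub>[x,y]\<^esub>) z, w)\<close> at \<open>P\<close>, evaluated in a chart around \<open>P\<close> after
  extending the tangent vectors \<open>x, y, z\<close> to vector fields with constant components in that chart.
  The result depends neither on the chart nor on the extension.
\<close>

definition curvature_tensor ::
    "nat \<Rightarrow> 'p chart set \<Rightarrow> 'p metric_field \<Rightarrow>
     'p \<Rightarrow> 'p tangent \<Rightarrow> 'p tangent \<Rightarrow> 'p tangent \<Rightarrow> 'p tangent \<Rightarrow> real" where
  "curvature_tensor n C g P x y z w =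
     (let c = (SOME c. c \<in> C \<and> P \<in> fst c);
          r = curvature_operator n (metric_coeff n C g c) (\<lambda>_. x c) (\<lambda>_. y c) (\<lambda>_. z c) (snd c P)
      in g P (\<Sum>k<n. r k *\<^sub>R coord_vector n C c k P) w)"

definition constant_scalar_curvature ::
    "nat \<Rightarrow> 'p topology \<Rightarrow> 'p chart set \<Rightarrow> 'p metric_field \<Rightarrow> bool" where
  "constant_scalar_curvature n X C g \<longleftrightarrow>
     (\<exists>\<tau>. \<forall>Q\<in>topspace X.
        scalar_curvature (tangent_space n C Q) (g Q) (curvature_tensor n C g Q) = \<tau>)"

definition flat_on :: "nat \<Rightarrow> 'p chart set \<Rightarrow> 'p set \<Rightarrow> 'p metric_field \<Rightarrow> bool" where
  "flat_on n C S g \<longleftrightarrow>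
     (\<forall>Q\<in>S. \<forall>x\<in>tangent_space n C Q. \<forall>y\<in>tangent_space n C Q.
        \<forall>z\<in>tangent_space n C Q. \<forall>w\<in>tangent_space n C Q. curvature_tensor n C g Q x y z w = 0)"

definition conformally_flat_manifold ::
    "nat \<Rightarrow> 'p topology \<Rightarrow> 'p chart set \<Rightarrow> 'p metric_field \<Rightarrow> bool" where
  "conformally_flat_manifold n X C g \<longleftrightarrow>
     (\<forall>P\<in>topspace X. \<exists>S h g\<^sub>0. openin X S \<and> P \<in> S \<and>
        (\<forall>Q\<in>S. h Q > (0::real)) \<and>
        (\<forall>c\<in>C. smooth_fun_on n (snd c ` (fst c \<inter> S)) (\<lambda>x. h (inv_into (fst c) (snd c) x))) \<and>
        pseudo_riemannian_metric_on smooth_fun_on n C S g\<^sub>0 \<and> flat_on n C S g\<^sub>0 \<and>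
        (\<forall>Q\<in>S. \<forall>v\<in>tangent_space n C Q. \<forall>w\<in>tangent_space n C Q. g Q v w = h Q * g\<^sub>0 Q v w))"

definition analytic_pseudo_riemannian_manifold ::
    "nat \<Rightarrow> 'p topology \<Rightarrow> 'p chart set \<Rightarrow> 'p metric_field \<Rightarrow> bool" where
  "analytic_pseudo_riemannian_manifold n X C g \<longleftrightarrow>
     analytic_manifold n X C \<and> pseudo_riemannian_metric_on real_analytic_on n C (topspace X) g"

end

theory Submission
  imports Defs
begin

text \<open>
  In an orthonormal basis a conformally flat curvature model is the Kulkarni--Nomizu product of the
  metric with a symmetric matrix \<open>H\<close> (its Schouten tensor). For a function \<open>F\<close> on a neighbourhood of the
  origin in pseudo-Euclidean space, the metric \<open>F\<^sup>-\<^sup>2 \<langle>\<cdot>,\<cdot>\<rangle>\<close> has Schouten tensor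
  \<open>Hess F / F - |dF|\<^sup>2 / (2 F\<^sup>2) \<langle>\<cdot>,\<cdot>\<rangle>\<close> and scalar curvature \<open>(n - 1) (2 F \<Delta>F - n |dF|\<^sup>2)\<close>. It therefore
  suffices to solve \<open>2 F \<Delta>F - n |dF|\<^sup>2 = 2 tr H\<close> analytically with \<open>F = 1\<close>, \<open>dF = 0\<close>, \<open>Hess F = H\<close> at the
  origin. This is a Cauchy problem in the direction of the coordinate \<open>0\<close>; its formal power series
  solution is shown to converge by estimating the homogeneous parts in the norms
  \<open>\<Sum> |c\<^sub>\<alpha>| / (k choose \<alpha>\<^sub>0)\<close>, which are submultiplicative and in which \<open>\<Delta>\<close> can be inverted
  without loss.
\<close>

section \<open>Formal solution of the scalar curvature equation\<close>

text \<open>Matching the curvature at one point prescribes only the 2-jet of \<open>F\<close>, and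
  any function with that jet would do; it is the constancy of the scalar curvature nearby that leads
  to a differential equation. Taking the conformal factor as \<open>F^-2\<close> instead of an
  exponential absorbs the square of \<open>dF\<close> that the Schouten tensor of an exponential
  factor contains, and makes the equation quadratic in \<open>F\<close>, so that the coefficient
  recursions involve nothing but convolutions. The signature is arbitrary, so the equation need not
  be elliptic; direction 0 is still non-characteristic, because \<open>\<epsilon> 0\<close> is a
  sign. The leading term \<open>F \<Delta>F\<close> is nonlinear; it is split as
  \<open>\<Delta>F + (F - 1) \<Delta>F\<close>, and as \<open>F - 1\<close> starts in degree two,
  the second summand involves only parts of \<open>\<Delta>F\<close> of lower degree. The prescribed
  Hessian does not overdetermine the Cauchy problem: the data fix all of \<open>H\<close> except the
  entry \<open>H 0 0\<close>, and the equation at the origin, a statement about traces, supplies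
  that entry.\<close>

definition multi_idx :: "nat \<Rightarrow> (nat \<Rightarrow> nat) set" where
  "multi_idx n = {\<alpha>. \<forall>i\<ge>n. \<alpha> i = 0}"

definition deg :: "nat \<Rightarrow> (nat \<Rightarrow> nat) \<Rightarrow> nat" where
  "deg n \<alpha> = (\<Sum>i<n. \<alpha> i)"

definition level :: "nat \<Rightarrow> nat \<Rightarrow> (nat \<Rightarrow> nat) set" where
  "level n k = {\<alpha> \<in> multi_idx n. deg n \<alpha> = k}"

text \<open>A formal power series is given by its coefficients, indexed by the exponents \<open>\<alpha> \<in> multi_idx n\<close>. On
  coefficients, multiplication is \<open>conv\<close>, multiplication of a monomial by \<open>x\<^sub>i\<close> is \<open>up i\<close>, \<open>\<partial>\<^sub>i\<close> is \<open>pd i\<close>, and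
  \<open>\<Sum>\<^sub>i \<epsilon>\<^sub>i \<partial>\<^sub>i\<^sup>2\<close> is \<open>lap n \<epsilon>\<close>.\<close>

definition conv :: "((nat \<Rightarrow> nat) \<Rightarrow> real) \<Rightarrow> ((nat \<Rightarrow> nat) \<Rightarrow> real) \<Rightarrow> (nat \<Rightarrow> nat) \<Rightarrow> real" where
  "conv f g \<alpha> = (\<Sum>\<beta>\<in>{..\<alpha>}. f \<beta> * g (\<alpha> - \<beta>))"

definition up :: "nat \<Rightarrow> (nat \<Rightarrow> nat) \<Rightarrow> nat \<Rightarrow> nat" where
  "up i \<alpha> = \<alpha>(i := Suc (\<alpha> i))"

definition pd :: "nat \<Rightarrow> ((nat \<Rightarrow> nat) \<Rightarrow> real) \<Rightarrow> (nat \<Rightarrow> nat) \<Rightarrow> real" where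
  "pd i f \<alpha> = real (Suc (\<alpha> i)) * f (up i \<alpha>)"

definition lap :: "nat \<Rightarrow> (nat \<Rightarrow> real) \<Rightarrow> ((nat \<Rightarrow> nat) \<Rightarrow> real) \<Rightarrow> (nat \<Rightarrow> nat) \<Rightarrow> real" where
  "lap n \<epsilon> f \<alpha> = (\<Sum>i<n. \<epsilon> i * pd i (pd i f) \<alpha>)"

text \<open>With the plain sum of absolute values, trading two powers of \<open>x_0\<close> for two
  powers of the other variables would multiply the bounds by ratios of falling factorials that
  accumulate along the recursion. The weight depends on \<open>\<alpha> 0\<close> alone and cancels
  exactly these ratios.\<close>

definition wnorm :: "nat \<Rightarrow> nat \<Rightarrow> ((nat \<Rightarrow> nat) \<Rightarrow> real) \<Rightarrow> real" where
  "wnorm n k f = (\<Sum>\<alpha>\<in>level n k. \<bar>f \<alpha>\<bar> / real (k choose \<alpha> 0))"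

section \<open>Multi-indices and their degrees\<close>

lemma up_apply: "up i \<alpha> j = (if j = i then Suc (\<alpha> i) else \<alpha> j)"
  by (simp add: up_def)

lemma inj_up: "inj (up i)"
proof (rule injI)
  fix \<alpha> \<beta> assume eq: "up i \<alpha> = up i \<beta>"
  show "\<alpha> = \<beta>"
  proof
    fix j show "\<alpha> j = \<beta> j" using fun_cong[OF eq, of j] by (simp add: up_apply split: if_splits)
  qed
qed

lemma up_commute: "up i (up j \<alpha>) = up j (up i \<alpha>)"
  by (auto simp: up_def fun_eq_iff)

lemma up_in_multi_idx: "i < n \<Longrightarrow> up i \<alpha> \<in> multi_idx n \<longleftrightarrow> \<alpha> \<in> multi_idx n"
  by (auto simp: multi_idx_def up_apply)

lemma deg_up: "i < n \<Longrightarrow> deg n (up i \<alpha>) = Suc (deg n \<alpha>)"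
proof -
  assume "i < n"
  then have "deg n (up i \<alpha>) = (\<Sum>j<n. \<alpha> j + (if j = i then 1 else 0))"
    unfolding deg_def by (intro sum.cong) (auto simp: up_apply)
  also have "\<dots> = Suc (deg n \<alpha>)" using \<open>i < n\<close> by (simp add: sum.distrib deg_def)
  finally show ?thesis .
qed

lemma up_in_level: "i < n \<Longrightarrow> up i \<alpha> \<in> level n (Suc k) \<longleftrightarrow> \<alpha> \<in> level n k"
  by (simp add: level_def up_in_multi_idx deg_up)

lemma index_le_deg: "\<alpha> \<in> multi_idx n \<Longrightarrow> \<alpha> i \<le> deg n \<alpha>"
  using member_le_sum[of i "{..<n}" \<alpha>] by (cases "i < n") (auto simp: multi_idx_def deg_def)

lemma deg_mono: "\<beta> \<le> \<alpha> \<Longrightarrow> deg n \<beta> \<le> deg n \<alpha>"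
  unfolding deg_def le_fun_def by (intro sum_mono) simp

lemma deg_diff: "\<beta> \<le> \<alpha> \<Longrightarrow> deg n (\<alpha> - \<beta>) = deg n \<alpha> - deg n \<beta>"
  unfolding deg_def fun_diff_def le_fun_def by (intro sum_subtractf_nat) simp

lemma deg_add: "deg n (\<alpha> + \<beta>) = deg n \<alpha> + deg n \<beta>"
  unfolding deg_def by (simp add: plus_fun_def sum.distrib)

lemma multi_idx_le: "\<beta> \<le> \<alpha> \<Longrightarrow> \<alpha> \<in> multi_idx n \<Longrightarrow> \<beta> \<in> multi_idx n"
proof -
  assume le: "\<beta> \<le> \<alpha>" and m: "\<alpha> \<in> multi_idx n"
  have "\<beta> i = 0" if "i \<ge> n" for i
    using le_funD[OF le, of i] m that by (simp add: multi_idx_def)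
  then show ?thesis by (simp add: multi_idx_def)
qed

lemma multi_idx_diff: "\<alpha> \<in> multi_idx n \<Longrightarrow> \<alpha> - \<beta> \<in> multi_idx n"
  by (simp add: multi_idx_def fun_diff_def)

lemma multi_idx_add: "\<alpha> \<in> multi_idx n \<Longrightarrow> \<beta> \<in> multi_idx n \<Longrightarrow> \<alpha> + \<beta> \<in> multi_idx n"
  by (simp add: multi_idx_def plus_fun_def)

lemma zero_in_multi_idx [simp]: "0 \<in> multi_idx n"
  by (simp add: multi_idx_def)

lemma deg_zero [simp]: "deg n 0 = 0"
  by (simp add: deg_def)

lemma deg_eq_0_iff: "\<alpha> \<in> multi_idx n \<Longrightarrow> deg n \<alpha> = 0 \<longleftrightarrow> \<alpha> = 0"
  using index_le_deg[of \<alpha> n] by (auto simp: fun_eq_iff deg_def)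

lemma deg_strict_mono:
  assumes "\<beta> \<le> \<alpha>" "\<beta> \<noteq> \<alpha>" "\<alpha> \<in> multi_idx n"
  shows "deg n \<beta> < deg n \<alpha>"
proof -
  obtain i where "\<beta> i \<noteq> \<alpha> i" using assms(2) by auto
  then have i: "\<beta> i < \<alpha> i" using assms(1) by (simp add: le_fun_def order_less_le)
  then have "i < n" using assms(3) unfolding multi_idx_def by (cases "n \<le> i") auto
  then show ?thesis unfolding deg_def
    using i assms(1) by (intro sum_strict_mono_ex1) (auto simp: le_fun_def)
qed

lemma finite_bounded_multi_idx: "finite {\<alpha> \<in> multi_idx n. \<forall>i. \<alpha> i \<le> k}"
proof -
  have "finite (PiE {..<n} (\<lambda>_. {..k}))" by (intro finite_PiE) auto
  moreover have "{\<alpha> \<in> multi_idx n. \<forall>i. \<alpha> i \<le> k} \<subseteq> (\<lambda>f i. if i < n then f i else 0) ` PiE {..<n} (\<lambda>_. {..k})"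
  proof
    fix \<alpha> assume \<alpha>: "\<alpha> \<in> {\<alpha> \<in> multi_idx n. \<forall>i. \<alpha> i \<le> k}"
    have "\<alpha> = (\<lambda>i. if i < n then restrict \<alpha> {..<n} i else 0)"
      using \<alpha> by (auto simp: multi_idx_def fun_eq_iff)
    moreover have "restrict \<alpha> {..<n} \<in> PiE {..<n} (\<lambda>_. {..k})" using \<alpha> by auto
    ultimately show "\<alpha> \<in> (\<lambda>f i. if i < n then f i else 0) ` PiE {..<n} (\<lambda>_. {..k})" by blast
  qed
  ultimately show ?thesis by (meson finite_surj)
qed

lemma finite_level [simp]: "finite (level n k)"
proof (rule finite_subset[OF _ finite_bounded_multi_idx[of n k]])
  show "level n k \<subseteq> {\<alpha> \<in> multi_idx n. \<forall>i. \<alpha> i \<le> k}"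
    unfolding level_def using index_le_deg[where n = n] by blast
qed

lemma finite_atMost_multi_idx:
  assumes "\<alpha> \<in> multi_idx n"
  shows "finite {..\<alpha>}"
proof (rule finite_subset[OF _ finite_bounded_multi_idx[of n "deg n \<alpha>"]], rule subsetI)
  fix \<beta> assume "\<beta> \<in> {..\<alpha>}"
  then have b: "\<beta> \<le> \<alpha>" by simp
  have m: "\<beta> \<in> multi_idx n" using b assms by (rule multi_idx_le)
  have "\<beta> i \<le> deg n \<alpha>" for i
    using index_le_deg[OF m] deg_mono[OF b] by (rule order_trans)
  then show "\<beta> \<in> {\<beta> \<in> multi_idx n. \<forall>i. \<beta> i \<le> deg n \<alpha>}" using m by simp
qed

lemma level_0: "level n 0 = {0}"
  by (auto simp: level_def deg_eq_0_iff)

section \<open>Estimates in the weighted norms\<close>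

lemma wnorm_nonneg: "0 \<le> wnorm n k f"
  unfolding wnorm_def by (intro sum_nonneg) auto

lemma level_index0_le: "\<alpha> \<in> level n k \<Longrightarrow> \<alpha> i \<le> k"
  using index_le_deg by (auto simp: level_def)

lemma wnorm_cong: "(\<And>\<alpha>. \<alpha> \<in> level n k \<Longrightarrow> f \<alpha> = g \<alpha>) \<Longrightarrow> wnorm n k f = wnorm n k g"
  unfolding wnorm_def by (intro sum.cong) auto

lemma wnorm_triangle: "wnorm n k (\<lambda>\<alpha>. f \<alpha> + g \<alpha>) \<le> wnorm n k f + wnorm n k g"
  unfolding wnorm_def sum.distrib[symmetric]
  by (intro sum_mono) (simp add: add_divide_distrib[symmetric] divide_right_mono)

lemma wnorm_scale: "wnorm n k (\<lambda>\<alpha>. a * f \<alpha>) = \<bar>a\<bar> * wnorm n k f"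
  unfolding wnorm_def sum_distrib_left by (simp add: abs_mult)

lemma wnorm_sum: "finite I \<Longrightarrow> wnorm n k (\<lambda>\<alpha>. \<Sum>i\<in>I. f i \<alpha>) \<le> (\<Sum>i\<in>I. wnorm n k (f i))"
proof (induction I rule: finite_induct)
  case empty then show ?case by (simp add: wnorm_def)
next
  case (insert x F) 
  have "wnorm n k (\<lambda>\<alpha>. \<Sum>i\<in>insert x F. f i \<alpha>) = wnorm n k (\<lambda>\<alpha>. f x \<alpha> + (\<Sum>i\<in>F. f i \<alpha>))"
    using insert by simp
  also have "\<dots> \<le> wnorm n k (f x) + wnorm n k (\<lambda>\<alpha>. \<Sum>i\<in>F. f i \<alpha>)" by (rule wnorm_triangle)
  finally show ?case using insert by simp
qed

lemma binomial_mult_le: "a \<le> i \<Longrightarrow> b \<le> j \<Longrightarrow> (i choose a) * (j choose b) \<le> (i + j) choose (a + b)"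
proof -
  have "(i choose a) * (j choose (a + b - a)) \<le> (\<Sum>k\<le>a + b. (i choose k) * (j choose (a + b - k)))"
    by (intro member_le_sum[of a "{..a+b}" "\<lambda>k. (i choose k) * (j choose (a + b - k))"]) auto
  then show ?thesis by (simp add: vandermonde)
qed

text \<open>The weights \<open>1 / (k choose \<alpha> 0)\<close> are submultiplicative by Vandermonde's identity.\<close>

lemma wnorm_conv_le:
  "wnorm n k (conv f g) \<le> (\<Sum>i\<le>k. wnorm n i f * wnorm n (k - i) g)"
proof -
  let ?w = "\<lambda>k \<alpha>. 1 / real (k choose (\<alpha> (0::nat)))"
  let ?t = "\<lambda>\<beta> \<gamma>. \<bar>f \<beta>\<bar> * ?w (deg n \<beta>) \<beta> * (\<bar>g \<gamma>\<bar> * ?w (deg n \<gamma>) \<gamma>)"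
  have "wnorm n k (conv f g) \<le> (\<Sum>\<alpha>\<in>level n k. \<Sum>\<beta>\<in>{..\<alpha>}. ?t \<beta> (\<alpha> - \<beta>))"
    unfolding wnorm_def
  proof (rule sum_mono)
    fix \<alpha> assume \<alpha>: "\<alpha> \<in> level n k"
    then have m: "\<alpha> \<in> multi_idx n" and d: "deg n \<alpha> = k" by (auto simp: level_def)
    have "\<bar>conv f g \<alpha>\<bar> / real (k choose \<alpha> 0) \<le> (\<Sum>\<beta>\<in>{..\<alpha>}. \<bar>f \<beta> * g (\<alpha> - \<beta>)\<bar> / real (k choose \<alpha> 0))"
      unfolding conv_def sum_divide_distrib[symmetric] by (intro divide_right_mono sum_abs) auto
    also have "\<dots> \<le> (\<Sum>\<beta>\<in>{..\<alpha>}. ?t \<beta> (\<alpha> - \<beta>))"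
    proof (rule sum_mono)
      fix \<beta> assume "\<beta> \<in> {..\<alpha>}"
      then have b: "\<beta> \<le> \<alpha>" by simp
      have mb: "\<beta> \<in> multi_idx n" using b m by (rule multi_idx_le)
      have mg: "\<alpha> - \<beta> \<in> multi_idx n" using m by (rule multi_idx_diff)
      have b0: "\<beta> 0 \<le> \<alpha> 0" using b by (simp add: le_fun_def)
      have s: "deg n \<beta> + deg n (\<alpha> - \<beta>) = k" using deg_diff[OF b, of n] deg_mono[OF b, of n] d by linarith
      have i1: "\<beta> 0 \<le> deg n \<beta>" and i2: "(\<alpha> - \<beta>) 0 \<le> deg n (\<alpha> - \<beta>)"
        using mb mg index_le_deg by blast+
      have s0: "\<beta> 0 + (\<alpha> - \<beta>) 0 = \<alpha> 0" using b0 by (simp add: fun_diff_def)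
      have le: "(deg n \<beta> choose \<beta> 0) * (deg n (\<alpha> - \<beta>) choose (\<alpha> - \<beta>) 0) \<le> k choose \<alpha> 0"
        using binomial_mult_le[OF i1 i2] unfolding s s0 .
      have "1 / real (k choose \<alpha> 0) \<le> 1 / (real (deg n \<beta> choose \<beta> 0) * real (deg n (\<alpha> - \<beta>) choose (\<alpha> - \<beta>) 0))"
        using le i1 i2 level_index0_le[OF \<alpha>, of 0]
        by (intro divide_left_mono) (auto simp: of_nat_mult[symmetric] simp del: of_nat_mult intro!: mult_pos_pos zero_less_binomial)
      then have "\<bar>f \<beta> * g (\<alpha> - \<beta>)\<bar> * (1 / real (k choose \<alpha> 0)) \<le> \<bar>f \<beta> * g (\<alpha> - \<beta>)\<bar> * (1 / (real (deg n \<beta> choose \<beta> 0) * real (deg n (\<alpha> - \<beta>) choose (\<alpha> - \<beta>) 0)))"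
        by (rule mult_left_mono) auto
      then show "\<bar>f \<beta> * g (\<alpha> - \<beta>)\<bar> / real (k choose \<alpha> 0) \<le> ?t \<beta> (\<alpha> - \<beta>)"
        by (simp add: abs_mult)
    qed
    finally show "\<bar>conv f g \<alpha>\<bar> / real (k choose \<alpha> 0) \<le> (\<Sum>\<beta>\<in>{..\<alpha>}. ?t \<beta> (\<alpha> - \<beta>))" .
  qed
  also have "\<dots> = (\<Sum>(\<alpha>,\<beta>)\<in>Sigma (level n k) (\<lambda>\<alpha>. {..\<alpha>}). ?t \<beta> (\<alpha> - \<beta>))"
    by (rule sum.Sigma) (simp, use finite_atMost_multi_idx[of _ n] in \<open>auto simp: level_def\<close>)
  \<comment> \<open>A multi-index together with a smaller one is a pair of summands, here sorted by
    the degree of the first summand.\<close>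
  also have "\<dots> = (\<Sum>(i,\<beta>,\<gamma>)\<in>Sigma {..k} (\<lambda>i. level n i \<times> level n (k - i)). ?t \<beta> \<gamma>)"
  proof (rule sum.reindex_bij_witness[of _ "\<lambda>(i,\<beta>,\<gamma>). (\<beta> + \<gamma>, \<beta>)" "\<lambda>(\<alpha>,\<beta>). (deg n \<beta>, \<beta>, \<alpha> - \<beta>)"], goal_cases)
    case (1 a) then show ?case by (auto simp: level_def fun_eq_iff le_fun_def)
  next
    case (2 a) then show ?case
      by (auto simp: level_def deg_diff deg_mono multi_idx_diff intro: multi_idx_le)
  next
    case (3 a) then show ?case by (auto simp: level_def fun_eq_iff)
  next
    case (4 a) then show ?case by (auto simp: level_def deg_add multi_idx_add le_fun_def)
  next
    case (5 a) then show ?case by auto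
  qed
  also have "\<dots> = (\<Sum>i\<le>k. \<Sum>(\<beta>,\<gamma>)\<in>level n i \<times> level n (k - i). ?t \<beta> \<gamma>)"
    by (subst sum.Sigma[symmetric]) auto
  also have "\<dots> = (\<Sum>i\<le>k. wnorm n i f * wnorm n (k - i) g)"
  proof (rule sum.cong[OF refl])
    fix i assume "i \<in> {..k}"
    have "(\<Sum>(\<beta>,\<gamma>)\<in>level n i \<times> level n (k - i). ?t \<beta> \<gamma>) = 
      (\<Sum>\<beta>\<in>level n i. \<Sum>\<gamma>\<in>level n (k - i). \<bar>f \<beta>\<bar> / real (i choose \<beta> 0) * (\<bar>g \<gamma>\<bar> / real ((k-i) choose \<gamma> 0)))"
      by (subst sum.cartesian_product) (auto intro!: sum.cong simp: level_def)
    then show "(\<Sum>(\<beta>,\<gamma>)\<in>level n i \<times> level n (k - i). ?t \<beta> \<gamma>) = wnorm n i f * wnorm n (k - i) g"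
      unfolding wnorm_def by (simp only: sum_product)
  qed
  finally show ?thesis .
qed

text \<open>The factor \<open>\<alpha> i + 1\<close> is absorbed by the change of weight. For
  \<open>i = 0\<close> this is the absorption identity for binomial coefficients; for other
  \<open>i\<close> one uses \<open>\<alpha> i \<le> k - \<alpha> 0\<close> and the companion
  identity that lowers only the upper index.\<close>

lemma wnorm_pd_le:
  assumes "i < n"
  shows "wnorm n k (pd i f) \<le> real (Suc k) * wnorm n (Suc k) f"
proof -
  have "wnorm n k (pd i f) \<le> (\<Sum>\<alpha>\<in>level n k. real (Suc k) * (\<bar>f (up i \<alpha>)\<bar> / real (Suc k choose (up i \<alpha> 0))))"
    unfolding wnorm_def
  proof (rule sum_mono)
    fix \<alpha> assume \<alpha>: "\<alpha> \<in> level n k"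
    then have m: "\<alpha> \<in> multi_idx n" and d: "deg n \<alpha> = k" by (auto simp: level_def)
    have a0: "\<alpha> 0 \<le> k" using \<alpha> by (rule level_index0_le)
    have u: "up i \<alpha> \<in> level n (Suc k)" using \<alpha> assms by (simp add: up_in_level)
    have key: "Suc (\<alpha> i) * (Suc k choose (up i \<alpha> 0)) \<le> Suc k * (k choose \<alpha> 0)"
    proof (cases "i = 0")
      case True
      then show ?thesis using Suc_times_binomial_eq[of k "\<alpha> 0"] by (simp add: up_apply)
    next
      case False
      have "\<alpha> 0 + \<alpha> i = (\<Sum>j\<in>{0,i}. \<alpha> j)" using False by simp
      also have "\<dots> \<le> deg n \<alpha>" unfolding deg_def using assms by (intro sum_mono2) auto
      finally have le: "\<alpha> i \<le> k - \<alpha> 0" using d by simp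
      have "Suc (\<alpha> i) * (Suc k choose \<alpha> 0) \<le> (Suc k - \<alpha> 0) * (Suc k choose \<alpha> 0)"
        using le a0 by (intro mult_right_mono) auto
      also have "\<dots> = Suc k * (k choose \<alpha> 0)"
        using binomial_absorb_comp[of "Suc k" "\<alpha> 0"] by simp
      finally show ?thesis using False by (simp add: up_apply)
    qed
    have p1: "0 < real (k choose \<alpha> 0)" using a0 by simp
    have p2: "0 < real (Suc k choose (up i \<alpha> 0))"
      using level_index0_le[OF u, of 0] by (simp add: zero_less_binomial del: binomial_Suc_Suc)
    have "real (Suc (\<alpha> i)) * real (Suc k choose (up i \<alpha> 0)) \<le> real (Suc k) * real (k choose \<alpha> 0)"
      using key unfolding of_nat_mult[symmetric] of_nat_le_iff .
    then have "real (Suc (\<alpha> i)) / real (k choose \<alpha> 0) \<le> real (Suc k) / real (Suc k choose (up i \<alpha> 0))"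
      using p1 p2 by (simp add: field_simps del: binomial_Suc_Suc of_nat_Suc)
    then have "\<bar>f (up i \<alpha>)\<bar> * (real (Suc (\<alpha> i)) / real (k choose \<alpha> 0)) \<le> \<bar>f (up i \<alpha>)\<bar> * (real (Suc k) / real (Suc k choose (up i \<alpha> 0)))"
      by (rule mult_left_mono) auto
    then show "\<bar>pd i f \<alpha>\<bar> / real (k choose \<alpha> 0) \<le> real (Suc k) * (\<bar>f (up i \<alpha>)\<bar> / real (Suc k choose (up i \<alpha> 0)))"
      by (simp add: pd_def abs_mult mult.commute del: binomial_Suc_Suc of_nat_Suc)
  qed
  also have "\<dots> = real (Suc k) * (\<Sum>\<alpha>\<in>up i ` level n k. \<bar>f \<alpha>\<bar> / real (Suc k choose \<alpha> 0))"
    by (subst sum.reindex) (auto simp: sum_distrib_left inj_on_subset[OF inj_up])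
  also have "\<dots> \<le> real (Suc k) * wnorm n (Suc k) f"
    unfolding wnorm_def using assms
    by (intro mult_left_mono sum_mono2) (auto simp: up_in_level)
  finally show ?thesis .
qed


text \<open>The Cauchy--Kovalevskaya estimate: solving the second order equation in the direction \<open>0\<close>, with
  zero Cauchy data, gains two degrees without loss in the weighted norms. The rescaled layer sums
  \<open>s a\<close> over the monomials with \<open>\<alpha> 0 = a\<close> can be estimated by telescoping.\<close>

lemma wnorm_le_lap:
  assumes n: "0 < n" and eps: "\<And>i. i < n \<Longrightarrow> \<bar>\<epsilon> i\<bar> = 1"
    and data: "\<And>\<alpha>. \<alpha> \<in> level n (k + 2) \<Longrightarrow> \<alpha> 0 < 2 \<Longrightarrow> f \<alpha> = 0"
  shows "real (k + 2) * wnorm n (k + 2) f \<le> wnorm n k (lap n \<epsilon> f)"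
proof -
  define L where "L = (\<lambda>k a. {\<alpha> \<in> level n k. \<alpha> 0 = a})"
  define M where "M = (\<lambda>a. \<Sum>\<alpha>\<in>L (k+2) a. \<bar>f \<alpha>\<bar>)"
  define H where "H = (\<lambda>a. \<Sum>\<alpha>\<in>L k a. \<bar>lap n \<epsilon> f \<alpha>\<bar>)"
  define s where "s = (\<lambda>a. M a / real ((k+2) choose a))"
  define t where "t = (\<lambda>a. H a / real (k choose a))"
  have fin: "finite (L j a)" for j a by (simp add: L_def)
  have H0: "0 \<le> H a" for a unfolding H_def by (intro sum_nonneg) auto
  then have t0: "0 \<le> t a" for a by (simp add: t_def)
  have split: "wnorm n j g = (\<Sum>a\<le>j. (\<Sum>\<alpha>\<in>L j a. \<bar>g \<alpha>\<bar>) / real (j choose a))" for j g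
  proof -
    have "wnorm n j g = (\<Sum>a\<in>{..j}. \<Sum>\<alpha>\<in>{\<alpha> \<in> level n j. \<alpha> 0 = a}. \<bar>g \<alpha>\<bar> / real (j choose \<alpha> 0))"
      unfolding wnorm_def by (rule sum.group[symmetric]) (auto dest: level_index0_le)
    also have "\<dots> = (\<Sum>a\<le>j. (\<Sum>\<alpha>\<in>L j a. \<bar>g \<alpha>\<bar>) / real (j choose a))"
      unfolding L_def sum_divide_distrib by (intro sum.cong) auto
    finally show ?thesis .
  qed
  \<comment> \<open>Coefficients with exponent \<open>a + 2\<close> of variable 0 are obtained by
    solving the equation for the second derivative in that direction. The other second derivatives
    stay within layer \<open>a\<close>, where the remaining exponents add up to
    \<open>k + 2 - a\<close>; hence the sum of all \<open>\<gamma> i * (\<gamma> i - 1)\<close> is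
    at most \<open>(k + 2 - a) * (k + 1 - a)\<close>.\<close>
  have layer: "real ((a+2)*(a+1)) * M (a+2) \<le> H a + real ((k+2-a)*(k+1-a)) * M a" if a: "a \<le> k" for a
  proof -
    have pdd: "pd i (pd i f) \<alpha> = real ((\<alpha> i + 2) * (\<alpha> i + 1)) * f (up i (up i \<alpha>))" for i \<alpha>
      by (simp add: pd_def up_apply algebra_simps)
    have abs_pdd: "\<bar>pd i (pd i f) \<alpha>\<bar> = real (up i (up i \<alpha>) i * (up i (up i \<alpha>) i - 1)) * \<bar>f (up i (up i \<alpha>))\<bar>" for i \<alpha>
    proof -
      have "up i (up i \<alpha>) i * (up i (up i \<alpha>) i - 1) = (\<alpha> i + 2) * (\<alpha> i + 1)" by (simp add: up_apply)
      then show ?thesis unfolding pdd abs_mult by (simp only: abs_of_nat)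
    qed
    have uL: "up 0 (up 0 \<alpha>) \<in> L (k+2) (a+2)" if "\<alpha> \<in> L k a" for \<alpha>
      using that n by (simp add: L_def up_in_level up_apply)
    have img: "(\<lambda>\<alpha>. up 0 (up 0 \<alpha>)) ` L k a = L (k+2) (a+2)"
    proof
      show "L (k+2) (a+2) \<subseteq> (\<lambda>\<alpha>. up 0 (up 0 \<alpha>)) ` L k a"
      proof
        fix \<beta> assume b: "\<beta> \<in> L (k+2) (a+2)"
        define \<alpha> where "\<alpha> = \<beta>(0 := a)"
        have u: "up 0 (up 0 \<alpha>) = \<beta>" using b by (auto simp: \<alpha>_def up_def L_def)
        have "up 0 (up 0 \<alpha>) \<in> level n (Suc (Suc k))" using b by (simp add: L_def u)
        then have "\<alpha> \<in> L k a" using n by (simp add: L_def up_in_level) (simp add: \<alpha>_def)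
        then show "\<beta> \<in> (\<lambda>\<alpha>. up 0 (up 0 \<alpha>)) ` L k a" using u by force
      qed
    qed (use uL in auto)
    have inj2: "inj (\<lambda>\<alpha>. up i (up i \<alpha>))" for i
      using inj_compose[OF inj_up inj_up] by (simp add: comp_def)
    have "real ((a+2)*(a+1)) * M (a+2) = (\<Sum>\<alpha>\<in>L k a. real ((a+2)*(a+1)) * \<bar>f (up 0 (up 0 \<alpha>))\<bar>)"
      unfolding M_def img[symmetric] by (subst sum.reindex) (auto simp: sum_distrib_left intro: inj_on_subset[OF inj2])
    also have "\<dots> \<le> (\<Sum>\<alpha>\<in>L k a. \<bar>lap n \<epsilon> f \<alpha>\<bar> + (\<Sum>i\<in>{1..<n}. \<bar>pd i (pd i f) \<alpha>\<bar>))"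
    proof (rule sum_mono)
      fix \<alpha> assume \<alpha>: "\<alpha> \<in> L k a"
      have "lap n \<epsilon> f \<alpha> = \<epsilon> 0 * pd 0 (pd 0 f) \<alpha> + (\<Sum>i\<in>{1..<n}. \<epsilon> i * pd i (pd i f) \<alpha>)"
        unfolding lap_def lessThan_atLeast0 using n by (subst sum.atLeast_Suc_lessThan) auto
      then have "\<epsilon> 0 * pd 0 (pd 0 f) \<alpha> = lap n \<epsilon> f \<alpha> - (\<Sum>i\<in>{1..<n}. \<epsilon> i * pd i (pd i f) \<alpha>)" by simp
      then have "\<bar>\<epsilon> 0 * pd 0 (pd 0 f) \<alpha>\<bar> \<le> \<bar>lap n \<epsilon> f \<alpha>\<bar> + \<bar>\<Sum>i\<in>{1..<n}. \<epsilon> i * pd i (pd i f) \<alpha>\<bar>" by linarith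
      also have "\<bar>\<Sum>i\<in>{1..<n}. \<epsilon> i * pd i (pd i f) \<alpha>\<bar> \<le> (\<Sum>i\<in>{1..<n}. \<bar>\<epsilon> i * pd i (pd i f) \<alpha>\<bar>)" by (rule sum_abs)
      also have "\<dots> = (\<Sum>i\<in>{1..<n}. \<bar>pd i (pd i f) \<alpha>\<bar>)" by (intro sum.cong) (auto simp: abs_mult eps)
      finally have "\<bar>pd 0 (pd 0 f) \<alpha>\<bar> \<le> \<bar>lap n \<epsilon> f \<alpha>\<bar> + (\<Sum>i\<in>{1..<n}. \<bar>pd i (pd i f) \<alpha>\<bar>)"
        by (simp add: abs_mult eps n)
      moreover have "\<alpha> 0 = a" using \<alpha> by (simp add: L_def)
      ultimately show "real ((a+2)*(a+1)) * \<bar>f (up 0 (up 0 \<alpha>))\<bar> \<le> \<bar>lap n \<epsilon> f \<alpha>\<bar> + (\<Sum>i\<in>{1..<n}. \<bar>pd i (pd i f) \<alpha>\<bar>)"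
        by (simp add: pdd abs_mult)
    qed
    also have "\<dots> = H a + (\<Sum>i\<in>{1..<n}. \<Sum>\<alpha>\<in>L k a. \<bar>pd i (pd i f) \<alpha>\<bar>)"
      unfolding sum.distrib H_def by (subst sum.swap) simp
    also have "(\<Sum>i\<in>{1..<n}. \<Sum>\<alpha>\<in>L k a. \<bar>pd i (pd i f) \<alpha>\<bar>) \<le> (\<Sum>i\<in>{1..<n}. \<Sum>\<gamma>\<in>L (k+2) a. real (\<gamma> i * (\<gamma> i - 1)) * \<bar>f \<gamma>\<bar>)"
    proof (rule sum_mono)
      fix i assume i: "i \<in> {1..<n}"
      have "(\<Sum>\<alpha>\<in>L k a. \<bar>pd i (pd i f) \<alpha>\<bar>) = (\<Sum>\<gamma>\<in>(\<lambda>\<alpha>. up i (up i \<alpha>)) ` L k a. real (\<gamma> i * (\<gamma> i - 1)) * \<bar>f \<gamma>\<bar>)"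
        by (subst sum.reindex[OF inj_on_subset[OF inj2]]) (simp_all only: comp_def abs_pdd subset_UNIV)
      also have "\<dots> \<le> (\<Sum>\<gamma>\<in>L (k+2) a. real (\<gamma> i * (\<gamma> i - 1)) * \<bar>f \<gamma>\<bar>)"
        using i by (intro sum_mono2 fin) (auto simp: L_def up_in_level up_apply)
      finally show "(\<Sum>\<alpha>\<in>L k a. \<bar>pd i (pd i f) \<alpha>\<bar>) \<le> (\<Sum>\<gamma>\<in>L (k+2) a. real (\<gamma> i * (\<gamma> i - 1)) * \<bar>f \<gamma>\<bar>)" .
    qed
    also have "(\<Sum>i\<in>{1..<n}. \<Sum>\<gamma>\<in>L (k+2) a. real (\<gamma> i * (\<gamma> i - 1)) * \<bar>f \<gamma>\<bar>) = (\<Sum>\<gamma>\<in>L (k+2) a. real (\<Sum>i\<in>{1..<n}. \<gamma> i * (\<gamma> i - 1)) * \<bar>f \<gamma>\<bar>)"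
      by (subst sum.swap) (simp add: sum_distrib_right)
    also have "\<dots> \<le> (\<Sum>\<gamma>\<in>L (k+2) a. real ((k+2-a)*(k+1-a)) * \<bar>f \<gamma>\<bar>)"
    proof (intro sum_mono mult_right_mono)
      fix \<gamma> assume \<gamma>: "\<gamma> \<in> L (k+2) a"
      then have "\<gamma> 0 = a" "deg n \<gamma> = k + 2" by (auto simp: L_def level_def)
      moreover have "deg n \<gamma> = \<gamma> 0 + (\<Sum>i\<in>{1..<n}. \<gamma> i)"
        unfolding deg_def lessThan_atLeast0 using n by (subst sum.atLeast_Suc_lessThan) auto
      ultimately have d: "(\<Sum>i\<in>{1..<n}. \<gamma> i) = k + 2 - a" by linarith
      have "(\<Sum>i\<in>{1..<n}. \<gamma> i * (\<gamma> i - 1)) \<le> (\<Sum>i\<in>{1..<n}. \<gamma> i * (k + 1 - a))"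
      proof (intro sum_mono mult_left_mono)
        fix i assume "i \<in> {1..<n}"
        then have "\<gamma> i \<le> k + 2 - a" unfolding d[symmetric] by (intro member_le_sum) auto
        then show "\<gamma> i - 1 \<le> k + 1 - a" by simp
      qed auto
      also have "\<dots> = (k+2-a)*(k+1-a)" unfolding sum_distrib_right[symmetric] d ..
      finally show "real (\<Sum>i\<in>{1..<n}. \<gamma> i * (\<gamma> i - 1)) \<le> real ((k+2-a)*(k+1-a))" unfolding of_nat_le_iff .
    qed auto
    also have "\<dots> = real ((k+2-a)*(k+1-a)) * M a" by (simp only: M_def sum_distrib_left)
    finally show ?thesis by simp
  qed
  \<comment> \<open>After rescaling by the binomial weights both falling factorials cancel against
    the same number \<open>(k + 2) * (k + 1) * (k choose a)\<close>, so \<open>s a\<close> reappears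
    with coefficient one and the bounds add up instead of multiplying.\<close>
  have step: "s (a+2) \<le> s a + t a / real ((k+2)*(k+1))" if a: "a \<le> k" for a
  proof -
    define B where "B = (k+2) choose a"
    have c1: "(a+2)*(a+1) * ((k+2) choose (a+2)) = (k+2)*(k+1) * (k choose a)"
    proof -
      have "(a+2) * ((k+2) choose (a+2)) = (k+2) * ((k+1) choose (a+1))"
        using Suc_times_binomial_eq[of "k+1" "a+1"] by (simp add: mult.commute)
      moreover have "(a+1) * ((k+1) choose (a+1)) = (k+1) * (k choose a)"
        using Suc_times_binomial_eq[of "k" "a"] by (simp add: mult.commute)
      ultimately show ?thesis by (metis mult.assoc mult.left_commute)
    qed
    have c2: "(k+2-a)*(k+1-a) * ((k+2) choose a) = (k+2)*(k+1) * (k choose a)"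
    proof -
      have "(k+2-a) * ((k+2) choose a) = (k+2) * ((k+1) choose a)"
        using binomial_absorb_comp[of "k+2" a] by simp
      moreover have "(k+1-a) * ((k+1) choose a) = (k+1) * (k choose a)"
        using binomial_absorb_comp[of "k+1" a] by simp
      ultimately show ?thesis by (metis mult.assoc mult.left_commute)
    qed
    define D where "D = real ((k+2)*(k+1) * (k choose a))"
    have D: "D > 0" unfolding D_def of_nat_0_less_iff using a by (intro mult_pos_pos zero_less_binomial) auto
    have e1: "s (a+2) = real ((a+2)*(a+1)) * M (a+2) / D"
    proof -
      have "D = real ((a+2)*(a+1)) * real ((k+2) choose (a+2))" unfolding D_def c1[symmetric] by (simp only: of_nat_mult)
      moreover have "real ((a+2)*(a+1)) \<noteq> 0" unfolding of_nat_eq_0_iff by simp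
      ultimately show ?thesis unfolding s_def by (metis mult_divide_mult_cancel_left)
    qed
    have e2: "s a = real ((k+2-a)*(k+1-a)) * M a / D"
    proof -
      have "D = real ((k+2-a)*(k+1-a)) * real ((k+2) choose a)" unfolding D_def c2[symmetric] by (simp only: of_nat_mult)
      moreover have "real ((k+2-a)*(k+1-a)) \<noteq> 0" unfolding of_nat_eq_0_iff using a by simp
      ultimately show ?thesis unfolding s_def by (metis mult_divide_mult_cancel_left)
    qed
    have e3: "t a / real ((k+2)*(k+1)) = H a / D"
      by (simp only: t_def D_def of_nat_mult divide_divide_eq_left mult_ac)
    show ?thesis unfolding e1 e2 e3 add_divide_distrib[symmetric]
      using layer[OF a] D by (intro divide_right_mono) auto
  qed
  define Q where "Q = wnorm n k (lap n \<epsilon> f)"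
  have Q: "Q = (\<Sum>a\<le>k. t a)" unfolding Q_def split t_def H_def ..
  have s01: "s a = 0" if "a < 2" for a
    unfolding s_def M_def using that data by (auto simp: L_def)
  have tele: "s a \<le> (\<Sum>j<a-1. t j) / real ((k+2)*(k+1))" if "a \<le> k + 2" for a
    using that
  proof (induction a rule: less_induct)
    case (less a)
    show ?case
    proof (cases "a < 2")
      case True then show ?thesis by (auto simp: s01 intro!: sum_nonneg t0 divide_nonneg_nonneg)
    next
      case False
      then obtain b where b: "a = b + 2" by (metis add.commute le_add_diff_inverse not_less)
      have "s a \<le> s b + t b / real ((k+2)*(k+1))" unfolding b using less.prems b by (intro step) simp
      also have "s b \<le> (\<Sum>j<b-1. t j) / real ((k+2)*(k+1))" using less b by simp
      \<comment> \<open>The recursion advances by two and collects every other \<open>t j\<close>;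
        the skipped ones are added to get a bound independent of parity.\<close>
      also have "(\<Sum>j<b-1. t j) \<le> (\<Sum>j<b. t j)" by (intro sum_mono2) (auto simp: t0)
      finally show ?thesis unfolding b by (simp add: add_divide_distrib divide_right_mono)
    qed
  qed
  have bound: "s a \<le> Q / real ((k+2)*(k+1))" if "a \<le> k + 2" for a
  proof -
    have "(\<Sum>j<a-1. t j) \<le> Q" unfolding Q using that by (intro sum_mono2) (auto simp: t0)
    then show ?thesis using tele[OF that] by (meson divide_right_mono of_nat_0_le_iff order_trans)
  qed
  have "wnorm n (k+2) f = (\<Sum>a\<le>k+2. s a)" unfolding split s_def M_def ..
  \<comment> \<open>Two of the \<open>k + 3\<close> layers vanish by the assumption on the data.
    Each of the other \<open>k + 1\<close> carries the denominator \<open>(k + 2) * (k + 1)\<close>,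
    which leaves the gain \<open>k + 2\<close> of the statement.\<close>
  also have "\<dots> = (\<Sum>a\<in>{2..k+2}. s a)" by (intro sum.mono_neutral_right) (auto simp: s01)
  also have "\<dots> \<le> (\<Sum>a\<in>{2..k+2}. Q / real ((k+2)*(k+1)))" by (intro sum_mono bound) auto
  also have "\<dots> = real (k + 1) * (Q / (real (k + 2) * real (k + 1)))" by (simp only: sum_constant card_atLeastAtMost of_nat_mult diff_add_inverse2) simp
  also have "\<dots> = Q / real (k + 2)"
  proof -
    have cancel: "y * (Q / (z * y)) = Q / z" if "y \<noteq> 0" for y z :: real using that by simp
    show ?thesis by (rule cancel) (unfold of_nat_eq_0_iff, simp)
  qed
  finally show ?thesis unfolding Q_def[symmetric] by (simp add: field_simps)
qed


section \<open>A quadratic majorant recursion\<close>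

lemma sum_convolution_le:
  fixes a b :: "nat \<Rightarrow> real"
  assumes "\<And>i. 0 \<le> a i" "\<And>i. 0 \<le> b i"
  shows "(\<Sum>k\<le>m. \<Sum>i\<le>k. a i * b (k - i)) \<le> (\<Sum>i\<le>m. a i) * (\<Sum>j\<le>m. b j)"
proof -
  have "(\<Sum>k\<le>m. \<Sum>i\<le>k. a i * b (k - i)) = (\<Sum>(i,j)\<in>{(i,j). i + j \<le> m}. a i * b j)"
    by (rule sum.triangle_reindex_eq[symmetric])
  also have "\<dots> \<le> (\<Sum>(i,j)\<in>{..m} \<times> {..m}. a i * b j)"
    using assms by (intro sum_mono2) auto
  also have "\<dots> = (\<Sum>i\<le>m. a i) * (\<Sum>j\<le>m. b j)"
    by (simp add: sum_product sum.cartesian_product)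
  finally show ?thesis .
qed

text \<open>The partial sums satisfy \<open>P_(j+2) \<le> e 0 + K s^2 P_j^2\<close>, so the bound
  \<open>E = e 0 + 1\<close> reproduces itself as soon as \<open>K s^2 E^2 \<le> 1\<close>.\<close>

lemma quadratic_recursion_bounded:
  fixes e :: "nat \<Rightarrow> real"
  assumes nonneg: "\<And>k. 0 \<le> e k" and e1: "e (Suc 0) = 0" and K: "0 \<le> K"
    and rec: "\<And>k. e (k + 2) \<le> K * (\<Sum>i\<le>k. e i * e (k - i))"
  obtains E r where "0 < E" "0 < r" "\<And>s m. 0 \<le> s \<Longrightarrow> s \<le> r \<Longrightarrow> (\<Sum>k\<le>m. e k * s ^ k) \<le> E"
proof -
  define E where "E = e 0 + 1"
  have E: "E > 0" using nonneg[of 0] by (simp add: E_def add_nonneg_pos)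
  \<comment> \<open>On this range \<open>s * E \<le> 1 / (K + 1)\<close>, and
    \<open>K \<le> (K + 1)^2\<close>; adding one to \<open>K\<close> also covers
    \<open>K = 0\<close>.\<close>
  define r where "r = 1 / (E * (K + 1))"
  have r: "r > 0" using E K by (simp add: r_def)
  have small: "K * s\<^sup>2 * E\<^sup>2 \<le> 1" if "0 \<le> s" "s \<le> r" for s
  proof -
    have "s * E \<le> r * E" using that E by (intro mult_right_mono) auto
    also have "r * E = 1 / (K + 1)" using E by (simp add: r_def)
    finally have "(s * E)\<^sup>2 \<le> (1 / (K + 1))\<^sup>2" using that E by (intro power_mono) auto
    then have "K * (s * E)\<^sup>2 \<le> K * (1 / (K + 1))\<^sup>2" using K by (intro mult_left_mono)
    also have "\<dots> \<le> 1"
    proof -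
      have "K \<le> (K + 1)\<^sup>2" using K by (simp add: power2_eq_square algebra_simps)
      then show ?thesis using K by (simp add: power_divide divide_le_eq)
    qed
    finally show ?thesis by (simp add: power_mult_distrib mult.assoc)
  qed
  have "(\<Sum>k\<le>m. e k * s ^ k) \<le> E" if s: "0 \<le> s" "s \<le> r" for s m
  proof (induction m rule: less_induct)
    case (less m)
    consider "m = 0" | "m = Suc 0" | j where "m = Suc (Suc j)"
      by (metis not0_implies_Suc)
    then show ?case
    proof cases
      case (3 j)
      let ?a = "\<lambda>i. e i * s ^ i"
      have "(\<Sum>k\<le>m. ?a k) = e 0 + (\<Sum>k\<le>j. e (k + 2) * s ^ (k + 2))"
        unfolding 3 sum.atMost_Suc_shift by (simp add: e1 del: sum.atMost_Suc)
      also have "(\<Sum>k\<le>j. e (k + 2) * s ^ (k + 2)) \<le> (\<Sum>k\<le>j. K * s\<^sup>2 * (\<Sum>i\<le>k. ?a i * ?a (k - i)))"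
      proof (rule sum_mono)
        fix k
        have "(\<Sum>i\<le>k. ?a i * ?a (k - i)) = (\<Sum>i\<le>k. e i * e (k - i)) * s ^ k"
          unfolding sum_distrib_right by (intro sum.cong) (auto simp: power_add[symmetric])
        moreover have "e (k + 2) * s ^ (k + 2) \<le> K * (\<Sum>i\<le>k. e i * e (k - i)) * s ^ (k + 2)"
          using s by (intro mult_right_mono rec) auto
        ultimately show "e (k + 2) * s ^ (k + 2) \<le> K * s\<^sup>2 * (\<Sum>i\<le>k. ?a i * ?a (k - i))"
          by (simp add: power_add power2_eq_square mult_ac)
      qed
      also have "\<dots> = K * s\<^sup>2 * (\<Sum>k\<le>j. \<Sum>i\<le>k. ?a i * ?a (k - i))" by (simp add: sum_distrib_left)
      also have "\<dots> \<le> K * s\<^sup>2 * ((\<Sum>i\<le>j. ?a i) * (\<Sum>i\<le>j. ?a i))"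
        using s K nonneg by (intro mult_left_mono sum_convolution_le) auto
      also have "\<dots> \<le> K * s\<^sup>2 * (E * E)"
        using s K nonneg less[of j] 3 E by (intro mult_left_mono mult_mono sum_nonneg) auto
      also have "\<dots> \<le> 1" using small[OF s] by (simp add: power2_eq_square)
      finally show ?thesis by (simp add: E_def)
    qed (auto simp: E_def e1)
  qed
  with E r show ?thesis by (rule that)
qed

section \<open>Recursive construction of the coefficients\<close>

lemma wf_fixpoint:
  assumes "wf R" and cong: "\<And>f g x. (\<And>y. (y, x) \<in> R \<Longrightarrow> f y = g y) \<Longrightarrow> G f x = G g x"
  shows "\<exists>f. \<forall>x. f x = G f x"
proof (intro exI allI)
  fix x
  have "wfrec R G x = G (cut (wfrec R G) R x) x" by (rule wfrec[OF assms(1)])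
  \<comment> \<open>\<open>G\<close> at \<open>x\<close> looks at values below \<open>x\<close>
    only, so the truncation made by \<open>wfrec\<close> is invisible to it.\<close>
  also have "\<dots> = G (wfrec R G) x" by (rule cong) (simp add: cut_apply)
  finally show "wfrec R G x = G (wfrec R G) x" .
qed

text \<open>The equation \<open>F \<Delta>F - n/2 |dF|^2 = T\<close> solved for
  \<open>\<Delta>F\<close> when \<open>c 0 = 1\<close>: then \<open>c(0 := 0)\<close> is the series
  of \<open>F - 1\<close>. Unlike a division by \<open>F\<close>, this keeps everything
  polynomial.\<close>

definition yamabe_rhs :: "nat \<Rightarrow> (nat \<Rightarrow> real) \<Rightarrow> real \<Rightarrow> ((nat \<Rightarrow> nat) \<Rightarrow> real) \<Rightarrow> (nat \<Rightarrow> nat) \<Rightarrow> real" where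
  "yamabe_rhs n \<epsilon> T c \<alpha> = (if \<alpha> = 0 then T else 0)
     + real n / 2 * (\<Sum>i<n. \<epsilon> i * conv (pd i c) (pd i c) \<alpha>) - conv (lap n \<epsilon> c) (c(0 := 0)) \<alpha>"

text \<open>Coefficients of degree \<open>deg n \<alpha> + 2\<close> could enter only through
  \<open>lap n \<epsilon> c\<close> at \<open>\<alpha>\<close> itself, where they are multiplied by
  the constant term of \<open>c(0 := 0)\<close>, which is zero.\<close>

lemma yamabe_rhs_cong:
  assumes \<alpha>: "\<alpha> \<in> multi_idx n" and eq: "\<And>\<beta>. deg n \<beta> < deg n \<alpha> + 2 \<Longrightarrow> f \<beta> = g \<beta>"
  shows "yamabe_rhs n \<epsilon> T f \<alpha> = yamabe_rhs n \<epsilon> T g \<alpha>"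
proof -
  have d: "deg n (\<alpha> - \<beta>) \<le> deg n \<alpha>" for \<beta> by (rule deg_mono) (simp add: le_fun_def fun_diff_def)
  have "pd i f \<beta> = pd i g \<beta>" if "i < n" "deg n \<beta> \<le> deg n \<alpha>" for i \<beta>
    using that by (simp add: pd_def eq deg_up)
  then have "conv (pd i f) (pd i f) \<alpha> = conv (pd i g) (pd i g) \<alpha>" if "i < n" for i
    unfolding conv_def using that d deg_mono[where \<alpha> = \<alpha> and n = n] by (intro sum.cong) auto
  moreover have "conv (lap n \<epsilon> f) (f(0 := 0)) \<alpha> = conv (lap n \<epsilon> g) (g(0 := 0)) \<alpha>"
    unfolding conv_def
  proof (rule sum.cong[OF refl])
    fix \<beta> assume "\<beta> \<in> {..\<alpha>}"
    then have le: "\<beta> \<le> \<alpha>" by simp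
    show "lap n \<epsilon> f \<beta> * (f(0 := 0)) (\<alpha> - \<beta>) = lap n \<epsilon> g \<beta> * (g(0 := 0)) (\<alpha> - \<beta>)"
    proof (cases "\<beta> = \<alpha>")
      case True then show ?thesis by (simp add: fun_eq_iff)
    next
      case False
      then have "deg n \<beta> < deg n \<alpha>" using deg_strict_mono[OF le _ \<alpha>] by blast
      then have "lap n \<epsilon> f \<beta> = lap n \<epsilon> g \<beta>"
        unfolding lap_def by (intro sum.cong refl) (simp add: pd_def eq deg_up)
      moreover have "f (\<alpha> - \<beta>) = g (\<alpha> - \<beta>)" using d[of \<beta>] by (intro eq) simp
      ultimately show ?thesis by simp
    qed
  qed
  ultimately show ?thesis unfolding yamabe_rhs_def by simp
qed

lemma lap_split:
  assumes "0 < n"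
  shows "lap n \<epsilon> c \<alpha> = \<epsilon> 0 * pd 0 (pd 0 c) \<alpha> + (\<Sum>i\<in>{1..<n}. \<epsilon> i * pd i (pd i c) \<alpha>)"
  unfolding lap_def lessThan_atLeast0 using assms by (subst sum.atLeast_Suc_lessThan) auto

text \<open>The coefficients are determined recursively, by the degree first and then by the exponent of
  the distinguished variable.\<close>

lemma yamabe_formal_exists:
  assumes n: "0 < n" and eps: "\<bar>\<epsilon> 0\<bar> = 1"
  obtains c where "\<And>\<alpha>. \<alpha> 0 < 2 \<Longrightarrow> c \<alpha> = d \<alpha>"
    and "\<And>\<alpha>. \<alpha> \<in> multi_idx n \<Longrightarrow> lap n \<epsilon> c \<alpha> = yamabe_rhs n \<epsilon> T c \<alpha>"
proof -
  \<comment> \<open>For \<open>\<alpha> 0 \<ge> 2\<close> the value is read off from the equation at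
    the multi-index two lower in variable 0; multiplying by \<open>\<epsilon> 0\<close> also divides
    by it, since its square is one. All other values are the data \<open>d\<close>.\<close>
  define G where "G = (\<lambda>c \<alpha>. if \<alpha> \<in> multi_idx n \<and> 2 \<le> \<alpha> 0 then 
     \<epsilon> 0 * (yamabe_rhs n \<epsilon> T c (\<alpha>(0 := \<alpha> 0 - 2)) - (\<Sum>i\<in>{1..<n}. \<epsilon> i * pd i (pd i c) (\<alpha>(0 := \<alpha> 0 - 2))))
       / (real (\<alpha> 0) * real (\<alpha> 0 - 1)) else d \<alpha>)"
  have "\<exists>c. \<forall>\<alpha>. c \<alpha> = G c \<alpha>"
  proof (rule wf_fixpoint)
    show "wf (measures [deg n, \<lambda>\<alpha>. \<alpha> 0])" by simp
  next
    fix f g :: "(nat \<Rightarrow> nat) \<Rightarrow> real" and \<alpha>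
    assume eq: "\<And>\<beta>. (\<beta>, \<alpha>) \<in> measures [deg n, \<lambda>\<alpha>. \<alpha> 0] \<Longrightarrow> f \<beta> = g \<beta>"
    show "G f \<alpha> = G g \<alpha>"
    proof (cases "\<alpha> \<in> multi_idx n \<and> 2 \<le> \<alpha> 0")
      case True
      define \<alpha>' where "\<alpha>' = \<alpha>(0 := \<alpha> 0 - 2)"
      have u: "up 0 (up 0 \<alpha>') = \<alpha>" using True by (auto simp: \<alpha>'_def up_apply fun_eq_iff)
      have d: "deg n \<alpha> = deg n \<alpha>' + 2" using n by (simp add: u[symmetric] deg_up)
      have m: "\<alpha>' \<in> multi_idx n" using True n by (simp add: u[symmetric] up_in_multi_idx)
      have r: "yamabe_rhs n \<epsilon> T f \<alpha>' = yamabe_rhs n \<epsilon> T g \<alpha>'"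
        by (rule yamabe_rhs_cong[OF m]) (rule eq, simp add: d)
      have "pd i (pd i f) \<alpha>' = pd i (pd i g) \<alpha>'" if "i \<in> {1..<n}" for i
      proof -
        have "f (up i (up i \<alpha>')) = g (up i (up i \<alpha>'))"
          by (rule eq) (use that True in \<open>auto simp: deg_up d up_apply \<alpha>'_def[THEN fun_cong, of 0]\<close>)
        then show ?thesis by (simp add: pd_def)
      qed
      then show ?thesis unfolding G_def \<alpha>'_def[symmetric] r by simp
    qed (auto simp: G_def)
  qed
  then obtain c where c: "\<And>\<alpha>. c \<alpha> = G c \<alpha>" by blast
  show ?thesis
  proof (rule that)
    show "c \<alpha> = d \<alpha>" if "\<alpha> 0 < 2" for \<alpha> using that by (subst c) (simp add: G_def)
    show "lap n \<epsilon> c \<alpha> = yamabe_rhs n \<epsilon> T c \<alpha>" if \<alpha>: "\<alpha> \<in> multi_idx n" for \<alpha>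
    proof -
      define \<beta> where "\<beta> = up 0 (up 0 \<alpha>)"
      have b0: "\<beta> 0 = \<alpha> 0 + 2" and b': "\<beta>(0 := \<beta> 0 - 2) = \<alpha>" by (auto simp: \<beta>_def up_def)
      have m: "\<beta> \<in> multi_idx n" using \<alpha> n by (simp add: \<beta>_def up_in_multi_idx)
      have "c \<beta> = \<epsilon> 0 * (yamabe_rhs n \<epsilon> T c \<alpha> - (\<Sum>i\<in>{1..<n}. \<epsilon> i * pd i (pd i c) \<alpha>))
       / (real (\<alpha> 0 + 2) * real (\<alpha> 0 + 1))"
        unfolding c[of \<beta>] G_def b' using m b0 by simp
      then have "(real (\<alpha> 0 + 2) * real (\<alpha> 0 + 1)) * c \<beta> = \<epsilon> 0 * (yamabe_rhs n \<epsilon> T c \<alpha> - (\<Sum>i\<in>{1..<n}. \<epsilon> i * pd i (pd i c) \<alpha>))"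
        by simp
      moreover have "pd 0 (pd 0 c) \<alpha> = (real (\<alpha> 0 + 2) * real (\<alpha> 0 + 1)) * c \<beta>"
        by (simp add: pd_def \<beta>_def up_apply algebra_simps)
      moreover have "\<epsilon> 0 * \<epsilon> 0 = 1" using eps by (metis abs_mult_self_eq mult_1)
      ultimately show ?thesis unfolding lap_split[OF n] by (simp add: mult.assoc[symmetric])
    qed
  qed
qed


section \<open>Convergence of the formal solution and of its reciprocal\<close>

lemma wnorm_yamabe_rhs_le:
  assumes eps: "\<And>i. i < n \<Longrightarrow> \<bar>\<epsilon> i\<bar> = 1" and k: "0 < k"
  shows "wnorm n k (yamabe_rhs n \<epsilon> T c) \<le>
    real n / 2 * (\<Sum>i<n. \<Sum>j\<le>k. wnorm n j (pd i c) * wnorm n (k - j) (pd i c)) +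
    (\<Sum>j\<le>k. wnorm n j (lap n \<epsilon> c) * wnorm n (k - j) (c(0 := 0)))"
proof -
  have "wnorm n k (yamabe_rhs n \<epsilon> T c) = wnorm n k (\<lambda>\<alpha>. real n / 2 * (\<Sum>i<n. \<epsilon> i * conv (pd i c) (pd i c) \<alpha>) + (-1) * conv (lap n \<epsilon> c) (c(0 := 0)) \<alpha>)"
    using k by (intro wnorm_cong) (auto simp: yamabe_rhs_def level_def)
  also have "\<dots> \<le> wnorm n k (\<lambda>\<alpha>. real n / 2 * (\<Sum>i<n. \<epsilon> i * conv (pd i c) (pd i c) \<alpha>)) + wnorm n k (\<lambda>\<alpha>. (-1) * conv (lap n \<epsilon> c) (c(0 := 0)) \<alpha>)"
    by (rule wnorm_triangle)
  also have "\<dots> = real n / 2 * wnorm n k (\<lambda>\<alpha>. \<Sum>i<n. \<epsilon> i * conv (pd i c) (pd i c) \<alpha>) + wnorm n k (conv (lap n \<epsilon> c) (c(0 := 0)))"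
    unfolding wnorm_scale by simp
  also have "wnorm n k (\<lambda>\<alpha>. \<Sum>i<n. \<epsilon> i * conv (pd i c) (pd i c) \<alpha>) \<le> (\<Sum>i<n. wnorm n k (\<lambda>\<alpha>. \<epsilon> i * conv (pd i c) (pd i c) \<alpha>))"
    by (rule wnorm_sum) simp
  also have "\<dots> = (\<Sum>i<n. wnorm n k (conv (pd i c) (pd i c)))"
    unfolding wnorm_scale using eps by (intro sum.cong) auto
  also have "\<dots> \<le> (\<Sum>i<n. \<Sum>j\<le>k. wnorm n j (pd i c) * wnorm n (k - j) (pd i c))"
    by (intro sum_mono wnorm_conv_le)
  finally show ?thesis using wnorm_conv_le[of n k "lap n \<epsilon> c" "c(0 := 0)"]
    by (smt (verit) divide_nonneg_nonneg mult_left_mono of_nat_0_le_iff)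
qed

text \<open>With \<open>e k\<close> controlling the degree \<open>k\<close> part of
  \<open>\<Delta>F\<close>, the inversion estimate bounds that of \<open>dF\<close> by
  \<open>e (k - 1)\<close> and that of \<open>F - 1\<close> by \<open>e (k - 2)\<close>; its gain
  \<open>k + 2\<close> pays for the factor lost in differentiating. Both quadratic terms of the
  equation thus become convolutions of \<open>e\<close> with itself whose total index is two lower,
  and the recursion closes.\<close>

lemma yamabe_formal_bound:
  assumes n: "0 < n" and eps: "\<And>i. i < n \<Longrightarrow> \<bar>\<epsilon> i\<bar> = 1"
    and eq: "\<And>\<alpha>. \<alpha> \<in> multi_idx n \<Longrightarrow> lap n \<epsilon> c \<alpha> = yamabe_rhs n \<epsilon> T c \<alpha>"
    and c1: "\<And>\<alpha>. \<alpha> \<in> level n 1 \<Longrightarrow> c \<alpha> = 0"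
    and data: "\<And>\<alpha>. \<alpha> \<in> multi_idx n \<Longrightarrow> 3 \<le> deg n \<alpha> \<Longrightarrow> \<alpha> 0 < 2 \<Longrightarrow> c \<alpha> = 0"
  obtains E r where "0 < E" "0 < r"
    "\<And>s m. 0 \<le> s \<Longrightarrow> s \<le> r \<Longrightarrow> (\<Sum>k\<le>m. wnorm n (k + 2) c * s ^ k) \<le> E"
proof -
  \<comment> \<open>The inversion estimate asks for vanishing data, which fails in degree two where
    \<open>H\<close> is prescribed. The extra summand in \<open>e 0\<close> covers that
    degree.\<close>
  define e where "e = (\<lambda>k. wnorm n k (lap n \<epsilon> c) + (if k = 0 then 2 * wnorm n 2 c else 0))"
  define p where "p = (\<lambda>k. case k of 0 \<Rightarrow> 0 | Suc j \<Rightarrow> e j)"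
  define q where "q = (\<lambda>k. case k of 0 \<Rightarrow> 0 | Suc j \<Rightarrow> p j)"
  have e0: "0 \<le> e k" for k by (simp add: e_def wnorm_nonneg)
  have p0: "0 \<le> p k" for k by (simp add: p_def e0 split: nat.split)
  have lape: "wnorm n k (lap n \<epsilon> c) \<le> e k" for k by (simp add: e_def wnorm_nonneg)
  have b: "real (k + 2) * wnorm n (k + 2) c \<le> e k" for k
  proof (cases "k = 0")
    case True then show ?thesis by (simp add: e_def wnorm_nonneg numeral_2_eq_2)
  next
    case False
    have "real (k + 2) * wnorm n (k + 2) c \<le> wnorm n k (lap n \<epsilon> c)"
      using n eps by (rule wnorm_le_lap) (use False data in \<open>auto simp: level_def\<close>)
    then show ?thesis using lape[of k] by linarith
  qed
  have w1: "wnorm n 1 c = 0" using c1 by (simp add: wnorm_def)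
  have pb: "wnorm n k (pd i c) \<le> p k" if "i < n" for i k
  proof (cases k)
    case 0 then show ?thesis using wnorm_pd_le[OF that, of k c] w1 by (simp add: p_def)
  next
    case (Suc j) then show ?thesis using wnorm_pd_le[OF that, of k c] b[of j] by (simp add: p_def)
  qed
  have qb: "wnorm n k (c(0 := 0)) \<le> q k" for k
  proof -
    have z: "wnorm n k (c(0 := 0)) = wnorm n k c" if "k \<noteq> 0" using that by (intro wnorm_cong) (auto simp: level_def)
    consider "k = 0" | "k = Suc 0" | j where "k = Suc (Suc j)" by (metis not0_implies_Suc)
    then show ?thesis
    proof cases
      case (3 j)
      have "wnorm n (j + 2) c \<le> real (j + 2) * wnorm n (j + 2) c" 
        using mult_right_mono[of 1 "real (j + 2)" "wnorm n (j + 2) c"] wnorm_nonneg by simp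
      then show ?thesis using z 3 b[of j] by (simp add: q_def p_def)
    qed (use z w1 in \<open>auto simp: q_def p_def wnorm_def level_0\<close>)
  qed
  have e_le: "e k \<le> real n * real n / 2 * (\<Sum>j\<le>k. p j * p (k - j)) + (\<Sum>j\<le>k. e j * q (k - j))" if k: "0 < k" for k
  proof -
    have "e k = wnorm n k (yamabe_rhs n \<epsilon> T c)"
      using k eq by (auto simp: e_def level_def intro!: wnorm_cong)
    also have "\<dots> \<le> real n / 2 * (\<Sum>i<n. \<Sum>j\<le>k. wnorm n j (pd i c) * wnorm n (k - j) (pd i c)) +
      (\<Sum>j\<le>k. wnorm n j (lap n \<epsilon> c) * wnorm n (k - j) (c(0 := 0)))"
      by (rule wnorm_yamabe_rhs_le[OF eps k])
    also have "\<dots> \<le> real n / 2 * (\<Sum>i<n. \<Sum>j\<le>k. p j * p (k - j)) + (\<Sum>j\<le>k. e j * q (k - j))"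
      by (intro add_mono mult_left_mono sum_mono mult_mono pb qb lape) (auto simp: p0 e0 wnorm_nonneg)
    finally show ?thesis by simp
  qed
  \<comment> \<open>\<open>p\<close> starts at index 1 and \<open>q\<close> at index 2, so every
    product of total index 1 contains a zero.\<close>
  have e1: "e (Suc 0) = 0"
    using e_le[of "Suc 0"] e0[of "Suc 0"] by (simp add: p_def q_def)
  have rec: "e (k + 2) \<le> (real n * real n / 2 + 1) * (\<Sum>i\<le>k. e i * e (k - i))" for k
  proof -
    have "(\<Sum>j\<le>k+2. p j * p (k + 2 - j)) = (\<Sum>j\<le>k+1. e j * p (k + 1 - j))"
      unfolding add_2_eq_Suc' by (subst sum.atMost_Suc_shift) (simp add: p_def)
    also have "\<dots> = (\<Sum>j\<le>k. e j * p (k + 1 - j))" by (simp add: p_def)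
    also have "\<dots> = (\<Sum>j\<le>k. e j * e (k - j))" by (intro sum.cong) (auto simp: p_def Suc_diff_le)
    finally have 1: "(\<Sum>j\<le>k+2. p j * p (k + 2 - j)) = (\<Sum>j\<le>k. e j * e (k - j))" .
    have "(\<Sum>j\<le>k+2. e j * q (k + 2 - j)) = (\<Sum>j\<le>k. e j * q (k + 2 - j))" by (simp add: q_def p_def)
    also have "\<dots> = (\<Sum>j\<le>k. e j * e (k - j))" by (intro sum.cong) (auto simp: q_def p_def Suc_diff_le)
    finally have 2: "(\<Sum>j\<le>k+2. e j * q (k + 2 - j)) = (\<Sum>j\<le>k. e j * e (k - j))" .
    show ?thesis using e_le[of "k + 2"] unfolding 1 2 by (simp add: algebra_simps)
  qed
  obtain E r where Er: "0 < E" "0 < r" "\<And>s m. 0 \<le> s \<Longrightarrow> s \<le> r \<Longrightarrow> (\<Sum>k\<le>m. e k * s ^ k) \<le> E"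
    by (rule quadratic_recursion_bounded[of e "real n * real n / 2 + 1"]) (use e0 e1 rec in auto)
  show ?thesis
  proof (rule that[OF Er(1,2)])
    fix s :: real and m assume s: "0 \<le> s" "s \<le> r"
    have "wnorm n (k + 2) c \<le> e k" for k
    proof -
      have "wnorm n (k + 2) c \<le> real (k + 2) * wnorm n (k + 2) c" 
        using mult_right_mono[of 1 "real (k + 2)" "wnorm n (k + 2) c"] wnorm_nonneg by simp
      then show ?thesis using b[of k] by linarith
    qed
    then have "(\<Sum>k\<le>m. wnorm n (k + 2) c * s ^ k) \<le> (\<Sum>k\<le>m. e k * s ^ k)"
      using s by (intro sum_mono mult_right_mono) auto
    then show "(\<Sum>k\<le>m. wnorm n (k + 2) c * s ^ k) \<le> E" using Er(3)[OF s, of m] by linarith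
  qed
qed

text \<open>Reciprocal of a series with constant term one, as the fixed point of
  \<open>g = 1 - g (v - 1)\<close>; deleting the constant term makes the recursion lower the degree.
  A reciprocal is needed because the metric coefficients are multiples of
  \<open>F^-2\<close>.\<close>

lemma formal_inverse_exists:
  obtains g where "\<And>\<alpha>. \<alpha> \<in> multi_idx n \<Longrightarrow> g \<alpha> = (if \<alpha> = 0 then 1 else 0) - conv g (v(0 := 0)) \<alpha>"
proof -
  define G where "G = (\<lambda>g \<alpha>. if \<alpha> \<in> multi_idx n then (if \<alpha> = 0 then 1 else 0) - conv g (v(0 := 0)) \<alpha> else (0::real))"
  have "\<exists>g. \<forall>\<alpha>. g \<alpha> = G g \<alpha>"
  proof (rule wf_fixpoint)
    show "wf (measures [deg n])" by simp
  next
    fix f g :: "(nat \<Rightarrow> nat) \<Rightarrow> real" and \<alpha>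
    assume eq: "\<And>\<beta>. (\<beta>, \<alpha>) \<in> measures [deg n] \<Longrightarrow> f \<beta> = g \<beta>"
    have "conv f (v(0 := 0)) \<alpha> = conv g (v(0 := 0)) \<alpha>" if "\<alpha> \<in> multi_idx n"
      unfolding conv_def
    proof (rule sum.cong[OF refl])
      fix \<beta> assume "\<beta> \<in> {..\<alpha>}"
      then show "f \<beta> * (v(0 := 0)) (\<alpha> - \<beta>) = g \<beta> * (v(0 := 0)) (\<alpha> - \<beta>)"
        using eq[of \<beta>] deg_strict_mono[OF _ _ that, of \<beta>] by (cases "\<beta> = \<alpha>") (auto simp: fun_eq_iff)
    qed
    then show "G f \<alpha> = G g \<alpha>" by (simp add: G_def)
  qed
  then obtain g where g: "\<And>\<alpha>. g \<alpha> = G g \<alpha>" by blast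
  show ?thesis
  proof (rule that)
    show "g \<alpha> = (if \<alpha> = 0 then 1 else 0) - conv g (v(0 := 0)) \<alpha>" if "\<alpha> \<in> multi_idx n" for \<alpha>
      using g[of \<alpha>] that by (simp add: G_def)
  qed
qed

text \<open>Turns the fixed-point equations, which omit the constant term, back into products with
  the full series.\<close>

lemma conv_upd_0:
  assumes "\<alpha> \<in> multi_idx n"
  shows "conv f v \<alpha> = conv f (v(0 := 0)) \<alpha> + f \<alpha> * v 0"
proof -
  have fin: "finite {..\<alpha>}" by (rule finite_atMost_multi_idx[OF assms])
  have "conv f v \<alpha> = (\<Sum>\<beta>\<in>{..\<alpha>}. f \<beta> * (v(0 := 0)) (\<alpha> - \<beta>) + (if \<beta> = \<alpha> then f \<alpha> * v 0 else 0))"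
    unfolding conv_def
  proof (intro sum.cong refl)
    fix \<beta> assume "\<beta> \<in> {..\<alpha>}"
    then have "\<alpha> - \<beta> = 0 \<longleftrightarrow> \<beta> = \<alpha>" by (auto simp: fun_eq_iff le_fun_def intro: order_antisym)
    then show "f \<beta> * v (\<alpha> - \<beta>) = f \<beta> * (v(0 := 0)) (\<alpha> - \<beta>) + (if \<beta> = \<alpha> then f \<alpha> * v 0 else 0)" by auto
  qed
  then show ?thesis using fin by (simp add: sum.distrib conv_def)
qed

text \<open>A geometric series in disguise: the partial sum \<open>P\<close> satisfies
  \<open>P \<le> 1 + P / 2\<close>.\<close>

lemma formal_inverse_bound:
  assumes g: "\<And>\<alpha>. \<alpha> \<in> multi_idx n \<Longrightarrow> g \<alpha> = (if \<alpha> = 0 then 1 else 0) - conv g (w) \<alpha>"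
    and r: "0 \<le> r" and w: "\<And>m. (\<Sum>k\<le>m. wnorm n k (w) * r ^ k) \<le> 1 / 2"
  shows "(\<Sum>k\<le>m. wnorm n k g * r ^ k) \<le> 2"
proof -
  have step: "wnorm n k g \<le> (if k = 0 then 1 else 0) + (\<Sum>i\<le>k. wnorm n i g * wnorm n (k - i) w)" for k
  proof -
    have "wnorm n k g = wnorm n k (\<lambda>\<alpha>. (if \<alpha> = 0 then 1 else 0) + (-1) * conv g w \<alpha>)"
      using g by (intro wnorm_cong) (simp add: level_def)
    also have "\<dots> \<le> wnorm n k (\<lambda>\<alpha>. if \<alpha> = 0 then 1 else 0) + wnorm n k (\<lambda>\<alpha>. (-1) * conv g w \<alpha>)"
      by (rule wnorm_triangle)
    also have "wnorm n k (\<lambda>\<alpha>. (-1) * conv g w \<alpha>) = wnorm n k (conv g w)"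
      unfolding wnorm_scale by simp
    also have "wnorm n k (\<lambda>\<alpha>. if \<alpha> = 0 then 1 else 0) = (if k = 0 then 1 else 0)"
    proof (cases "k = 0")
      case True then show ?thesis by (simp add: wnorm_def level_0)
    next
      case False
      then have "\<alpha> \<noteq> 0" if "\<alpha> \<in> level n k" for \<alpha> using that by (auto simp: level_def)
      then show ?thesis using False by (auto simp: wnorm_def intro!: sum.neutral)
    qed
    finally show ?thesis using wnorm_conv_le[of n k g w] by linarith
  qed
  let ?P = "\<Sum>k\<le>m. wnorm n k g * r ^ k"
  have P0: "0 \<le> ?P" using r by (intro sum_nonneg mult_nonneg_nonneg wnorm_nonneg) auto
  have "?P \<le> (\<Sum>k\<le>m. (if k = 0 then 1 else 0) + (\<Sum>i\<le>k. (wnorm n i g * r ^ i) * (wnorm n (k - i) w * r ^ (k - i))))"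
  proof (rule sum_mono)
    fix k
    have "wnorm n k g * r ^ k \<le> ((if k = 0 then 1 else 0) + (\<Sum>i\<le>k. wnorm n i g * wnorm n (k - i) w)) * r ^ k"
      using r by (intro mult_right_mono step) auto
    also have "\<dots> = (if k = 0 then 1 else 0) + (\<Sum>i\<le>k. wnorm n i g * wnorm n (k - i) w) * r ^ k"
      by (simp add: distrib_right)
    also have "(\<Sum>i\<le>k. wnorm n i g * wnorm n (k - i) w) * r ^ k = (\<Sum>i\<le>k. (wnorm n i g * r ^ i) * (wnorm n (k - i) w * r ^ (k - i)))"
      unfolding sum_distrib_right by (intro sum.cong refl) (auto simp: power_add[symmetric])
    finally show "wnorm n k g * r ^ k \<le> (if k = 0 then 1 else 0) + (\<Sum>i\<le>k. (wnorm n i g * r ^ i) * (wnorm n (k - i) w * r ^ (k - i)))"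
      .
  qed
  also have "\<dots> = 1 + (\<Sum>k\<le>m. \<Sum>i\<le>k. (wnorm n i g * r ^ i) * (wnorm n (k - i) w * r ^ (k - i)))"
    by (simp add: sum.distrib)
  also have "\<dots> \<le> 1 + ?P * (\<Sum>k\<le>m. wnorm n k w * r ^ k)"
    using r by (intro add_left_mono sum_convolution_le mult_nonneg_nonneg wnorm_nonneg) auto
  also have "\<dots> \<le> 1 + ?P * (1 / 2)" using P0 by (intro add_left_mono mult_left_mono w)
  finally show ?thesis by simp
qed


text \<open>The binomial \<open>k choose \<alpha> 0\<close> is at most \<open>2 ^ k\<close>; halving
  the radius therefore pays for the weights.\<close>

lemma abs_summable_of_wnorm_bound:
  assumes r: "0 \<le> r" and B: "\<And>m. (\<Sum>k\<le>m. wnorm n k c * r ^ k) \<le> B"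
  shows "(\<lambda>\<alpha>. \<bar>c \<alpha>\<bar> * (r / 2) ^ deg n \<alpha>) summable_on multi_idx n"
proof (rule nonneg_bdd_above_summable_on)
  let ?t = "\<lambda>\<alpha>. \<bar>c \<alpha>\<bar> * (r / 2) ^ deg n \<alpha>"
  show "bdd_above (sum ?t ` {F. F \<subseteq> multi_idx n \<and> finite F})"
  proof (rule bdd_aboveI)
    fix x assume "x \<in> sum ?t ` {F. F \<subseteq> multi_idx n \<and> finite F}"
    then obtain F where F: "F \<subseteq> multi_idx n" "finite F" and x: "x = sum ?t F" by blast
    define m where "m = Max (insert 0 (deg n ` F))"
    have m: "deg n \<alpha> \<le> m" if "\<alpha> \<in> F" for \<alpha> unfolding m_def using F that by (intro Max_ge) auto
    have "sum ?t F \<le> sum ?t (\<Union>k\<in>{..m}. level n k)"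
    proof (rule sum_mono2)
      show "F \<subseteq> (\<Union>k\<in>{..m}. level n k)" using F m by (auto simp: level_def)
    qed (use r in auto)
    also have "\<dots> = (\<Sum>k\<le>m. sum ?t (level n k))"
    proof (rule sum.UNION_disjoint)
      show "\<forall>i\<in>{..m}. \<forall>j\<in>{..m}. i \<noteq> j \<longrightarrow> level n i \<inter> level n j = {}" by (auto simp: level_def)
    qed auto
    also have "\<dots> \<le> (\<Sum>k\<le>m. wnorm n k c * r ^ k)"
    proof (rule sum_mono)
      fix k
      show "sum ?t (level n k) \<le> wnorm n k c * r ^ k"
        unfolding wnorm_def sum_distrib_right
      proof (rule sum_mono)
        fix \<alpha> assume \<alpha>: "\<alpha> \<in> level n k"
        have "real (k choose \<alpha> 0) \<le> 2 ^ k"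
          using binomial_le_pow2[of k "\<alpha> 0"] by (metis of_nat_le_iff of_nat_numeral of_nat_power)
        moreover have "0 < real (k choose \<alpha> 0)" using level_index0_le[OF \<alpha>, of 0] by simp
        ultimately have "1 / 2 ^ k \<le> 1 / real (k choose \<alpha> 0)" by (simp add: frac_le)
        then have "\<bar>c \<alpha>\<bar> * r ^ k * (1 / 2 ^ k) \<le> \<bar>c \<alpha>\<bar> * r ^ k * (1 / real (k choose \<alpha> 0))"
          using r by (intro mult_left_mono) auto
        then show "?t \<alpha> \<le> \<bar>c \<alpha>\<bar> / real (k choose \<alpha> 0) * r ^ k"
          using \<alpha> by (simp add: level_def power_divide)
      qed
    qed
    also have "\<dots> \<le> B" by (rule B)
    finally show "x \<le> B" by (simp add: x)
  qed
qed (use r in auto)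

lemma pd_pd_commute: "pd i (pd j c) = pd j (pd i c)"
  by (rule ext) (auto simp: pd_def up_commute[of i j] up_apply)

text \<open>The formal solution of \<open>2 F \<Delta>F - n |dF|\<^sup>2 = 2 tr H\<close> with \<open>F = 1\<close>, \<open>dF = 0\<close> and
  second derivative \<open>H\<close> at the origin, together with its reciprocal.\<close>

lemma yamabe_formal_solution:
  fixes H :: "nat \<Rightarrow> nat \<Rightarrow> real"
  assumes n: "0 < n" and eps: "\<And>i. i < n \<Longrightarrow> \<bar>\<epsilon> i\<bar> = 1"
    and sym: "\<And>i j. H i j = H j i"
  obtains c g \<rho> where "0 < \<rho>"
    "(\<lambda>\<alpha>. \<bar>c \<alpha>\<bar> * \<rho> ^ deg n \<alpha>) summable_on multi_idx n"
    "(\<lambda>\<alpha>. \<bar>g \<alpha>\<bar> * \<rho> ^ deg n \<alpha>) summable_on multi_idx n"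
    "\<And>\<alpha>. \<alpha> \<in> multi_idx n \<Longrightarrow> conv g c \<alpha> = (if \<alpha> = 0 then 1 else 0)"
    "\<And>\<alpha>. \<alpha> \<in> multi_idx n \<Longrightarrow> conv (lap n \<epsilon> c) c \<alpha> =
       (if \<alpha> = 0 then \<Sum>i<n. \<epsilon> i * H i i else 0) + real n / 2 * (\<Sum>i<n. \<epsilon> i * conv (pd i c) (pd i c) \<alpha>)"
    "c 0 = 1" "\<And>i. i < n \<Longrightarrow> pd i c 0 = 0" "\<And>i j. i < n \<Longrightarrow> j < n \<Longrightarrow> pd i (pd j c) 0 = H i j"
proof -
  define T where "T = (\<Sum>i<n. \<epsilon> i * H i i)"
  \<comment> \<open>The coefficients of the polynomial \<open>1 + x H x / 2\<close>; those with
    \<open>\<alpha> 0 < 2\<close> serve as Cauchy data. The sum over ordered pairs counts mixed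
    monomials twice, matching the factor 1/2.\<close>
  define d where "d = (\<lambda>\<alpha>. if \<alpha> = 0 then 1 else 1 / 2 * (\<Sum>i<n. \<Sum>j<n. if up i (up j 0) = \<alpha> then H i j else 0))"
  obtain c where cd: "\<And>\<alpha>. \<alpha> 0 < 2 \<Longrightarrow> c \<alpha> = d \<alpha>"
    and ceq: "\<And>\<alpha>. \<alpha> \<in> multi_idx n \<Longrightarrow> lap n \<epsilon> c \<alpha> = yamabe_rhs n \<epsilon> T c \<alpha>"
    using yamabe_formal_exists[of n \<epsilon> d T, OF n eps[OF n]] by blast
  have dz: "d \<alpha> = 0" if "\<alpha> \<in> multi_idx n" "deg n \<alpha> = 1 \<or> 3 \<le> deg n \<alpha>" for \<alpha>
  proof -
    have "up i (up j 0) \<noteq> \<alpha>" if "i < n" "j < n" for i j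
    proof
      assume "up i (up j 0) = \<alpha>"
      moreover have "deg n (up i (up j 0)) = 2" using that by (simp add: deg_up)
      ultimately show False using \<open>deg n \<alpha> = 1 \<or> 3 \<le> deg n \<alpha>\<close> by auto
    qed
    moreover have "\<alpha> \<noteq> 0" using that by auto
    ultimately show ?thesis by (simp add: d_def)
  qed
  have c0: "c 0 = 1" using cd[of 0] by (simp add: d_def)
  have c1: "c \<alpha> = 0" if "\<alpha> \<in> level n 1" for \<alpha>
    using that cd[of \<alpha>] dz[of \<alpha>] level_index0_le[OF that, of 0] by (simp add: level_def)
  have pd0: "pd i c 0 = 0" if "i < n" for i
  proof -
    have "up i 0 \<in> level n 1" using that by (simp add: up_in_level level_0)
    then show ?thesis by (simp add: pd_def c1)
  qed
  have dH: "d (up k (up l 0)) = (if k = l then 1 / 2 else 1) * H k l" if "k < n" "l < n" for k l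
  proof -
    have eq: "up i (up j 0) = up k (up l 0) \<longleftrightarrow> i = k \<and> j = l \<or> i = l \<and> j = k" for i j
    proof
      assume e: "up i (up j 0) = up k (up l 0)"
      have up2: "up i (up j 0) m = (if m = i then 1 else 0) + (if m = j then 1 else 0)" for i j m :: nat
        by (simp add: up_apply)
      have e: "(if m = i then 1 else 0) + (if m = j then 1 else 0) = (if m = k then 1 else 0) + (if m = l then 1 else 0 :: nat)" for m
        using fun_cong[OF e, of m] unfolding up2 .
      show "i = k \<and> j = l \<or> i = l \<and> j = k" using e[of i] e[of j] by (cases "i = k"; cases "j = l"; cases "i = l"; cases "j = k"; simp)
    qed (use up_commute[of l k 0] in auto)
    have ne: "up k (up l 0) \<noteq> 0"
    proof
      assume "up k (up l 0) = 0"
      from fun_cong[OF this, of k] show False by (simp add: up_apply)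
    qed
    have "(\<Sum>i<n. \<Sum>j<n. if up i (up j 0) = up k (up l 0) then H i j else 0) =
       (\<Sum>(i,j)\<in>{..<n}\<times>{..<n}. if (i, j) \<in> {(k,l), (l,k)} then H i j else 0)"
      unfolding sum.cartesian_product eq by (intro sum.cong) auto
    also have "\<dots> = (\<Sum>(i,j)\<in>{(k,l), (l,k)}. H i j)"
      using that by (intro sum.mono_neutral_cong_right) (auto split: if_splits)
    also have "\<dots> = (if k = l then 1 else 2) * H k l" using sym[of k l] by auto
    finally show ?thesis using ne by (simp add: d_def)
  qed
  have pdd: "pd i (pd j c) 0 = (if i = j then 2 else 1) * c (up i (up j 0))" for i j
    by (simp add: pd_def up_apply up_commute)
  have hess: "pd i (pd j c) 0 = H i j" if "i < n" "j < n" "i \<noteq> 0 \<or> j \<noteq> 0" for i j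
  proof -
    have "c (up i (up j 0)) = d (up i (up j 0))" using that by (intro cd) (auto simp: up_apply)
    then show ?thesis using that by (simp add: pdd dH)
  qed
  \<comment> \<open>The coefficient of \<open>x_0^2\<close> is not part of the data. The constant
    term of the equation gives the trace of the Hessian, and as the other diagonal entries are
    already right, the remaining one must be \<open>H 0 0\<close>.\<close>
  have "lap n \<epsilon> c 0 = T"
  proof -
    have "{..0::nat \<Rightarrow> nat} = {0}" by (auto simp: le_fun_def fun_eq_iff)
    then show ?thesis by (simp add: ceq yamabe_rhs_def conv_def pd0)
  qed
  moreover have "T = \<epsilon> 0 * H 0 0 + (\<Sum>i\<in>{1..<n}. \<epsilon> i * H i i)"
    unfolding T_def lessThan_atLeast0 using n by (subst sum.atLeast_Suc_lessThan) auto
  moreover have "(\<Sum>i\<in>{1..<n}. \<epsilon> i * pd i (pd i c) 0) = (\<Sum>i\<in>{1..<n}. \<epsilon> i * H i i)"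
    by (intro sum.cong) (auto simp: hess)
  ultimately have "\<epsilon> 0 * pd 0 (pd 0 c) 0 = \<epsilon> 0 * H 0 0" unfolding lap_split[OF n] by simp
  then have "pd 0 (pd 0 c) 0 = H 0 0" using eps[OF n] by (metis abs_zero mult_left_cancel zero_neq_one)
  then have hess: "pd i (pd j c) 0 = H i j" if "i < n" "j < n" for i j
    using that hess by metis
  have data: "c \<alpha> = 0" if "\<alpha> \<in> multi_idx n" "3 \<le> deg n \<alpha>" "\<alpha> 0 < 2" for \<alpha>
    using that by (simp add: cd dz)
  obtain E r0 where E: "0 < E" "0 < r0"
    and bound: "\<And>s m. 0 \<le> s \<Longrightarrow> s \<le> r0 \<Longrightarrow> (\<Sum>k\<le>m. wnorm n (k + 2) c * s ^ k) \<le> E"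
    using yamabe_formal_bound[OF n eps ceq c1 data] by blast
  \<comment> \<open>\<open>r \<le> 1\<close> and \<open>r \<le> 1 / (2 * E)\<close> give
    \<open>r^2 * E \<le> 1 / 2\<close>. Since \<open>F - 1\<close> starts in degree two, this is the
    smallness required for the reciprocal.\<close>
  define r where "r = min r0 (min 1 (1 / (2 * E)))"
  have r: "0 < r" "r \<le> r0" "r \<le> 1" "r \<le> 1 / (2 * E)" using E by (auto simp: r_def)
  define v where "v = c(0 := 0)"
  have rE: "r\<^sup>2 * E \<le> 1 / 2"
  proof -
    have "r\<^sup>2 \<le> r * 1" unfolding power2_eq_square using r by (intro mult_left_mono) auto
    also have "\<dots> \<le> 1 / (2 * E)" using r by simp
    finally have "r\<^sup>2 * E \<le> 1 / (2 * E) * E" using E by (intro mult_right_mono) auto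
    then show ?thesis using E by simp
  qed
  have vb: "(\<Sum>k\<le>m. wnorm n k v * r ^ k) \<le> 1 / 2" for m
  proof -
    have wv: "wnorm n k v = wnorm n k c" if "k \<noteq> 0" for k
      unfolding v_def using that by (intro wnorm_cong) (auto simp: level_def)
    have w0: "wnorm n 0 v = 0" by (simp add: wnorm_def level_0 v_def)
    have w1: "wnorm n (Suc 0) v = 0" using c1 wv[of 1] by (simp add: wnorm_def)
    have "(\<Sum>k\<le>m. wnorm n k v * r ^ k) \<le> (\<Sum>k\<le>Suc (Suc m). wnorm n k v * r ^ k)"
      using r by (intro sum_mono2 mult_nonneg_nonneg wnorm_nonneg) auto
    also have "\<dots> = (\<Sum>k\<le>m. wnorm n (k + 2) c * r ^ k) * r\<^sup>2"
      unfolding sum.atMost_Suc_shift sum_distrib_right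
      by (simp add: w0 w1 wv power2_eq_square mult_ac del: sum.atMost_Suc)
    also have "\<dots> \<le> E * r\<^sup>2" using bound[of r m] r by (intro mult_right_mono) auto
    also have "\<dots> \<le> 1 / 2" using rE by (simp add: mult.commute)
    finally show ?thesis .
  qed
  obtain g where g: "\<And>\<alpha>. \<alpha> \<in> multi_idx n \<Longrightarrow> g \<alpha> = (if \<alpha> = 0 then 1 else 0) - conv g v \<alpha>"
    unfolding v_def using formal_inverse_exists by blast
  have gb: "(\<Sum>k\<le>m. wnorm n k g * r ^ k) \<le> 2" for m
    by (rule formal_inverse_bound[OF g]) (use r vb in auto)
  have sv: "(\<lambda>\<alpha>. \<bar>v \<alpha>\<bar> * (r / 2) ^ deg n \<alpha>) summable_on multi_idx n"
    by (rule abs_summable_of_wnorm_bound[OF _ vb]) (use r in auto)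
  have sc: "(\<lambda>\<alpha>. \<bar>c \<alpha>\<bar> * (r / 2) ^ deg n \<alpha>) summable_on multi_idx n"
  proof -
    have "(\<lambda>\<alpha>. \<bar>c \<alpha>\<bar> * (r / 2) ^ deg n \<alpha>) summable_on ({0} \<union> (multi_idx n - {0}))"
    proof (rule summable_on_Un_disjoint)
      have "(\<lambda>\<alpha>. \<bar>v \<alpha>\<bar> * (r / 2) ^ deg n \<alpha>) summable_on (multi_idx n - {0})"
        by (rule summable_on_subset[OF sv]) auto
      then show "(\<lambda>\<alpha>. \<bar>c \<alpha>\<bar> * (r / 2) ^ deg n \<alpha>) summable_on (multi_idx n - {0})"
        by (rule summable_on_cong[THEN iffD1, rotated]) (simp add: v_def)
    qed auto
    moreover have "{0} \<union> (multi_idx n - {0}) = multi_idx n" by auto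
    ultimately show ?thesis by simp
  qed
  show ?thesis
  proof (rule that[of "r / 2" c g])
    show "(\<lambda>\<alpha>. \<bar>g \<alpha>\<bar> * (r / 2) ^ deg n \<alpha>) summable_on multi_idx n"
      by (rule abs_summable_of_wnorm_bound[OF _ gb]) (use r in auto)
    show "conv g c \<alpha> = (if \<alpha> = 0 then 1 else 0)" if "\<alpha> \<in> multi_idx n" for \<alpha>
      using conv_upd_0[OF that, of g c] g[OF that] by (simp add: c0 v_def)
    show "conv (lap n \<epsilon> c) c \<alpha> =
       (if \<alpha> = 0 then \<Sum>i<n. \<epsilon> i * H i i else 0) + real n / 2 * (\<Sum>i<n. \<epsilon> i * conv (pd i c) (pd i c) \<alpha>)"
      if "\<alpha> \<in> multi_idx n" for \<alpha>
      using conv_upd_0[OF that, of "lap n \<epsilon> c" c] ceq[OF that] by (simp add: c0 yamabe_rhs_def T_def)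
  qed (use r sc c0 pd0 hess in auto)
qed

section \<open>Convergent power series in several variables\<close>

definition mpow :: "nat \<Rightarrow> coords \<Rightarrow> (nat \<Rightarrow> nat) \<Rightarrow> real" where
  "mpow n x \<alpha> = (\<Prod>i<n. x i ^ \<alpha> i)"

text \<open>Coordinates from \<open>n\<close> on are unrestricted: a power series ignores them, and
  the box becomes open in the space of all coordinate functions. \<open>cube\<close> restores the
  restriction to \<open>n\<close> dimensions.\<close>

definition polybox :: "nat \<Rightarrow> real \<Rightarrow> coords set" where
  "polybox n \<rho> = {x. \<forall>i<n. \<bar>x i\<bar> < \<rho>}"

definition has_pseries :: "nat \<Rightarrow> real \<Rightarrow> ((nat \<Rightarrow> nat) \<Rightarrow> real) \<Rightarrow> (coords \<Rightarrow> real) \<Rightarrow> bool" where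
  "has_pseries n \<rho> c f \<longleftrightarrow>
     (\<forall>x\<in>polybox n \<rho>. ((\<lambda>\<alpha>. c \<alpha> * mpow n x \<alpha>) has_sum f x) (multi_idx n))"

section \<open>Operations on convergent power series\<close>

lemma polybox_upd: "x \<in> polybox n \<rho> \<Longrightarrow> \<bar>t\<bar> < \<rho> \<Longrightarrow> x(i := t) \<in> polybox n \<rho>"
  by (simp add: polybox_def)

lemma open_polybox: "open (polybox n \<rho>)"
proof -
  have "open {x :: coords. \<bar>x i\<bar> < \<rho>}" for i
    by (intro open_Collect_less continuous_intros continuous_on_product_coordinates)
  then have "open (\<Inter>i\<in>{..<n}. {x :: coords. \<bar>x i\<bar> < \<rho>})" by (intro open_INT) auto
  also have "(\<Inter>i\<in>{..<n}. {x :: coords. \<bar>x i\<bar> < \<rho>}) = polybox n \<rho>" by (auto simp: polybox_def)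
  finally show ?thesis .
qed

lemma mpow_const: "mpow n (\<lambda>_. r) \<alpha> = r ^ deg n \<alpha>"
  by (simp add: mpow_def deg_def power_sum)

lemma abs_mpow: "\<bar>mpow n x \<alpha>\<bar> = mpow n (\<lambda>i. \<bar>x i\<bar>) \<alpha>"
  by (simp add: mpow_def abs_prod power_abs)

lemma abs_mpow_le: "(\<And>i. i < n \<Longrightarrow> \<bar>x i\<bar> \<le> r) \<Longrightarrow> \<bar>mpow n x \<alpha>\<bar> \<le> r ^ deg n \<alpha>"
proof -
  assume le: "\<And>i. i < n \<Longrightarrow> \<bar>x i\<bar> \<le> r"
  have "mpow n (\<lambda>i. \<bar>x i\<bar>) \<alpha> \<le> mpow n (\<lambda>_. r) \<alpha>"
    unfolding mpow_def by (intro prod_mono) (simp add: power_mono le)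
  then show ?thesis by (simp add: abs_mpow mpow_const)
qed

lemma mpow_add: "mpow n x (\<alpha> + \<beta>) = mpow n x \<alpha> * mpow n x \<beta>"
  by (simp add: mpow_def power_add prod.distrib plus_fun_def)

lemma has_pseries_of_summable:
  assumes "(\<lambda>\<alpha>. \<bar>c \<alpha>\<bar> * \<rho> ^ deg n \<alpha>) summable_on multi_idx n"
  shows "has_pseries n \<rho> c (\<lambda>x. \<Sum>\<^sub>\<infinity>\<alpha>\<in>multi_idx n. c \<alpha> * mpow n x \<alpha>)"
  unfolding has_pseries_def
proof (intro ballI has_sum_infsum)
  fix x assume x: "x \<in> polybox n \<rho>"
  have "(\<lambda>\<alpha>. norm (c \<alpha> * mpow n x \<alpha>)) summable_on multi_idx n"
  proof (rule Infinite_Sum.abs_summable_on_comparison_test'[OF assms])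
    fix \<alpha>
    have "\<bar>mpow n x \<alpha>\<bar> \<le> \<rho> ^ deg n \<alpha>" using x by (intro abs_mpow_le) (auto simp: polybox_def less_imp_le)
    then show "norm (c \<alpha> * mpow n x \<alpha>) \<le> \<bar>c \<alpha>\<bar> * \<rho> ^ deg n \<alpha>" by (simp add: abs_mult mult_left_mono)
  qed
  then show "(\<lambda>\<alpha>. c \<alpha> * mpow n x \<alpha>) summable_on multi_idx n" by (rule abs_summable_summable)
qed

text \<open>Evaluate at the diagonal point \<open>(R, ..., R)\<close>; for real families
  unconditional and absolute summability agree.\<close>

lemma has_pseries_abs_summable:
  assumes "has_pseries n \<rho> c f" "0 \<le> R" "R < \<rho>"
  shows "(\<lambda>\<alpha>. \<bar>c \<alpha>\<bar> * R ^ deg n \<alpha>) summable_on multi_idx n"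
proof -
  have "(\<lambda>_. R) \<in> polybox n \<rho>" using assms by (simp add: polybox_def)
  then have "(\<lambda>\<alpha>. c \<alpha> * mpow n (\<lambda>_. R) \<alpha>) summable_on multi_idx n"
    using assms(1) unfolding has_pseries_def by (meson has_sum_imp_summable)
  then have "(\<lambda>\<alpha>. norm (c \<alpha> * mpow n (\<lambda>_. R) \<alpha>)) summable_on multi_idx n"
    by (rule summable_on_iff_abs_summable_on_real[THEN iffD1])
  then show ?thesis using assms by (simp add: mpow_const abs_mult)
qed

lemma has_pseries_at_0: "has_pseries n \<rho> c f \<Longrightarrow> 0 < \<rho> \<Longrightarrow> f 0 = c 0"
proof -
  assume ps: "has_pseries n \<rho> c f" and "0 < \<rho>"
  then have "((\<lambda>\<alpha>. c \<alpha> * mpow n 0 \<alpha>) has_sum f 0) (multi_idx n)"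
    by (simp add: has_pseries_def polybox_def)
  moreover have "((\<lambda>\<alpha>. c \<alpha> * mpow n 0 \<alpha>) has_sum c 0) (multi_idx n)"
  proof (rule has_sum_finite_neutralI[of "{0}"])
    fix \<alpha> assume "\<alpha> \<in> multi_idx n - {0}"
    then have "deg n \<alpha> \<noteq> 0" by (simp add: deg_eq_0_iff)
    then have "mpow n (\<lambda>_. 0) \<alpha> = 0" by (simp add: mpow_const)
    then show "c \<alpha> * mpow n 0 \<alpha> = 0" by (simp add: zero_fun_def)
  qed (auto simp: mpow_def)
  ultimately show ?thesis by (rule has_sum_unique)
qed

lemma has_pseries_add:
  "has_pseries n \<rho> c f \<Longrightarrow> has_pseries n \<rho> d g \<Longrightarrow> has_pseries n \<rho> (\<lambda>\<alpha>. c \<alpha> + d \<alpha>) (\<lambda>x. f x + g x)"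
  unfolding has_pseries_def distrib_right by (intro ballI has_sum_add) auto

lemma has_pseries_scale:
  "has_pseries n \<rho> c f \<Longrightarrow> has_pseries n \<rho> (\<lambda>\<alpha>. a * c \<alpha>) (\<lambda>x. a * f x)"
  unfolding has_pseries_def mult.assoc by (intro ballI has_sum_cmult_right) auto

lemma has_pseries_const: "has_pseries n \<rho> (\<lambda>\<alpha>. if \<alpha> = 0 then a else 0) (\<lambda>x. a)"
  unfolding has_pseries_def by (auto intro!: has_sum_finite_neutralI[of "{0}"] simp: mpow_def split: if_splits)

lemma has_pseries_sum:
  assumes "finite I" "\<And>i. i \<in> I \<Longrightarrow> has_pseries n \<rho> (c i) (f i)"
  shows "has_pseries n \<rho> (\<lambda>\<alpha>. \<Sum>i\<in>I. c i \<alpha>) (\<lambda>x. \<Sum>i\<in>I. f i x)"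
  using assms
proof (induction I rule: finite_induct)
  case empty then show ?case by (simp add: has_pseries_def)
next
  case (insert i I)
  then show ?case using has_pseries_add[of n \<rho> "c i" "f i" "\<lambda>\<alpha>. \<Sum>i\<in>I. c i \<alpha>" "\<lambda>x. \<Sum>i\<in>I. f i x"] by simp
qed

lemma has_pseries_coord:
  assumes "i < n"
  shows "has_pseries n \<rho> (\<lambda>\<alpha>. if \<alpha> = up i 0 then 1 else 0) (\<lambda>x. x i)"
  unfolding has_pseries_def
proof
  fix x
  have "mpow n x (up i 0) = (\<Prod>j<n. if j = i then x i else 1)"
    unfolding mpow_def by (intro prod.cong) (auto simp: up_apply)
  also have "\<dots> = x i" using assms by simp
  finally show "((\<lambda>\<alpha>. (if \<alpha> = up i 0 then 1 else 0) * mpow n x \<alpha>) has_sum x i) (multi_idx n)"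
    using assms by (intro has_sum_finite_neutralI[of "{up i 0}"]) (auto simp: up_in_multi_idx)
qed

lemma has_pseries_unique:
  "has_pseries n \<rho> c f \<Longrightarrow> has_pseries n \<rho> d g \<Longrightarrow> (\<And>\<alpha>. \<alpha> \<in> multi_idx n \<Longrightarrow> c \<alpha> = d \<alpha>) \<Longrightarrow> x \<in> polybox n \<rho> \<Longrightarrow> f x = g x"
proof -
  assume f: "has_pseries n \<rho> c f" and g: "has_pseries n \<rho> d g"
    and eq: "\<And>\<alpha>. \<alpha> \<in> multi_idx n \<Longrightarrow> c \<alpha> = d \<alpha>" and x: "x \<in> polybox n \<rho>"
  have "((\<lambda>\<alpha>. c \<alpha> * mpow n x \<alpha>) has_sum f x) (multi_idx n)" using f x by (simp add: has_pseries_def)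
  then have "((\<lambda>\<alpha>. d \<alpha> * mpow n x \<alpha>) has_sum f x) (multi_idx n)"
    by (rule has_sum_cong[THEN iffD1, rotated]) (simp add: eq)
  moreover have "((\<lambda>\<alpha>. d \<alpha> * mpow n x \<alpha>) has_sum g x) (multi_idx n)" using g x by (simp add: has_pseries_def)
  ultimately show ?thesis by (rule has_sum_unique)
qed

text \<open>Joint summability over the product set comes from the absolute summability of both
  factors.\<close>

lemma has_sum_product_real:
  fixes f :: "'a \<Rightarrow> real" and g :: "'b \<Rightarrow> real"
  assumes f: "(f has_sum a) A" and g: "(g has_sum b) B"
  shows "((\<lambda>(x, y). f x * g y) has_sum (a * b)) (A \<times> B)"
proof (rule has_sum_SigmaI)
  show "((\<lambda>y. case (x, y) of (x, y) \<Rightarrow> f x * g y) has_sum f x * b) B" for x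
    using has_sum_cmult_right[OF g] by simp
  show "((\<lambda>x. f x * b) has_sum a * b) A" by (rule has_sum_cmult_left[OF f])
  have fa: "(\<lambda>x. \<bar>f x\<bar>) summable_on A" and ga: "(\<lambda>x. \<bar>g x\<bar>) summable_on B"
    using f g summable_on_iff_abs_summable_on_real[of f] summable_on_iff_abs_summable_on_real[of g]
    by (auto dest!: has_sum_imp_summable)
  have "(\<lambda>(x, y). \<bar>f x\<bar> * \<bar>g y\<bar>) summable_on A \<times> B"
  proof (rule summable_on_SigmaI)
    show "((\<lambda>y. case (x, y) of (x, y) \<Rightarrow> \<bar>f x\<bar> * \<bar>g y\<bar>) has_sum \<bar>f x\<bar> * infsum (\<lambda>y. \<bar>g y\<bar>) B) B" for x
      using has_sum_cmult_right[OF has_sum_infsum[OF ga]] by simp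
    show "(\<lambda>x. \<bar>f x\<bar> * infsum (\<lambda>y. \<bar>g y\<bar>) B) summable_on A" by (rule summable_on_cmult_left[OF fa])
  qed auto
  then have "(\<lambda>p. norm (case p of (x, y) \<Rightarrow> f x * g y)) summable_on A \<times> B"
    by (rule summable_on_cong[THEN iffD1, rotated]) (auto simp: abs_mult)
  then show "(\<lambda>(x, y). f x * g y) summable_on A \<times> B" by (rule abs_summable_summable)
qed

text \<open>Pairs \<open>(\<beta>, \<gamma>)\<close> are regrouped by their sum; the fibre over
  \<open>\<alpha>\<close> is the finite set of multi-indices below \<open>\<alpha>\<close>.\<close>

lemma has_pseries_mult:
  assumes "has_pseries n \<rho> c f" "has_pseries n \<rho> d g"
  shows "has_pseries n \<rho> (conv c d) (\<lambda>x. f x * g x)"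
  unfolding has_pseries_def
proof
  fix x assume x: "x \<in> polybox n \<rho>"
  let ?M = "multi_idx n"
  let ?t = "\<lambda>\<beta> \<gamma>. (c \<beta> * mpow n x \<beta>) * (d \<gamma> * mpow n x \<gamma>)"
  have "((\<lambda>(\<beta>, \<gamma>). ?t \<beta> \<gamma>) has_sum (f x * g x)) (?M \<times> ?M)"
    using assms x by (intro has_sum_product_real) (auto simp: has_pseries_def)
  also have "((\<lambda>(\<beta>, \<gamma>). ?t \<beta> \<gamma>) has_sum (f x * g x)) (?M \<times> ?M) \<longleftrightarrow>
      ((\<lambda>(\<alpha>, \<beta>). ?t \<beta> (\<alpha> - \<beta>)) has_sum (f x * g x)) (Sigma ?M (\<lambda>\<alpha>. {..\<alpha>}))"
  proof (rule has_sum_reindex_bij_witness[of _ "\<lambda>(\<alpha>, \<beta>). (\<beta>, \<alpha> - \<beta>)" "\<lambda>(\<beta>, \<gamma>). (\<beta> + \<gamma>, \<beta>)"], goal_cases)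
    case (1 a) then show ?case by (auto simp: fun_eq_iff)
  next
    case (2 a) then show ?case by (auto simp: multi_idx_add le_fun_def)
  next
    case (3 a) then show ?case by (auto simp: fun_eq_iff le_fun_def)
  next
    case (4 a) then show ?case
      by (cases a) (use multi_idx_le[of "snd a" "fst a" n] in \<open>auto simp: multi_idx_diff\<close>)
  next
    case (5 a)
    have "\<beta> + \<gamma> - \<beta> = \<gamma>" for \<beta> \<gamma> :: "nat \<Rightarrow> nat" by (simp add: fun_eq_iff)
    then show ?case by (auto split: prod.split)
  qed simp
  finally have "((\<lambda>(\<alpha>, \<beta>). ?t \<beta> (\<alpha> - \<beta>)) has_sum (f x * g x)) (Sigma ?M (\<lambda>\<alpha>. {..\<alpha>}))" .
  then show "((\<lambda>\<alpha>. conv c d \<alpha> * mpow n x \<alpha>) has_sum f x * g x) ?M"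
  proof (rule has_sum_SigmaD)
    fix \<alpha> assume \<alpha>: "\<alpha> \<in> ?M"
    have "?t \<beta> (\<alpha> - \<beta>) = c \<beta> * d (\<alpha> - \<beta>) * mpow n x \<alpha>" if "\<beta> \<le> \<alpha>" for \<beta>
    proof -
      have "\<beta> + (\<alpha> - \<beta>) = \<alpha>" using that by (auto simp: fun_eq_iff le_fun_def)
      then have "mpow n x \<alpha> = mpow n x \<beta> * mpow n x (\<alpha> - \<beta>)" by (metis mpow_add)
      then show ?thesis by simp
    qed
    then show "((\<lambda>\<beta>. case (\<alpha>, \<beta>) of (\<alpha>, \<beta>) \<Rightarrow> ?t \<beta> (\<alpha> - \<beta>)) has_sum conv c d \<alpha> * mpow n x \<alpha>) {..\<alpha>}"
      using finite_atMost_multi_idx[OF \<alpha>] unfolding conv_def sum_distrib_right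
      by (intro has_sum_finiteI sum.cong) (simp_all only: atMost_iff prod.case)
  qed
qed

section \<open>Re-expansion of a power series about another point\<close>

lemma multi_binomial:
  assumes "\<alpha> \<in> multi_idx n"
  shows "(\<Sum>\<beta>\<in>{..\<alpha>}. (\<Prod>i<n. real (\<alpha> i choose \<beta> i) * u i ^ (\<alpha> i - \<beta> i)) * mpow n v \<beta>) = mpow n (\<lambda>i. u i + v i) \<alpha>"
proof -
  let ?t = "\<lambda>i k. real (\<alpha> i choose k) * v i ^ k * u i ^ (\<alpha> i - k)"
  have "mpow n (\<lambda>i. u i + v i) \<alpha> = (\<Prod>i<n. \<Sum>k\<le>\<alpha> i. ?t i k)"
    unfolding mpow_def by (simp add: add.commute[of "u _"] binomial_ring)
  also have "\<dots> = (\<Sum>g\<in>PiE {..<n} (\<lambda>i. {..\<alpha> i}). \<Prod>i<n. ?t i (g i))"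
    by (rule prod_sum_PiE) auto
  also have "\<dots> = (\<Sum>\<beta>\<in>{..\<alpha>}. \<Prod>i<n. ?t i (\<beta> i))"
  proof (rule sum.reindex_bij_witness[of _ "\<lambda>\<beta>. restrict \<beta> {..<n}" "\<lambda>g i. if i < n then g i else 0"], goal_cases)
    case (1 g) then show ?case by (auto simp: fun_eq_iff PiE_def extensional_def)
  next
    case (2 g) then show ?case by (auto simp: le_fun_def PiE_def Pi_def)
  next
    case (3 \<beta>)
    then have "\<beta> \<in> multi_idx n" using multi_idx_le[OF _ assms] by simp
    then show ?case by (auto simp: fun_eq_iff multi_idx_def)
  next
    case (4 \<beta>) then show ?case by (auto simp: le_fun_def)
  qed auto
  also have "\<dots> = (\<Sum>\<beta>\<in>{..\<alpha>}. (\<Prod>i<n. real (\<alpha> i choose \<beta> i) * u i ^ (\<alpha> i - \<beta> i)) * mpow n v \<beta>)"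
    unfolding mpow_def prod.distrib[symmetric] by (intro sum.cong prod.cong) auto
  finally show ?thesis by simp
qed

text \<open>What the monomial \<open>\<alpha>\<close> of a series about the origin contributes to
  the coefficient at \<open>\<beta>\<close> of its expansion about \<open>a\<close>. It is summed
  over the \<open>\<alpha>\<close> above \<open>\<beta>\<close> only, where the subtractions are
  genuine.\<close>

definition recenter :: "nat \<Rightarrow> coords \<Rightarrow> ((nat \<Rightarrow> nat) \<Rightarrow> real) \<Rightarrow> (nat \<Rightarrow> nat) \<Rightarrow> (nat \<Rightarrow> nat) \<Rightarrow> real" where
  "recenter n a c \<beta> \<alpha> = c \<alpha> * (\<Prod>i<n. real (\<alpha> i choose \<beta> i) * a i ^ (\<alpha> i - \<beta> i))"

text \<open>Expand each power of \<open>a + y\<close> binomially and exchange the summations, which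
  is legitimate since the series of absolute values converges at
  \<open>|a i| + |y i| \<le> R < \<rho>\<close>. Analyticity at every point of the cube and
  differentiability both rest on this.\<close>

lemma has_pseries_recenter:
  assumes ps: "has_pseries n \<rho> c f" and \<rho>: "0 < \<rho>" and a: "a \<in> polybox n \<rho>"
  shows "\<exists>r>0. (\<forall>\<beta>\<in>multi_idx n. recenter n a c \<beta> summable_on {\<alpha> \<in> multi_idx n. \<beta> \<le> \<alpha>}) \<and>
    (\<forall>y. (\<forall>i<n. \<bar>y i\<bar> \<le> r) \<longrightarrow>
       ((\<lambda>\<beta>. infsum (recenter n a c \<beta>) {\<alpha> \<in> multi_idx n. \<beta> \<le> \<alpha>} * mpow n y \<beta>) has_sum f (\<lambda>i. a i + y i)) (multi_idx n))"
proof -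
  let ?M = "multi_idx n"
  \<comment> \<open>The largest \<open>|a i|\<close>, with 0 included for the case
    \<open>n = 0\<close>. Half of the distance from it to \<open>\<rho>\<close> is left for
    \<open>y\<close>.\<close>
  define R' where "R' = Max (insert 0 ((\<lambda>i. \<bar>a i\<bar>) ` {..<n}))"
  have R'0: "0 \<le> R'" unfolding R'_def by (intro Max_ge) auto
  have aR': "\<bar>a i\<bar> \<le> R'" if "i < n" for i unfolding R'_def using that by (intro Max_ge) auto
  have "R' \<in> insert 0 ((\<lambda>i. \<bar>a i\<bar>) ` {..<n})" unfolding R'_def by (intro Max_in) auto
  then have R'\<rho>: "R' < \<rho>" using a \<rho> by (auto simp: polybox_def)
  define r where "r = (\<rho> - R') / 2"
  define R where "R = R' + r"
  have r: "0 < r" and R: "0 \<le> R" "R < \<rho>" using R'0 R'\<rho> by (auto simp: r_def R_def field_simps)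
  let ?t = "\<lambda>y \<alpha> \<beta>. recenter n a c \<beta> \<alpha> * mpow n y \<beta>"
  have inbox: "(\<lambda>i. a i + y i) \<in> polybox n \<rho>" if "\<And>i. i < n \<Longrightarrow> \<bar>y i\<bar> \<le> r" for y
    unfolding polybox_def
  proof (simp, intro allI impI)
    fix i assume "i < n"
    then show "\<bar>a i + y i\<bar> < \<rho>" using that[of i] aR'[of i] R by (simp add: R_def)
  qed
  have hs: "((\<lambda>(\<beta>, \<alpha>). ?t y \<alpha> \<beta>) has_sum f (\<lambda>i. a i + y i)) (Sigma ?M (\<lambda>\<beta>. {\<alpha> \<in> ?M. \<beta> \<le> \<alpha>}))"
    if y: "\<And>i. i < n \<Longrightarrow> \<bar>y i\<bar> \<le> r" for y
  proof -
    have "((\<lambda>(\<alpha>, \<beta>). ?t y \<alpha> \<beta>) has_sum f (\<lambda>i. a i + y i)) (Sigma ?M (\<lambda>\<alpha>. {..\<alpha>}))"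
    proof (rule has_sum_SigmaI)
      show "((\<lambda>\<alpha>. c \<alpha> * mpow n (\<lambda>i. a i + y i) \<alpha>) has_sum f (\<lambda>i. a i + y i)) ?M"
        using ps inbox[OF y] by (simp add: has_pseries_def)
      show "((\<lambda>\<beta>. case (\<alpha>, \<beta>) of (\<alpha>, \<beta>) \<Rightarrow> ?t y \<alpha> \<beta>) has_sum c \<alpha> * mpow n (\<lambda>i. a i + y i) \<alpha>) {..\<alpha>}" if "\<alpha> \<in> ?M" for \<alpha>
        unfolding multi_binomial[OF that, symmetric] sum_distrib_left using finite_atMost_multi_idx[OF that]
        by (intro has_sum_finiteI) (auto simp: recenter_def mult.assoc intro!: sum.cong)
      have "(\<lambda>(\<alpha>, \<beta>). \<bar>c \<alpha>\<bar> * (\<Prod>i<n. real (\<alpha> i choose \<beta> i) * \<bar>a i\<bar> ^ (\<alpha> i - \<beta> i)) * mpow n (\<lambda>i. \<bar>y i\<bar>) \<beta>) summable_on (Sigma ?M (\<lambda>\<alpha>. {..\<alpha>}))"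
      proof (rule summable_on_SigmaI)
        show "((\<lambda>\<beta>. case (\<alpha>, \<beta>) of (\<alpha>, \<beta>) \<Rightarrow> \<bar>c \<alpha>\<bar> * (\<Prod>i<n. real (\<alpha> i choose \<beta> i) * \<bar>a i\<bar> ^ (\<alpha> i - \<beta> i)) * mpow n (\<lambda>i. \<bar>y i\<bar>) \<beta>) has_sum \<bar>c \<alpha>\<bar> * mpow n (\<lambda>i. \<bar>a i\<bar> + \<bar>y i\<bar>) \<alpha>) {..\<alpha>}" if "\<alpha> \<in> ?M" for \<alpha>
          unfolding multi_binomial[OF that, symmetric] sum_distrib_left using finite_atMost_multi_idx[OF that]
          by (intro has_sum_finiteI) (auto simp: mult.assoc intro!: sum.cong)
        show "(\<lambda>\<alpha>. \<bar>c \<alpha>\<bar> * mpow n (\<lambda>i. \<bar>a i\<bar> + \<bar>y i\<bar>) \<alpha>) summable_on ?M"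
        proof (rule summable_on_comparison_test[OF has_pseries_abs_summable[OF ps R]])
          fix \<alpha>
          have "\<bar>mpow n (\<lambda>i. \<bar>a i\<bar> + \<bar>y i\<bar>) \<alpha>\<bar> \<le> R ^ deg n \<alpha>"
            using aR' y by (intro abs_mpow_le) (auto simp: R_def intro: add_mono)
          then show "\<bar>c \<alpha>\<bar> * mpow n (\<lambda>i. \<bar>a i\<bar> + \<bar>y i\<bar>) \<alpha> \<le> \<bar>c \<alpha>\<bar> * R ^ deg n \<alpha>" by (intro mult_left_mono) auto
        qed (auto simp: mpow_def intro!: mult_nonneg_nonneg prod_nonneg)
      qed (auto simp: mpow_def intro!: mult_nonneg_nonneg prod_nonneg)
      then have "(\<lambda>p. norm (case p of (\<alpha>, \<beta>) \<Rightarrow> ?t y \<alpha> \<beta>)) summable_on (Sigma ?M (\<lambda>\<alpha>. {..\<alpha>}))"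
        by (rule summable_on_cong[THEN iffD1, rotated]) (auto simp: abs_mult recenter_def abs_prod power_abs abs_mpow)
      then show "(\<lambda>(\<alpha>, \<beta>). ?t y \<alpha> \<beta>) summable_on (Sigma ?M (\<lambda>\<alpha>. {..\<alpha>}))" by (rule abs_summable_summable)
    qed
    also have "?this \<longleftrightarrow> ?thesis"
    proof (rule has_sum_reindex_bij_witness[of _ prod.swap prod.swap], goal_cases)
      case (2 p) then show ?case by (cases p) (use multi_idx_le[of "snd p" "fst p" n] in auto)
    qed auto
    finally show ?thesis .
  qed
  \<comment> \<open>Evaluate at \<open>y = (r, ..., r)\<close> and divide by the nonzero
    monomial.\<close>
  have sm: "recenter n a c \<beta> summable_on {\<alpha> \<in> ?M. \<beta> \<le> \<alpha>}" if "\<beta> \<in> ?M" for \<beta>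
  proof -
    have "(\<lambda>(\<beta>, \<alpha>). ?t (\<lambda>_. r) \<alpha> \<beta>) summable_on (Sigma ?M (\<lambda>\<beta>. {\<alpha> \<in> ?M. \<beta> \<le> \<alpha>}))"
      using hs[of "\<lambda>_. r"] r by (auto intro: has_sum_imp_summable)
    then have "(\<lambda>\<alpha>. ?t (\<lambda>_. r) \<alpha> \<beta>) summable_on {\<alpha> \<in> ?M. \<beta> \<le> \<alpha>}" using that by (rule summable_on_SigmaD1)
    moreover have "mpow n (\<lambda>_. r) \<beta> \<noteq> 0" using r by (simp add: mpow_const)
    ultimately show ?thesis by (simp add: summable_on_cmult_left')
  qed
  show ?thesis
  proof (intro exI conjI ballI allI impI, rule r, erule sm)
    fix y assume "\<forall>i<n. \<bar>y i\<bar> \<le> r"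
    then have y: "\<And>i. i < n \<Longrightarrow> \<bar>y i\<bar> \<le> r" by blast
    from hs[OF y] show "((\<lambda>\<beta>. infsum (recenter n a c \<beta>) {\<alpha> \<in> ?M. \<beta> \<le> \<alpha>} * mpow n y \<beta>) has_sum f (\<lambda>i. a i + y i)) ?M"
      by (rule has_sum_SigmaD) (auto intro!: has_sum_cmult_left has_sum_infsum sm)
  qed
qed

lemma recenter_up:
  assumes "i < n"
  shows "recenter n a c (up i 0) (up i \<gamma>) = pd i c \<gamma> * mpow n a \<gamma>"
proof -
  have "(\<Prod>j<n. real (up i \<gamma> j choose up i 0 j) * a j ^ (up i \<gamma> j - up i 0 j)) =
        (\<Prod>j<n. (if j = i then real (Suc (\<gamma> i)) else 1) * a j ^ \<gamma> j)"
    by (intro prod.cong refl) (auto simp: up_apply)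
  also have "\<dots> = real (Suc (\<gamma> i)) * mpow n a \<gamma>"
    unfolding prod.distrib mpow_def using assms by simp
  finally show ?thesis by (simp add: recenter_def pd_def mult_ac)
qed

lemma up_image: "i < n \<Longrightarrow> up i ` multi_idx n = {\<alpha> \<in> multi_idx n. up i 0 \<le> \<alpha>}"
proof (intro equalityI subsetI)
  fix \<alpha> assume i: "i < n" and "\<alpha> \<in> {\<alpha> \<in> multi_idx n. up i 0 \<le> \<alpha>}"
  then have m: "\<alpha> \<in> multi_idx n" and le: "up i 0 \<le> \<alpha>" by auto
  have "0 < \<alpha> i" using le_funD[OF le, of i] by (simp add: up_apply)
  then have "\<alpha> = up i (\<alpha>(i := \<alpha> i - 1))" by (auto simp: up_def fun_eq_iff)
  moreover have "\<alpha>(i := \<alpha> i - 1) \<in> multi_idx n" using m i by (auto simp: multi_idx_def)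
  ultimately show "\<alpha> \<in> up i ` multi_idx n" by blast
qed (auto simp: up_in_multi_idx le_fun_def up_apply)

section \<open>Termwise differentiation and continuity\<close>

lemma powser_deriv_at_0:
  fixes s :: "nat \<Rightarrow> real"
  assumes r: "0 < r" and sums: "\<And>t. \<bar>t\<bar> < r \<Longrightarrow> (\<lambda>k. s k * t ^ k) sums h t"
  shows "(h has_real_derivative s 1) (at 0)"
proof -
  have "((\<lambda>t. \<Sum>k. s k * t ^ k) has_real_derivative (\<Sum>k. diffs s k * 0 ^ k)) (at 0)"
    by (rule termdiffs_strong'[of r]) (use sums r in \<open>auto simp: sums_iff\<close>)
  also have "(\<Sum>k. diffs s k * 0 ^ k) = s 1" by (simp add: diffs_def)
  finally show ?thesis
  proof (rule has_field_derivative_transform_within_open)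
    show "open {-r<..<r}" "0 \<in> {-r<..<r}" using r by auto
    show "(\<Sum>k. s k * t ^ k) = h t" if "t \<in> {-r<..<r}" for t
      using sums[of t] that by (auto simp: sums_iff)
  qed
qed

text \<open>Along the \<open>i\<close>-th coordinate line the expansion about \<open>x\<close> is a
  power series in one variable, and its linear coefficient is the derivative. By
  \<open>recenter_up\<close> that coefficient is the sum of the termwise differentiated series,
  whose convergence thus comes for free.\<close>

lemma has_pseries_DERIV:
  assumes ps: "has_pseries n \<rho> c f" and \<rho>: "0 < \<rho>" and i: "i < n" and x: "x \<in> polybox n \<rho>"
  shows "\<exists>D. ((\<lambda>\<alpha>. pd i c \<alpha> * mpow n x \<alpha>) has_sum D) (multi_idx n) \<and>
     ((\<lambda>t. f (x(i := t))) has_real_derivative D) (at (x i))"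
proof -
  let ?M = "multi_idx n"
  obtain r where r: "0 < r"
    and sm: "\<And>\<beta>. \<beta> \<in> ?M \<Longrightarrow> recenter n x c \<beta> summable_on {\<alpha> \<in> ?M. \<beta> \<le> \<alpha>}"
    and hs: "\<And>y. \<forall>i<n. \<bar>y i\<bar> \<le> r \<Longrightarrow>
       ((\<lambda>\<beta>. infsum (recenter n x c \<beta>) {\<alpha> \<in> ?M. \<beta> \<le> \<alpha>} * mpow n y \<beta>) has_sum f (\<lambda>i. x i + y i)) ?M"
    using has_pseries_recenter[OF ps \<rho> x] by blast
  define d where "d = (\<lambda>\<beta>. infsum (recenter n x c \<beta>) {\<alpha> \<in> ?M. \<beta> \<le> \<alpha>})"
  define e where "e = (\<lambda>k::nat. (\<lambda>j::nat. if j = i then k else 0))"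
  have e_in: "e k \<in> ?M" for k using i by (simp add: e_def multi_idx_def)
  have inj_e: "inj e" by (rule injI) (metis e_def)
  have e1: "e 1 = up i 0" by (auto simp: e_def up_def)
  have "((\<lambda>t. f (x(i := x i + t))) has_real_derivative d (e 1)) (at 0)"
  proof (rule powser_deriv_at_0[OF r, of "\<lambda>k. d (e k)"])
    fix t :: real assume t: "\<bar>t\<bar> < r"
    define y where "y = (\<lambda>j. if j = i then t else 0)"
    have "((\<lambda>\<beta>. d \<beta> * mpow n y \<beta>) has_sum f (\<lambda>j. x j + y j)) ?M"
      unfolding d_def by (rule hs) (use t r in \<open>auto simp: y_def\<close>)
    also have "(\<lambda>j. x j + y j) = x(i := x i + t)" by (auto simp: y_def)
    also have "((\<lambda>\<beta>. d \<beta> * mpow n y \<beta>) has_sum f (x(i := x i + t))) ?M \<longleftrightarrow>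
       ((\<lambda>\<beta>. d \<beta> * mpow n y \<beta>) has_sum f (x(i := x i + t))) (range e)"
    \<comment> \<open>\<open>y\<close> is supported on coordinate \<open>i\<close>, so only the
      powers of \<open>y i\<close> survive.\<close>
    proof (rule has_sum_cong_neutral)
      fix \<beta> assume \<beta>: "\<beta> \<in> ?M - range e"
      have "\<exists>j<n. j \<noteq> i \<and> \<beta> j \<noteq> 0"
      proof (rule ccontr)
        assume "\<not> ?thesis"
        then have "\<beta> = e (\<beta> i)" using \<beta> unfolding e_def multi_idx_def by (auto simp: fun_eq_iff) (metis not_le)
        then show False using \<beta> by blast
      qed
      then obtain j where "j < n" "j \<noteq> i" "\<beta> j \<noteq> 0" by blast
      then have "mpow n y \<beta> = 0" unfolding mpow_def by (intro prod_zero) (auto simp: y_def)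
      then show "d \<beta> * mpow n y \<beta> = 0" by simp
    qed (use e_in in auto)
    also have "\<dots> \<longleftrightarrow> ((\<lambda>k. d (e k) * mpow n y (e k)) has_sum f (x(i := x i + t))) UNIV"
      using has_sum_reindex[OF inj_e, of "\<lambda>\<beta>. d \<beta> * mpow n y \<beta>"] by (simp add: comp_def)
    finally have "((\<lambda>k. d (e k) * mpow n y (e k)) has_sum f (x(i := x i + t))) UNIV" .
    moreover have "mpow n y (e k) = t ^ k" for k
    proof -
      have "mpow n y (e k) = (\<Prod>j<n. if j = i then t ^ k else 1)"
        unfolding mpow_def by (intro prod.cong) (auto simp: y_def e_def)
      then show ?thesis using i by simp
    qed
    ultimately show "(\<lambda>k. d (e k) * t ^ k) sums f (x(i := x i + t))"
      using has_sum_imp_sums by simp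
  qed
  then have "((\<lambda>t. f (x(i := t))) has_real_derivative d (e 1)) (at (x i))"
    using DERIV_shift[of "\<lambda>t. f (x(i := t))" "d (e 1)" 0 "x i"] by (simp add: add.commute)
  moreover have "((\<lambda>\<alpha>. pd i c \<alpha> * mpow n x \<alpha>) has_sum d (e 1)) ?M"
  proof -
    have "(recenter n x c (e 1) has_sum d (e 1)) (up i ` ?M)"
      unfolding up_image[OF i] d_def e1[symmetric] using sm[OF e_in] by (rule has_sum_infsum)
    then have "((recenter n x c (e 1) \<circ> up i) has_sum d (e 1)) ?M"
      by (subst (asm) has_sum_reindex) (auto intro: inj_on_subset[OF inj_up])
    then show ?thesis unfolding comp_def e1 recenter_up[OF i] .
  qed
  ultimately show ?thesis by blast
qed

lemma has_pseries_partial_deriv: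
  assumes ps: "has_pseries n \<rho> c f" and \<rho>: "0 < \<rho>" and i: "i < n"
  shows "has_pseries n \<rho> (pd i c) (partial_deriv i f)"
    and "x \<in> polybox n \<rho> \<Longrightarrow> ((\<lambda>t. f (x(i := t))) has_real_derivative partial_deriv i f x) (at (x i))"
proof -
  have *: "((\<lambda>\<alpha>. pd i c \<alpha> * mpow n x \<alpha>) has_sum partial_deriv i f x) (multi_idx n) \<and>
     ((\<lambda>t. f (x(i := t))) has_real_derivative partial_deriv i f x) (at (x i))" if x: "x \<in> polybox n \<rho>" for x
  proof -
    obtain D where D: "((\<lambda>\<alpha>. pd i c \<alpha> * mpow n x \<alpha>) has_sum D) (multi_idx n)"
      "((\<lambda>t. f (x(i := t))) has_real_derivative D) (at (x i))"
      using has_pseries_DERIV[OF assms x] by blast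
    have "partial_deriv i f x = D" unfolding partial_deriv_def by (rule DERIV_imp_deriv[OF D(2)])
    then show ?thesis using D by simp
  qed
  show "has_pseries n \<rho> (pd i c) (partial_deriv i f)" using * by (simp add: has_pseries_def)
  show "x \<in> polybox n \<rho> \<Longrightarrow> ((\<lambda>t. f (x(i := t))) has_real_derivative partial_deriv i f x) (at (x i))"
    using * by blast
qed

lemma has_pseries_foldr:
  assumes ps: "has_pseries n \<rho> c f" and \<rho>: "0 < \<rho>"
  shows "set ls \<subseteq> {..<n} \<Longrightarrow> \<exists>c. has_pseries n \<rho> c (foldr partial_deriv ls f)"
  using ps by (induction ls) (auto intro: has_pseries_partial_deriv(1)[OF _ \<rho>])

text \<open>The boxes of radius \<open>R < \<rho>\<close> exhaust the open box, and on each of them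
  the M-test gives uniform convergence.\<close>

lemma has_pseries_continuous_on:
  assumes ps: "has_pseries n \<rho> c f"
  shows "continuous_on (polybox n \<rho>) f"
proof (rule continuous_on_open_UN[of "{R. R < \<rho>}" "polybox n", simplified, THEN continuous_on_subset], goal_cases)
  case (2 R)
  show ?case
  proof (cases "R \<le> 0 \<and> 0 < n")
    case True
    then have "polybox n R = {}" unfolding polybox_def by fastforce
    then show ?thesis by simp
  next
    case R: False
    show ?thesis
    proof (cases "n = 0")
      case True
      \<comment> \<open>Without coordinates every box is the whole space, whatever the sign of its
        radius, and \<open>f\<close> is constant.\<close>
      then have "mpow n x \<alpha> = 1" "x \<in> polybox n \<rho>" for x \<alpha> by (auto simp: mpow_def polybox_def)
      then have "((\<lambda>\<alpha>. c \<alpha>) has_sum f x) (multi_idx n)" for x using ps by (simp add: has_pseries_def)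
      then have "f x = f y" for x y by (metis has_sum_unique)
      then show ?thesis by (metis continuous_on_const continuous_on_cong)
    next
      case False
      with R have R0: "0 \<le> R" by auto
      have "uniform_limit (polybox n R) (\<lambda>X x. \<Sum>\<alpha>\<in>X. c \<alpha> * mpow n x \<alpha>) f (finite_subsets_at_top (multi_idx n))"
      proof (rule Weierstrass_m_test_general')
        show "(\<lambda>\<alpha>. \<bar>c \<alpha>\<bar> * R ^ deg n \<alpha>) summable_on multi_idx n"
          using has_pseries_abs_summable[OF ps R0] 2 by simp
        show "norm (c \<alpha> * mpow n x \<alpha>) \<le> \<bar>c \<alpha>\<bar> * R ^ deg n \<alpha>" if "x \<in> polybox n R" for \<alpha> x
        proof -
          have "\<bar>mpow n x \<alpha>\<bar> \<le> R ^ deg n \<alpha>" using that by (intro abs_mpow_le) (auto simp: polybox_def less_imp_le)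
          then show ?thesis by (simp add: abs_mult mult_left_mono)
        qed
        show "((\<lambda>\<alpha>. c \<alpha> * mpow n x \<alpha>) has_sum f x) (multi_idx n)" if "x \<in> polybox n R" for x
          using ps that 2 by (force simp: has_pseries_def polybox_def)
      qed
      moreover have "continuous_on (polybox n R) (\<lambda>x. \<Sum>\<alpha>\<in>X. c \<alpha> * mpow n x \<alpha>)" for X
        unfolding mpow_def by (intro continuous_intros continuous_on_subset[OF continuous_on_product_coordinates]) auto
      ultimately show ?thesis
        by (intro uniform_limit_theorem[of _ "\<lambda>X x. \<Sum>\<alpha>\<in>X. c \<alpha> * mpow n x \<alpha>"]) (auto intro!: always_eventually)
    qed
  qed
next
  case 3
  show ?case
  proof
    fix x assume x: "x \<in> polybox n \<rho>"
    \<comment> \<open>Including \<open>\<rho> - 1\<close> keeps the set nonempty, with maximum below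
      \<open>\<rho>\<close>, when \<open>n = 0\<close>.\<close>
    define R' where "R' = Max (insert (\<rho> - 1) ((\<lambda>i. \<bar>x i\<bar>) ` {..<n}))"
    have aR': "\<bar>x i\<bar> \<le> R'" if "i < n" for i unfolding R'_def using that by (intro Max_ge) auto
    have "R' \<in> insert (\<rho> - 1) ((\<lambda>i. \<bar>x i\<bar>) ` {..<n})" unfolding R'_def by (intro Max_in) auto
    then have "R' < \<rho>" using x by (auto simp: polybox_def)
    then have "(R' + \<rho>) / 2 < \<rho>" "x \<in> polybox n ((R' + \<rho>) / 2)" using aR' by (force simp: polybox_def)+
    then show "x \<in> (\<Union>R\<in>{R. R < \<rho>}. polybox n R)" by blast
  qed
qed (simp_all add: open_polybox)

section \<open>Smooth and analytic functions on a cube\<close>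

definition cube :: "nat \<Rightarrow> real \<Rightarrow> coords set" where
  "cube n \<rho> = polybox n \<rho> \<inter> topspace (Euclidean_space n)"

text \<open>Bridge from the abstract topology of \<open>Euclidean_space n\<close> to the type-class
  topology on functions.\<close>

lemma subtopology_Euclidean_space:
  assumes "S \<subseteq> topspace (Euclidean_space n)"
  shows "subtopology (Euclidean_space n) S = top_of_set S"
proof -
  have "{x. \<forall>i\<ge>n. x i = 0} \<inter> S = S" using assms by (auto simp: topspace_Euclidean_space)
  then show ?thesis
    unfolding Euclidean_space_def euclidean_product_topology subtopology_subtopology by simp
qed

lemma cube_upd: "x \<in> cube n \<rho> \<Longrightarrow> i < n \<Longrightarrow> \<bar>t\<bar> < \<rho> \<Longrightarrow> x(i := t) \<in> cube n \<rho>"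
  by (simp add: cube_def polybox_upd topspace_Euclidean_space)

lemma eventually_cube_upd:
  assumes "x \<in> cube n \<rho>" "i < n"
  shows "\<forall>\<^sub>F t in nhds (x i). x(i := t) \<in> cube n \<rho>"
proof -
  have "x i \<in> {-\<rho><..<\<rho>}" using assms by (auto simp: cube_def polybox_def abs_less_iff)
  then have "\<forall>\<^sub>F t in nhds (x i). t \<in> {-\<rho><..<\<rho>}" by (intro eventually_nhds_in_open) auto
  then show ?thesis by eventually_elim (rule cube_upd[OF assms], simp add: abs_less_iff)
qed

text \<open>Changing coordinate \<open>i < n\<close> slightly does not leave the cube. This matters
  because chart expressions such as \<open>metric_coeff\<close> have controlled values on the cube
  only.\<close>

lemma partial_deriv_cong:
  assumes "x \<in> cube n \<rho>" "i < n" "\<And>y. y \<in> cube n \<rho> \<Longrightarrow> f y = g y"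
  shows "partial_deriv i f x = partial_deriv i g x"
  unfolding partial_deriv_def
  by (rule deriv_cong_ev[OF eventually_mono[OF eventually_cube_upd[OF assms(1,2)]] refl]) (rule assms(3))

lemma foldr_partial_deriv_cong:
  assumes "\<And>y. y \<in> cube n \<rho> \<Longrightarrow> f y = g y"
  shows "set ls \<subseteq> {..<n} \<Longrightarrow> x \<in> cube n \<rho> \<Longrightarrow> foldr partial_deriv ls f x = foldr partial_deriv ls g x"
proof (induction ls arbitrary: x)
  case (Cons i ls)
  then have "partial_deriv i (foldr partial_deriv ls f) x = partial_deriv i (foldr partial_deriv ls g) x"
    by (intro partial_deriv_cong[of x n \<rho>]) auto
  then show ?case by simp
qed (use assms in auto)

lemma has_pseries_smooth:
  assumes ps: "has_pseries n \<rho> c f" and \<rho>: "0 < \<rho>" and eq: "\<And>x. x \<in> cube n \<rho> \<Longrightarrow> g x = f x"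
  shows "smooth_fun_on n (cube n \<rho>) g"
  unfolding smooth_fun_on_def
proof (intro allI impI conjI ballI)
  fix ls :: "nat list" assume ls: "set ls \<subseteq> {..<n}"
  obtain d where d: "has_pseries n \<rho> d (foldr partial_deriv ls f)" using has_pseries_foldr[OF ps \<rho> ls] ..
  have e: "foldr partial_deriv ls g x = foldr partial_deriv ls f x" if "x \<in> cube n \<rho>" for x
    using foldr_partial_deriv_cong[OF eq ls that] .
  have "continuous_on (cube n \<rho>) (foldr partial_deriv ls f)"
    using has_pseries_continuous_on[OF d] by (rule continuous_on_subset) (auto simp: cube_def)
  then have "continuous_on (cube n \<rho>) (foldr partial_deriv ls g)"
    by (rule continuous_on_eq) (rule e[symmetric])
  moreover have "subtopology (Euclidean_space n) (cube n \<rho>) = top_of_set (cube n \<rho>)"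
    by (rule subtopology_Euclidean_space) (simp add: cube_def)
  ultimately show "continuous_map (subtopology (Euclidean_space n) (cube n \<rho>)) euclideanreal (foldr partial_deriv ls g)"
    by simp
  fix i x assume i: "i < n" and x: "x \<in> cube n \<rho>"
  have "((\<lambda>t. foldr partial_deriv ls f (x(i := t))) has_real_derivative partial_deriv i (foldr partial_deriv ls f) x) (at (x i))"
    using has_pseries_partial_deriv(2)[OF d \<rho> i] x by (simp add: cube_def)
  then have "((\<lambda>t. foldr partial_deriv ls g (x(i := t))) has_real_derivative partial_deriv i (foldr partial_deriv ls f) x) (at (x i))"
    by (rule DERIV_cong_ev[OF refl eventually_mono[OF eventually_cube_upd[OF x i]] refl, THEN iffD1, rotated]) (rule e[symmetric])
  then show "(\<lambda>t. foldr partial_deriv ls g (x(i := t))) differentiable at (x i)"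
    by (auto simp: real_differentiable_def)
qed

lemma has_pseries_real_analytic:
  assumes ps: "has_pseries n \<rho> c f" and \<rho>: "0 < \<rho>" and eq: "\<And>x. x \<in> cube n \<rho> \<Longrightarrow> g x = f x"
  shows "real_analytic_on n (cube n \<rho>) g"
  unfolding real_analytic_on_def
proof
  fix a assume a: "a \<in> cube n \<rho>"
  then have a': "a \<in> polybox n \<rho>" by (simp add: cube_def)
  obtain r where r: "0 < r"
    and hs: "\<And>y. \<forall>i<n. \<bar>y i\<bar> \<le> r \<Longrightarrow>
       ((\<lambda>\<beta>. infsum (recenter n a c \<beta>) {\<alpha> \<in> multi_idx n. \<beta> \<le> \<alpha>} * mpow n y \<beta>) has_sum f (\<lambda>i. a i + y i)) (multi_idx n)"
    using has_pseries_recenter[OF ps \<rho> a'] by blast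
  show "\<exists>c r. 0 < r \<and> (\<forall>x\<in>cube n \<rho>. (\<forall>i<n. \<bar>x i - a i\<bar> < r) \<longrightarrow>
     ((\<lambda>\<alpha>. c \<alpha> * (\<Prod>i<n. (x i - a i) ^ \<alpha> i)) has_sum g x) {\<alpha>. \<forall>i\<ge>n. \<alpha> i = 0})"
  proof (intro exI conjI ballI impI, rule r)
    fix x assume x: "x \<in> cube n \<rho>" "\<forall>i<n. \<bar>x i - a i\<bar> < r"
    show "((\<lambda>\<alpha>. infsum (recenter n a c \<alpha>) {\<alpha>' \<in> multi_idx n. \<alpha> \<le> \<alpha>'} * (\<Prod>i<n. (x i - a i) ^ \<alpha> i)) has_sum g x) {\<alpha>. \<forall>i\<ge>n. \<alpha> i = 0}"
      using hs[of "\<lambda>i. x i - a i"] x eq[of x] by (simp add: mpow_def multi_idx_def less_imp_le)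
  qed
qed

text \<open>Identities between coefficients become identities between functions, since both sides
  are sums of the same convergent series. \<open>G\<close> is the reciprocal of
  \<open>F\<close>.\<close>

lemma yamabe_solution:
  fixes H :: "nat \<Rightarrow> nat \<Rightarrow> real"
  assumes eps: "\<And>i. i < n \<Longrightarrow> \<bar>\<epsilon> i\<bar> = 1" and sym: "\<And>i j. H i j = H j i"
  obtains \<rho> F G c where "0 < \<rho>" "has_pseries n \<rho> c F" "\<exists>g. has_pseries n \<rho> g G"
    "\<And>x. x \<in> polybox n \<rho> \<Longrightarrow> G x * F x = 1"
    "\<And>x. x \<in> polybox n \<rho> \<Longrightarrow> F x * (\<Sum>i<n. \<epsilon> i * partial_deriv i (partial_deriv i F) x)
        - real n / 2 * (\<Sum>i<n. \<epsilon> i * (partial_deriv i F x)\<^sup>2) = (\<Sum>i<n. \<epsilon> i * H i i)"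
    "\<And>x i j. x \<in> polybox n \<rho> \<Longrightarrow> i < n \<Longrightarrow> j < n \<Longrightarrow>
        partial_deriv i (partial_deriv j F) x = partial_deriv j (partial_deriv i F) x"
    "F 0 = 1" "\<And>i. i < n \<Longrightarrow> partial_deriv i F 0 = 0"
    "\<And>i j. i < n \<Longrightarrow> j < n \<Longrightarrow> partial_deriv i (partial_deriv j F) 0 = H i j"
proof (cases "n = 0")
  case True
  \<comment> \<open>For \<open>n = 0\<close> there is no distinguished variable; the constant
    function one serves.\<close>
  show ?thesis
  proof (rule that[of 1 "\<lambda>\<alpha>. if \<alpha> = 0 then 1 else 0" "\<lambda>_. 1" "\<lambda>_. 1"])
    show "\<exists>g. has_pseries n 1 g (\<lambda>_. 1)" using has_pseries_const by blast
  qed (simp_all add: True has_pseries_const)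
next
  case False
  then have n: "0 < n" by simp
  show ?thesis
  proof (rule yamabe_formal_solution[of n \<epsilon> H, OF n eps sym])
  fix c g \<rho>
  assume \<rho>: "0 < \<rho>"
    and sc: "(\<lambda>\<alpha>. \<bar>c \<alpha>\<bar> * \<rho> ^ deg n \<alpha>) summable_on multi_idx n"
    and sg: "(\<lambda>\<alpha>. \<bar>g \<alpha>\<bar> * \<rho> ^ deg n \<alpha>) summable_on multi_idx n"
    and inv: "\<And>\<alpha>. \<alpha> \<in> multi_idx n \<Longrightarrow> conv g c \<alpha> = (if \<alpha> = 0 then 1 else 0)"
    and eq: "\<And>\<alpha>. \<alpha> \<in> multi_idx n \<Longrightarrow> conv (lap n \<epsilon> c) c \<alpha> =
       (if \<alpha> = 0 then \<Sum>i<n. \<epsilon> i * H i i else 0) + real n / 2 * (\<Sum>i<n. \<epsilon> i * conv (pd i c) (pd i c) \<alpha>)"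
    and c0: "c 0 = 1" and c1: "\<And>i. i < n \<Longrightarrow> pd i c 0 = 0"
    and c2: "\<And>i j. i < n \<Longrightarrow> j < n \<Longrightarrow> pd i (pd j c) 0 = H i j"
  define F where "F = (\<lambda>x. \<Sum>\<^sub>\<infinity>\<alpha>\<in>multi_idx n. c \<alpha> * mpow n x \<alpha>)"
  define G where "G = (\<lambda>x. \<Sum>\<^sub>\<infinity>\<alpha>\<in>multi_idx n. g \<alpha> * mpow n x \<alpha>)"
  have F: "has_pseries n \<rho> c F" unfolding F_def by (rule has_pseries_of_summable[OF sc])
  have G: "has_pseries n \<rho> g G" unfolding G_def by (rule has_pseries_of_summable[OF sg])
  have F1: "has_pseries n \<rho> (pd i c) (partial_deriv i F)" if "i < n" for i
    by (rule has_pseries_partial_deriv(1)[OF F \<rho> that])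
  have F2: "has_pseries n \<rho> (pd i (pd j c)) (partial_deriv i (partial_deriv j F))" if "i < n" "j < n" for i j
    by (rule has_pseries_partial_deriv(1)[OF F1[OF that(2)] \<rho> that(1)])
  have L: "has_pseries n \<rho> (lap n \<epsilon> c) (\<lambda>x. \<Sum>i<n. \<epsilon> i * partial_deriv i (partial_deriv i F) x)"
    unfolding lap_def[abs_def] by (intro has_pseries_sum has_pseries_scale F2) auto
  show ?thesis
  proof (rule that[OF \<rho> F])
    show "\<exists>g. has_pseries n \<rho> g G" using G by blast
    fix x assume x: "x \<in> polybox n \<rho>"
    show "G x * F x = 1"
      by (rule has_pseries_unique[OF has_pseries_mult[OF G F] has_pseries_const inv x])
    have "(\<Sum>i<n. \<epsilon> i * partial_deriv i (partial_deriv i F) x) * F x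
        = (\<Sum>i<n. \<epsilon> i * H i i) + real n / 2 * (\<Sum>i<n. \<epsilon> i * (partial_deriv i F x * partial_deriv i F x))"
    proof (rule has_pseries_unique[OF has_pseries_mult[OF L F] _ eq x])
      show "has_pseries n \<rho> (\<lambda>\<alpha>. (if \<alpha> = 0 then \<Sum>i<n. \<epsilon> i * H i i else 0) + real n / 2 * (\<Sum>i<n. \<epsilon> i * conv (pd i c) (pd i c) \<alpha>))
        (\<lambda>x. (\<Sum>i<n. \<epsilon> i * H i i) + real n / 2 * (\<Sum>i<n. \<epsilon> i * (partial_deriv i F x * partial_deriv i F x)))"
        by (intro has_pseries_add has_pseries_const has_pseries_scale has_pseries_sum has_pseries_mult F1) auto
    qed
    then show "F x * (\<Sum>i<n. \<epsilon> i * partial_deriv i (partial_deriv i F) x)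
        - real n / 2 * (\<Sum>i<n. \<epsilon> i * (partial_deriv i F x)\<^sup>2) = (\<Sum>i<n. \<epsilon> i * H i i)"
      by (simp add: power2_eq_square mult.commute)
    \<comment> \<open>Symmetry of the second derivatives is inherited from the formal derivatives,
      which commute on coefficients.\<close>
    show "partial_deriv i (partial_deriv j F) x = partial_deriv j (partial_deriv i F) x" if "i < n" "j < n" for i j
      by (rule has_pseries_unique[OF F2[OF that] F2[OF that(2,1)] _ x]) (simp add: pd_pd_commute)
  next
    show "F 0 = 1" using has_pseries_at_0[OF F \<rho>] c0 by simp
    show "partial_deriv i F 0 = 0" if "i < n" for i using has_pseries_at_0[OF F1[OF that] \<rho>] c1[OF that] by simp
    show "partial_deriv i (partial_deriv j F) 0 = H i j" if "i < n" "j < n" for i j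
      using has_pseries_at_0[OF F2[OF that] \<rho>] c2[OF that] by simp
  qed
  qed
qed

section \<open>Orthonormal frames and contractions\<close>

definition bilinear_on :: "'a::real_vector set \<Rightarrow> ('a \<Rightarrow> 'a \<Rightarrow> real) \<Rightarrow> bool" where
  "bilinear_on V B \<longleftrightarrow> (\<forall>y\<in>V. linear_on V (\<lambda>x. B x y)) \<and> (\<forall>x\<in>V. linear_on V (B x))"

text \<open>The signs are those of the Weyl tensor formula, so that \<open>W = 0\<close> turns
  \<open>A\<close> into such a product with the metric.\<close>

definition kulkarni_nomizu :: "('a \<Rightarrow> 'a \<Rightarrow> real) \<Rightarrow> ('a \<Rightarrow> 'a \<Rightarrow> real) \<Rightarrow> 'a \<Rightarrow> 'a \<Rightarrow> 'a \<Rightarrow> 'a \<Rightarrow> real" where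
  "kulkarni_nomizu S g x y z w = S x w * g y z - S x z * g y w + g x w * S y z - g x z * S y w"

section \<open>Bases, orthonormal frames and traces\<close>

lemma linear_on_sum:
  assumes f: "linear_on V f" and V: "subspace V" and v: "\<And>i. i \<in> I \<Longrightarrow> v i \<in> V"
  shows "f (\<Sum>i\<in>I. c i *\<^sub>R v i) = (\<Sum>i\<in>I. c i *\<^sub>R f (v i))"
proof -
  have f0: "f 0 = 0"
  proof -
    have "f (0 *\<^sub>R 0) = 0 *\<^sub>R f 0" using f subspace_0[OF V] unfolding linear_on_def by blast
    then show ?thesis by simp
  qed
  show ?thesis
  proof (cases "finite I")
    case True
    then show ?thesis using v
    proof (induction I rule: finite_induct)
      case (insert i I)
      have "c i *\<^sub>R v i \<in> V" using insert.prems V by (simp add: subspace_scale)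
      moreover have "(\<Sum>i\<in>I. c i *\<^sub>R v i) \<in> V" using insert.prems V by (intro subspace_sum subspace_scale) auto
      ultimately have "f (c i *\<^sub>R v i + (\<Sum>i\<in>I. c i *\<^sub>R v i)) = f (c i *\<^sub>R v i) + f (\<Sum>i\<in>I. c i *\<^sub>R v i)"
        using f unfolding linear_on_def by blast
      moreover have "f (c i *\<^sub>R v i) = c i *\<^sub>R f (v i)" using f insert.prems unfolding linear_on_def by blast
      ultimately show ?case using insert by simp
    qed (simp add: f0)
  qed (simp add: f0)
qed

lemma linear_on_add: "linear_on V f \<Longrightarrow> linear_on V g \<Longrightarrow> linear_on V (\<lambda>x. f x + g x)"
  by (simp add: linear_on_def scaleR_add_right)

lemma linear_on_diff: "linear_on V f \<Longrightarrow> linear_on V g \<Longrightarrow> linear_on V (\<lambda>x. f x - g x)"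
  by (simp add: linear_on_def scaleR_diff_right)

lemma linear_on_mult_left: "linear_on V f \<Longrightarrow> linear_on V (\<lambda>x. a * f x :: real)"
  by (simp add: linear_on_def algebra_simps)

lemma linear_on_mult_right: "linear_on V f \<Longrightarrow> linear_on V (\<lambda>x. f x * a :: real)"
  by (simp add: linear_on_def algebra_simps)

lemma linear_on_zero: "linear_on V (\<lambda>x. 0)"
  by (simp add: linear_on_def)

lemma linear_on_sum_fun: "(\<And>i. i \<in> I \<Longrightarrow> linear_on V (f i)) \<Longrightarrow> linear_on V (\<lambda>x. \<Sum>i\<in>I. f i x)"
  by (induction I rule: infinite_finite_induct) (auto intro: linear_on_add linear_on_zero)

lemmas linear_on_intros = linear_on_add linear_on_diff linear_on_mult_left linear_on_mult_right linear_on_sum_fun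

lemma bilinear_onD:
  assumes "bilinear_on V B"
  shows "y \<in> V \<Longrightarrow> linear_on V (\<lambda>x. B x y)" "x \<in> V \<Longrightarrow> linear_on V (B x)" "x \<in> V \<Longrightarrow> linear_on V (\<lambda>y. B x y)"
  using assms by (auto simp: bilinear_on_def)

lemma nondegenerate_form_bilinear: "nondegenerate_form V ip \<Longrightarrow> bilinear_on V ip"
  by (auto simp: nondegenerate_form_def bilinear_on_def)

lemma is_basis_in: "is_basis V f \<Longrightarrow> k < dim V \<Longrightarrow> f k \<in> V"
proof -
  assume f: "is_basis V f" and k: "k < dim V"
  have "f k \<in> span (f ` {..<dim V})" using k by (intro span_base imageI) simp
  moreover have "span (f ` {..<dim V}) = V" using f unfolding is_basis_def by blast
  ultimately show ?thesis by simp
qed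

lemma is_basis_coords:
  assumes "is_basis V f" "v \<in> V"
  obtains u where "v = (\<Sum>k<dim V. u k *\<^sub>R f k)"
proof -
  have inj: "inj_on f {..<dim V}" and "v \<in> span (f ` {..<dim V})" using assms by (auto simp: is_basis_def)
  then obtain u where "v = (\<Sum>x\<in>f ` {..<dim V}. u x *\<^sub>R x)" by (auto simp: span_finite)
  also have "\<dots> = (\<Sum>k<dim V. u (f k) *\<^sub>R f k)" using inj by (simp add: sum.reindex)
  finally show ?thesis by (rule that[of "\<lambda>k. u (f k)"])
qed

lemma is_basis_unique:
  assumes "is_basis V f" and eq: "(\<Sum>k<dim V. u k *\<^sub>R f k) = (\<Sum>k<dim V. w k *\<^sub>R f k)" and k: "k < dim V"
  shows "u k = w k"
proof -
  have inj: "inj_on f {..<dim V}" and ind: "independent (f ` {..<dim V})" using assms(1) by (auto simp: is_basis_def)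
  define d where "d = (\<lambda>x. u (inv_into {..<dim V} f x) - w (inv_into {..<dim V} f x))"
  have "(\<Sum>x\<in>f ` {..<dim V}. d x *\<^sub>R x) = (\<Sum>k<dim V. (u k - w k) *\<^sub>R f k)"
    using inj by (simp add: sum.reindex d_def)
  also have "\<dots> = 0" using eq by (simp add: scaleR_diff_left sum_subtractf)
  finally have "d (f k) = 0" using ind k by (auto simp: dependent_finite)
  then show ?thesis using inj k by (simp add: d_def)
qed

text \<open>Pairing a linear relation with \<open>e i\<close> isolates its \<open>i\<close>-th
  coefficient times \<open>\<sigma> i\<close>; for an indefinite form this asks the vectors to be
  non-null, not merely nonzero.\<close>

lemma orthogonal_is_basis:
  assumes ip: "bilinear_on V ip" and sp: "span (e ` {..<n}) = V"
    and orth: "\<And>i j. i < n \<Longrightarrow> j < n \<Longrightarrow> ip (e i) (e j) = (if i = j then \<sigma> i else 0)"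
    and nz: "\<And>i. i < n \<Longrightarrow> \<sigma> i \<noteq> (0::real)"
  shows "is_basis V e" "dim V = n"
proof -
  have V: "subspace V" using sp subspace_span by blast
  have eV: "e i \<in> V" if "i < n" for i using that sp by (auto intro: span_base)
  have inj: "inj_on e {..<n}"
  proof (rule inj_onI, rule ccontr)
    fix i j assume "i \<in> {..<n}" "j \<in> {..<n}" "e i = e j" "i \<noteq> j"
    then show False using orth[of i i] orth[of i j] nz[of i] by simp
  qed
  have ind: "independent (e ` {..<n})"
  proof
    assume "dependent (e ` {..<n})"
    then obtain u i where i: "i < n" "u (e i) \<noteq> 0" and s: "(\<Sum>x\<in>e ` {..<n}. u x *\<^sub>R x) = 0"
      by (auto simp: dependent_finite)
    from s have "(\<Sum>k<n. u (e k) *\<^sub>R e k) = 0" using inj by (simp add: sum.reindex)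
    then have "ip (e i) (\<Sum>k<n. u (e k) *\<^sub>R e k) = ip (e i) 0" by simp
    moreover have "ip (e i) 0 = 0"
      using linear_on_sum[OF bilinear_onD(2)[OF ip eV[OF i(1)]] V, of "{}"] by simp
    moreover have "ip (e i) (\<Sum>k<n. u (e k) *\<^sub>R e k) = (\<Sum>k<n. u (e k) *\<^sub>R ip (e i) (e k))"
      by (rule linear_on_sum[OF bilinear_onD(2)[OF ip eV[OF i(1)]] V]) (auto intro: eV)
    moreover have "\<dots> = u (e i) * \<sigma> i" using i by (simp add: orth if_distrib cong: if_cong)
    ultimately show False using i nz by simp
  qed
  show d: "dim V = n"
    using dim_eq_card_independent[OF ind] inj sp by (metis card_image card_lessThan dim_span)
  show "is_basis V e" using inj ind sp by (simp add: is_basis_def d)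
qed

locale orthonormal_frame =
  fixes V :: "'a::real_vector set" and ip :: "'a \<Rightarrow> 'a \<Rightarrow> real" and n :: nat and e :: "nat \<Rightarrow> 'a" and \<epsilon> :: "nat \<Rightarrow> real"
  assumes form: "nondegenerate_form V ip" and span_e: "span (e ` {..<n}) = V"
    and orthonormal: "\<And>i j. i < n \<Longrightarrow> j < n \<Longrightarrow> ip (e i) (e j) = (if i = j then \<epsilon> i else 0)"
    and eps: "\<And>i. i < n \<Longrightarrow> \<bar>\<epsilon> i\<bar> = 1"
begin

lemma subspace: "subspace V" using span_e subspace_span by blast

lemma bilinear: "bilinear_on V ip" using form by (rule nondegenerate_form_bilinear)

lemma sym: "x \<in> V \<Longrightarrow> y \<in> V \<Longrightarrow> ip x y = ip y x" using form by (auto simp: nondegenerate_form_def)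

lemma e_in: "i < n \<Longrightarrow> e i \<in> V" using span_e by (auto intro: span_base)

lemma eps_sq: "i < n \<Longrightarrow> \<epsilon> i * \<epsilon> i = 1" using eps by (metis abs_mult_self_eq mult_1)

lemma eps_sq_left: "i < n \<Longrightarrow> \<epsilon> i * (\<epsilon> i * a) = a"
  using eps_sq[of i] by (simp add: mult.assoc[symmetric])

lemma basis: "is_basis V e" and dim: "dim V = n"
proof -
  have "\<epsilon> i \<noteq> 0" if "i < n" for i using eps_sq[OF that] by auto
  then show "is_basis V e" "dim V = n" using orthogonal_is_basis[OF bilinear span_e orthonormal] by blast+
qed

lemma comb_in: "(\<Sum>i<n. c i *\<^sub>R e i) \<in> V"
  using e_in by (intro subspace_sum subspace subspace_scale) auto

lemma ip_comb: "j < n \<Longrightarrow> ip (\<Sum>i<n. c i *\<^sub>R e i) (e j) = c j * \<epsilon> j"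
proof -
  assume j: "j < n"
  have "ip (\<Sum>i<n. c i *\<^sub>R e i) (e j) = (\<Sum>i<n. c i *\<^sub>R ip (e i) (e j))"
    by (rule linear_on_sum[OF bilinear_onD(1)[OF bilinear e_in[OF j]] subspace]) (auto intro: e_in)
  also have "\<dots> = c j * \<epsilon> j" using j by (simp add: orthonormal if_distrib cong: if_cong)
  finally show ?thesis .
qed

lemma expand: "v \<in> V \<Longrightarrow> v = (\<Sum>i<n. (\<epsilon> i * ip v (e i)) *\<^sub>R e i)"
proof -
  assume "v \<in> V"
  then obtain u where u: "v = (\<Sum>i<n. u i *\<^sub>R e i)" using is_basis_coords[OF basis] dim by metis
  have "\<epsilon> i * ip v (e i) = u i" if "i < n" for i
    using eps_sq[OF that] unfolding u ip_comb[OF that] by (simp add: algebra_simps)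
  then show ?thesis using u by simp
qed

lemma linear_expand: "linear_on V f \<Longrightarrow> v \<in> V \<Longrightarrow> f v = (\<Sum>i<n. \<epsilon> i * ip v (e i) * (f (e i) :: real))"
proof -
  assume f: "linear_on V f" and v: "v \<in> V"
  have "f v = f (\<Sum>i<n. (\<epsilon> i * ip v (e i)) *\<^sub>R e i)" by (rule arg_cong[OF expand[OF v]])
  also have "\<dots> = (\<Sum>i<n. (\<epsilon> i * ip v (e i)) *\<^sub>R f (e i))"
    by (rule linear_on_sum[OF f subspace]) (simp add: e_in)
  finally show ?thesis by simp
qed

lemma linear_eqI:
  "linear_on V f \<Longrightarrow> linear_on V g \<Longrightarrow> (\<And>i. i < n \<Longrightarrow> f (e i) = (g (e i) :: real)) \<Longrightarrow> v \<in> V \<Longrightarrow> f v = g v"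
proof -
  assume f: "linear_on V f" and g: "linear_on V g" and eq: "\<And>i. i < n \<Longrightarrow> f (e i) = g (e i)" and v: "v \<in> V"
  show ?thesis unfolding linear_expand[OF f v] linear_expand[OF g v] by (simp add: eq)
qed

text \<open>The contraction with an arbitrary frame is computed by passing to the dual frame \<open>h\<close>.\<close>

lemma contraction:
  assumes B: "bilinear_on V B"
  shows "(\<Sum>j<n. \<Sum>k<n. inv_gram V ip j k * B (frame V j) (frame V k)) = (\<Sum>i<n. \<epsilon> i * B (e i) (e i))"
proof -
  define f where "f = frame V"
  have f: "is_basis V f" unfolding f_def frame_def using someI[of "is_basis V" e] basis by simp
  have fV: "f k \<in> V" if "k < n" for k using is_basis_in[OF f] that dim by simp
  define b where "b = inv_gram V ip"
  have "\<forall>l. \<exists>u. l < n \<longrightarrow> e l = (\<Sum>k<n. u k *\<^sub>R f k)"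
  proof
    fix l show "\<exists>u. l < n \<longrightarrow> e l = (\<Sum>k<n. u k *\<^sub>R f k)"
      using is_basis_coords[OF f e_in[of l]] unfolding dim by blast
  qed
  then have "\<exists>m. \<forall>l. l < n \<longrightarrow> e l = (\<Sum>k<n. m l k *\<^sub>R f k)" by (rule choice)
  then obtain m where m: "\<And>l. l < n \<Longrightarrow> e l = (\<Sum>k<n. m l k *\<^sub>R f k)" by blast
  have "\<exists>b. \<forall>i<n. \<forall>j<n. (\<Sum>k<n. ip (f i) (f k) * b k j) = (if i = j then 1 else 0)"
  \<comment> \<open>Writing \<open>e = m f\<close>, the Gram matrix \<open>\<Gamma>\<close> of
    \<open>f\<close> satisfies \<open>m \<Gamma> m^T = \<epsilon>\<close>; as
    \<open>\<epsilon>\<close> is its own inverse, \<open>\<Gamma>\<close> is inverted by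
    \<open>m^T \<epsilon> m\<close>.\<close>
  proof (rule exI[of _ "\<lambda>k j. \<Sum>l<n. \<epsilon> l * m l k * m l j"], intro allI impI)
    fix i j assume i: "i < n" and j: "j < n"
    have "(\<Sum>k<n. ip (f i) (f k) * (\<Sum>l<n. \<epsilon> l * m l k * m l j)) = (\<Sum>l<n. \<epsilon> l * m l j * (\<Sum>k<n. m l k * ip (f i) (f k)))"
      unfolding sum_distrib_left by (subst sum.swap) (simp add: mult_ac)
    also have "\<dots> = (\<Sum>l<n. \<epsilon> l * m l j * ip (f i) (e l))"
    proof (intro sum.cong refl arg_cong2[where f = "(*)"])
      fix l assume "l \<in> {..<n}"
      then show "(\<Sum>k<n. m l k * ip (f i) (f k)) = ip (f i) (e l)"
        using linear_on_sum[OF bilinear_onD(2)[OF bilinear fV[OF i]] subspace, of "{..<n}" f "m l"] fV m by simp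
    qed
    finally have 1: "(\<Sum>k<n. ip (f i) (f k) * (\<Sum>l<n. \<epsilon> l * m l k * m l j)) = (\<Sum>l<n. \<epsilon> l * m l j * ip (f i) (e l))" .
    have "(\<Sum>k<n. (if k = i then 1 else 0) *\<^sub>R f k) = f i" using i by (simp add: if_distrib[of "\<lambda>c. c *\<^sub>R _"] cong: if_cong)
    also have "f i = (\<Sum>l<n. (\<epsilon> l * ip (f i) (e l)) *\<^sub>R e l)" by (rule expand[OF fV[OF i]])
    also have "\<dots> = (\<Sum>l<n. (\<epsilon> l * ip (f i) (e l)) *\<^sub>R (\<Sum>k<n. m l k *\<^sub>R f k))" using m by simp
    also have "\<dots> = (\<Sum>k<n. (\<Sum>l<n. \<epsilon> l * m l k * ip (f i) (e l)) *\<^sub>R f k)"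
      unfolding scaleR_sum_right scaleR_sum_left
      by (rule trans[OF sum.swap], intro sum.cong refl) (simp only: scaleR_scaleR mult_ac)
    finally have eq: "(\<Sum>k<n. (if k = i then 1 else 0) *\<^sub>R f k) = (\<Sum>k<n. (\<Sum>l<n. \<epsilon> l * m l k * ip (f i) (e l)) *\<^sub>R f k)" .
    have "(if j = i then 1 else 0) = (\<Sum>l<n. \<epsilon> l * m l j * ip (f i) (e l))"
      by (rule is_basis_unique[OF f, unfolded dim, OF eq j])
    then show "(\<Sum>k<n. ip (f i) (f k) * (\<Sum>l<n. \<epsilon> l * m l k * m l j)) = (if i = j then 1 else 0)"
      unfolding 1 by auto
  qed
  then have b: "\<forall>i<n. \<forall>j<n. (\<Sum>k<n. ip (f i) (f k) * b k j) = (if i = j then 1 else 0)"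
    unfolding b_def inv_gram_def inv_matrix_def f_def[symmetric] dim by (rule someI_ex)
  define h where "h = (\<lambda>j. \<Sum>k<n. b k j *\<^sub>R f k)"
  have hV: "h j \<in> V" for j unfolding h_def using fV by (intro subspace_sum subspace subspace_scale) auto
  have fh: "ip (f i) (h j) = (if i = j then 1 else 0)" if "i < n" "j < n" for i j
    using linear_on_sum[OF bilinear_onD(2)[OF bilinear fV[OF that(1)]] subspace, of "{..<n}" f "\<lambda>k. b k j"] fV b that
    by (simp add: h_def mult.commute)
  have dual: "v = (\<Sum>k<n. ip v (h k) *\<^sub>R f k)" if v: "v \<in> V" for v
  proof -
    obtain u where u: "v = (\<Sum>k<n. u k *\<^sub>R f k)" using is_basis_coords[OF f v] dim by metis
    have "ip v (h k) = u k" if "k < n" for k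
      using linear_on_sum[OF bilinear_onD(1)[OF bilinear hV[of k]] subspace, of "{..<n}" f u] fV that
      by (simp add: u fh if_distrib cong: if_cong)
    then show ?thesis using u by simp
  qed
  \<comment> \<open>The double sum is the trace of \<open>B\<close> over \<open>f\<close> and its
    dual frame; expanding \<open>h k\<close> in the orthonormal frame and then summing over
    \<open>k\<close> eliminates \<open>f\<close>.\<close>
  have "(\<Sum>j<n. \<Sum>k<n. b j k * B (f j) (f k)) = (\<Sum>k<n. B (h k) (f k))"
  proof (subst sum.swap, intro sum.cong refl)
    fix k assume "k \<in> {..<n}"
    then show "(\<Sum>j<n. b j k * B (f j) (f k)) = B (h k) (f k)"
      using linear_on_sum[OF bilinear_onD(1)[OF B fV[of k]] subspace, of "{..<n}" f "\<lambda>j. b j k"] fV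
      by (simp add: h_def)
  qed
  also have "\<dots> = (\<Sum>k<n. \<Sum>i<n. \<epsilon> i * ip (h k) (e i) * B (e i) (f k))"
    using linear_expand[OF bilinear_onD(1)[OF B] hV] fV by simp
  also have "\<dots> = (\<Sum>i<n. \<epsilon> i * (\<Sum>k<n. ip (e i) (h k) * B (e i) (f k)))"
    unfolding sum_distrib_left by (subst sum.swap) (use sym hV e_in in \<open>auto intro!: sum.cong simp: mult_ac\<close>)
  also have "\<dots> = (\<Sum>i<n. \<epsilon> i * B (e i) (e i))"
  proof (intro sum.cong refl arg_cong2[where f = "(*)"])
    fix i assume "i \<in> {..<n}"
    then have i: "e i \<in> V" by (simp add: e_in)
    show "(\<Sum>k<n. ip (e i) (h k) * B (e i) (f k)) = B (e i) (e i)"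
      using linear_on_sum[OF bilinear_onD(2)[OF B i] subspace, of "{..<n}" f "\<lambda>k. ip (e i) (h k)"] fV dual[OF i]
      by simp
  qed
  finally show ?thesis unfolding b_def f_def .
qed

lemma frame_in: "k < n \<Longrightarrow> frame V k \<in> V"
proof -
  assume "k < n"
  moreover have "is_basis V (frame V)" unfolding frame_def using someI[of "is_basis V" e] basis by simp
  ultimately show ?thesis using is_basis_in dim by blast
qed

text \<open>Contracting the metric gives \<open>n\<close>, contracting \<open>S\<close> gives its
  trace, and each of the two mixed terms returns \<open>S x w\<close> with a minus sign.\<close>

lemma ricci_kulkarni_nomizu:
  assumes S: "bilinear_on V S"
    and A: "\<And>x y z w. x \<in> V \<Longrightarrow> y \<in> V \<Longrightarrow> z \<in> V \<Longrightarrow> w \<in> V \<Longrightarrow> A x y z w = kulkarni_nomizu S ip x y z w"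
    and x: "x \<in> V" and w: "w \<in> V"
  shows "ricci_tensor V ip A x w = (real n - 2) * S x w + (\<Sum>i<n. \<epsilon> i * S (e i) (e i)) * ip x w"
proof -
  note lin = bilinear_onD[OF S] bilinear_onD[OF bilinear]
  let ?B = "\<lambda>y z. kulkarni_nomizu S ip x y z w"
  have B: "bilinear_on V ?B"
    unfolding bilinear_on_def kulkarni_nomizu_def by (intro conjI ballI linear_on_intros lin x w)
  have "ricci_tensor V ip A x w = (\<Sum>j<n. \<Sum>k<n. inv_gram V ip j k * ?B (frame V j) (frame V k))"
    unfolding ricci_tensor_def dim by (intro sum.cong refl) (simp add: A x w frame_in)
  also have "\<dots> = (\<Sum>i<n. \<epsilon> i * ?B (e i) (e i))" by (rule contraction[OF B])
  also have "\<dots> = (\<Sum>i<n. S x w + ip x w * (\<epsilon> i * S (e i) (e i)) - \<epsilon> i * ip w (e i) * S x (e i) - \<epsilon> i * ip x (e i) * S (e i) w)"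
    by (intro sum.cong refl) (simp add: kulkarni_nomizu_def orthonormal sym[OF w e_in] eps_sq eps_sq_left algebra_simps)
  also have "\<dots> = real n * S x w + ip x w * (\<Sum>i<n. \<epsilon> i * S (e i) (e i)) - S x w - S x w"
    unfolding sum_subtractf sum.distrib sum_distrib_left[symmetric]
    using linear_expand[OF lin(2)[OF x] w] linear_expand[OF lin(1)[OF w] x] by simp
  finally show ?thesis by (simp add: algebra_simps)
qed

lemma scalar_curvature_kulkarni_nomizu:
  assumes S: "bilinear_on V S"
    and A: "\<And>x y z w. x \<in> V \<Longrightarrow> y \<in> V \<Longrightarrow> z \<in> V \<Longrightarrow> w \<in> V \<Longrightarrow> A x y z w = kulkarni_nomizu S ip x y z w"
  shows "scalar_curvature V ip A = 2 * (real n - 1) * (\<Sum>i<n. \<epsilon> i * S (e i) (e i))"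
proof -
  define t where "t = (\<Sum>i<n. \<epsilon> i * S (e i) (e i))"
  note lin = bilinear_onD[OF S] bilinear_onD[OF bilinear]
  let ?B = "\<lambda>x w. (real n - 2) * S x w + t * ip x w"
  have B: "bilinear_on V ?B"
    unfolding bilinear_on_def by (intro conjI ballI linear_on_intros lin)
  have "scalar_curvature V ip A = (\<Sum>j<n. \<Sum>k<n. inv_gram V ip j k * ?B (frame V j) (frame V k))"
    unfolding scalar_curvature_def dim t_def
    by (intro sum.cong refl arg_cong2[where f = "(*)"] ricci_kulkarni_nomizu S A frame_in) auto
  also have "\<dots> = (\<Sum>i<n. \<epsilon> i * ?B (e i) (e i))" by (rule contraction[OF B])
  also have "\<dots> = (\<Sum>i<n. (real n - 2) * (\<epsilon> i * S (e i) (e i)) + t)"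
    by (intro sum.cong refl) (simp add: orthonormal eps_sq eps_sq_left algebra_simps)
  also have "\<dots> = (real n - 2) * t + real n * t" by (simp add: sum.distrib sum_distrib_left[symmetric] t_def)
  finally show ?thesis by (simp add: t_def algebra_simps)
qed

lemma curvature_eqI:
  assumes A: "algebraic_curvature_tensor V A" and S: "bilinear_on V S"
    and eq: "\<And>i j k l. i < n \<Longrightarrow> j < n \<Longrightarrow> k < n \<Longrightarrow> l < n \<Longrightarrow>
      A (e i) (e j) (e k) (e l) = kulkarni_nomizu S ip (e i) (e j) (e k) (e l)"
    and V: "x \<in> V" "y \<in> V" "z \<in> V" "w \<in> V"
  shows "A x y z w = kulkarni_nomizu S ip x y z w"
proof -
  note lin = bilinear_onD[OF S] bilinear_onD[OF bilinear]
  have lA: "linear_on V (\<lambda>w. A w x y z) \<and> linear_on V (\<lambda>w. A x w y z) \<and>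
        linear_on V (\<lambda>w. A x y w z) \<and> linear_on V (\<lambda>w. A x y z w)" if "x \<in> V" "y \<in> V" "z \<in> V" for x y z
    using A that unfolding algebraic_curvature_tensor_def by blast
  have 1: "A (e i) (e j) (e k) w = kulkarni_nomizu S ip (e i) (e j) (e k) w" if "i < n" "j < n" "k < n" "w \<in> V" for i j k w
    by (rule linear_eqI[OF _ _ _ that(4)]) (use that lA e_in eq in \<open>auto simp: kulkarni_nomizu_def intro!: linear_on_intros lin\<close>)
  have 2: "A (e i) (e j) z w = kulkarni_nomizu S ip (e i) (e j) z w" if "i < n" "j < n" "z \<in> V" "w \<in> V" for i j z w
    by (rule linear_eqI[OF _ _ _ that(3), of "\<lambda>z. A (e i) (e j) z w" "\<lambda>z. kulkarni_nomizu S ip (e i) (e j) z w"])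
       (use that lA e_in 1 in \<open>auto simp: kulkarni_nomizu_def intro!: linear_on_intros lin\<close>)
  have 3: "A (e i) y z w = kulkarni_nomizu S ip (e i) y z w" if "i < n" "y \<in> V" "z \<in> V" "w \<in> V" for i y z w
    by (rule linear_eqI[OF _ _ _ that(2), of "\<lambda>y. A (e i) y z w" "\<lambda>y. kulkarni_nomizu S ip (e i) y z w"])
       (use that lA e_in 2 in \<open>auto simp: kulkarni_nomizu_def intro!: linear_on_intros lin\<close>)
  show ?thesis
    by (rule linear_eqI[OF _ _ _ V(1), of "\<lambda>x. A x y z w" "\<lambda>x. kulkarni_nomizu S ip x y z w"])
       (use V lA e_in 3 in \<open>auto simp: kulkarni_nomizu_def intro!: linear_on_intros lin\<close>)
qed

end


text \<open>Gram-Schmidt may stop at null vectors, so a family of maximal size is taken instead;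
  sizes are bounded because such families are independent. Its orthogonal complement
  \<open>W\<close> contains only null vectors, as any other could be normalised and added.
  Polarisation makes the form vanish on \<open>W\<close>, so a vector of \<open>W\<close> is
  orthogonal to all of \<open>V\<close> and hence zero.\<close>

lemma orthonormal_family_exists:
  assumes "fin_dim_space V" and form: "nondegenerate_form V ip"
  obtains B where "finite B" "span B = V" "\<And>b. b \<in> B \<Longrightarrow> ip b b = 1 \<or> ip b b = -1"
    "\<And>b c. b \<in> B \<Longrightarrow> c \<in> B \<Longrightarrow> b \<noteq> c \<Longrightarrow> ip b c = 0"
proof -
  obtain B0 where B0: "finite B0" "span B0 = V" using assms by (auto simp: fin_dim_space_def)
  have V: "subspace V" using B0 subspace_span by blast
  have bil: "bilinear_on V ip" by (rule nondegenerate_form_bilinear[OF form])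
  have sym: "ip x y = ip y x" if "x \<in> V" "y \<in> V" for x y using form that by (auto simp: nondegenerate_form_def)
  have addl: "ip (x + y) z = ip x z + ip y z" if "x \<in> V" "y \<in> V" "z \<in> V" for x y z
    using bilinear_onD(1)[OF bil that(3)] that by (auto simp: linear_on_def)
  have scalel: "ip (c *\<^sub>R x) z = c * ip x z" if "x \<in> V" "z \<in> V" for c x z
    using bilinear_onD(1)[OF bil that(2)] that by (auto simp: linear_on_def)
  define P where "P = (\<lambda>B. finite B \<and> B \<subseteq> V \<and> (\<forall>b\<in>B. ip b b = 1 \<or> ip b b = -1) \<and> (\<forall>b\<in>B. \<forall>c\<in>B. b \<noteq> c \<longrightarrow> ip b c = 0))"
  have bound: "card B \<le> card B0" if PB: "P B" for B
  proof -
    have finB: "finite B" using PB by (simp add: P_def)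
    have "independent B"
    proof
      assume "dependent B"
      then have "\<exists>u. (\<exists>b\<in>B. u b \<noteq> 0) \<and> (\<Sum>x\<in>B. u x *\<^sub>R x) = 0"
        by (simp only: dependent_finite[OF finB])
      then obtain u b where b: "b \<in> B" "u b \<noteq> 0" and s: "(\<Sum>x\<in>B. u x *\<^sub>R x) = 0" by blast
      have bV: "b \<in> V" and xV: "\<And>x. x \<in> B \<Longrightarrow> x \<in> V" and fin: "finite B" using b that by (auto simp: P_def)
      have "ip (\<Sum>x\<in>B. u x *\<^sub>R x) b = (\<Sum>x\<in>B. u x *\<^sub>R ip x b)"
        by (rule linear_on_sum[OF bilinear_onD(1)[OF bil bV] V xV])
      also have "\<dots> = (\<Sum>x\<in>B. if x = b then u b * ip b b else 0)"
        by (intro sum.cong refl) (use that b in \<open>auto simp: P_def\<close>)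
      also have "\<dots> = u b * ip b b" using b fin by simp
      finally have "ip 0 b = u b * ip b b" by (simp add: s)
      moreover have "ip 0 b = 0" using scalel[OF bV bV, of 0] by simp
      moreover have "ip b b \<noteq> 0" using that b by (auto simp: P_def)
      ultimately show False using b by simp
    qed
    then show ?thesis using independent_span_bound[of B0 B] B0 that by (auto simp: P_def)
  qed
  have "P {}" by (simp add: P_def)
  then obtain B where B: "P B" and max: "\<And>C. P C \<Longrightarrow> card C \<le> card B"
    using ex_has_greatest_nat[of P "{}" card "card B0 + 1"] bound by fastforce
  have fin: "finite B" and BV: "\<And>b. b \<in> B \<Longrightarrow> b \<in> V" and unit: "\<And>b. b \<in> B \<Longrightarrow> ip b b = 1 \<or> ip b b = -1"
    and orth: "\<And>b c. b \<in> B \<Longrightarrow> c \<in> B \<Longrightarrow> b \<noteq> c \<Longrightarrow> ip b c = 0" using B by (auto simp: P_def)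
  have spV: "span B \<subseteq> V" using BV V by (simp add: span_minimal subsetI)
  define W where "W = {x \<in> V. \<forall>b\<in>B. ip x b = 0}"
  have iso: "ip x x = 0" if "x \<in> W" for x
  proof (rule ccontr)
    assume nz: "ip x x \<noteq> 0"
    have xV: "x \<in> V" and xB: "\<And>b. b \<in> B \<Longrightarrow> ip x b = 0" using that by (auto simp: W_def)
    define s where "s = 1 / sqrt \<bar>ip x x\<bar>"
    define y where "y = s *\<^sub>R x"
    have yV: "y \<in> V" using xV V by (simp add: y_def subspace_scale)
    have "ip y y = s * s * ip x x"
      using scalel[OF xV yV, of s] scalel[OF xV xV, of s] sym[OF xV yV] by (simp add: y_def)
    also have "\<dots> = ip x x / \<bar>ip x x\<bar>" by (simp add: s_def)
    finally have y1: "ip y y = 1 \<or> ip y y = -1" using nz by (auto simp: abs_if)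
    have yB: "ip y b = 0" if "b \<in> B" for b using scalel[OF xV BV[OF that]] xB[OF that] by (simp add: y_def)
    have "y \<notin> B" using y1 yB by force
    moreover have "P (insert y B)"
      using B yV y1 yB sym[OF BV yV] by (auto simp: P_def)
    ultimately show False using max[of "insert y B"] fin by simp
  qed
  have "V \<subseteq> span B"
  proof
    fix v assume v: "v \<in> V"
    define q where "q = (\<Sum>b\<in>B. (ip b b * ip v b) *\<^sub>R b)"
    have qs: "q \<in> span B" unfolding q_def by (intro span_sum span_scale span_base)
    then have qV: "q \<in> V" using spV by blast
    have proj: "u - (\<Sum>b\<in>B. (ip b b * ip u b) *\<^sub>R b) \<in> W" if u: "u \<in> V" for u
    proof -
      have sV: "(\<Sum>b\<in>B. (ip b b * ip u b) *\<^sub>R b) \<in> V" using BV by (intro subspace_sum V subspace_scale) auto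
      have "ip (u - (\<Sum>b\<in>B. (ip b b * ip u b) *\<^sub>R b)) c = 0" if c: "c \<in> B" for c
      proof -
        have "ip (\<Sum>b\<in>B. (ip b b * ip u b) *\<^sub>R b) c = (\<Sum>b\<in>B. (ip b b * ip u b) *\<^sub>R ip b c)"
          by (rule linear_on_sum[OF bilinear_onD(1)[OF bil BV[OF c]] V BV])
        also have "\<dots> = (\<Sum>b\<in>B. if b = c then ip c c * ip u c * ip c c else 0)"
          using orth[OF _ c] by (intro sum.cong) auto
        also have "\<dots> = ip u c" using c fin unit[OF c] by auto
        finally have 1: "ip (\<Sum>b\<in>B. (ip b b * ip u b) *\<^sub>R b) c = ip u c" .
        have "ip (u + (-1) *\<^sub>R (\<Sum>b\<in>B. (ip b b * ip u b) *\<^sub>R b)) c = 0"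
          using addl[OF u subspace_scale[OF V sV] BV[OF c], of "-1"] scalel[OF sV BV[OF c], of "-1"] 1 by simp
        then show ?thesis by simp
      qed
      then show ?thesis unfolding W_def using subspace_diff[OF V u sV] by simp
    qed
    have W0: "ip x y = 0" if "x \<in> W" "y \<in> W" for x y
    proof -
      have xV: "x \<in> V" and yV: "y \<in> V" using that by (auto simp: W_def)
      have sV: "x + y \<in> V" using xV yV by (rule subspace_add[OF V])
      have "x + y \<in> W" using that sV addl[OF xV yV BV] by (simp add: W_def)
      then have "ip (x + y) (x + y) = 0" by (rule iso)
      then have "ip x x + ip x y + (ip y x + ip y y) = 0"
        using addl[OF xV yV sV] sym[OF xV sV] sym[OF yV sV] addl[OF xV yV xV] addl[OF xV yV yV] sym[OF xV yV] by simp
      then show ?thesis using iso that sym[OF xV yV] by simp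
    qed
    define v' where "v' = v - q"
    have v'W: "v' \<in> W" unfolding v'_def q_def by (rule proj[OF v])
    then have v'V: "v' \<in> V" by (simp add: W_def)
    have "ip v' y = 0" if y: "y \<in> V" for y
    proof -
      define s where "s = (\<Sum>b\<in>B. (ip b b * ip y b) *\<^sub>R b)"
      have sV: "s \<in> V" unfolding s_def using BV by (intro subspace_sum V subspace_scale) auto
      have w: "y - s \<in> W" unfolding s_def by (rule proj[OF y])
      then have wV: "y - s \<in> V" by (simp add: W_def)
      have "ip s v' = (\<Sum>b\<in>B. (ip b b * ip y b) *\<^sub>R ip b v')"
        unfolding s_def by (rule linear_on_sum[OF bilinear_onD(1)[OF bil v'V] V BV])
      also have "\<dots> = 0" using v'W sym[OF BV v'V] by (intro sum.neutral) (auto simp: W_def)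
      finally have "ip s v' = 0" .
      moreover have "ip (y - s) v' = 0" by (rule W0[OF w v'W])
      ultimately have "ip ((y - s) + s) v' = 0" using addl[OF wV sV v'V] by simp
      then show ?thesis using sym[OF v'V y] by simp
    qed
    then have "v' = 0" using form v'V by (auto simp: nondegenerate_form_def)
    then show "v \<in> span B" using qs by (simp add: v'_def)
  qed
  with spV have "span B = V" by blast
  with fin show ?thesis using unit orth by (rule that)
qed

text \<open>Vectors of square -1 are enumerated before the others, which is the order demanded by
  \<open>has_signature\<close>.\<close>

lemma orthonormal_frame_exists:
  assumes "fin_dim_space V" and form: "nondegenerate_form V ip"
  obtains n p e where "p \<le> n" "orthonormal_frame V ip n e (\<lambda>i. if i < p then -1 else 1)"
proof -
  obtain B where B: "finite B" "span B = V" and unit: "\<And>b. b \<in> B \<Longrightarrow> ip b b = 1 \<or> ip b b = -1"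
    and orth: "\<And>b c. b \<in> B \<Longrightarrow> c \<in> B \<Longrightarrow> b \<noteq> c \<Longrightarrow> ip b c = 0"
    using orthonormal_family_exists[OF assms] by metis
  define N where "N = {b \<in> B. ip b b = -1}"
  define Q where "Q = B - N"
  have fin: "finite N" "finite Q" using B by (auto simp: N_def Q_def)
  obtain f where f: "bij_betw f {0..<card N} N" using ex_bij_betw_nat_finite[OF fin(1)] by blast
  obtain g where g: "bij_betw g {0..<card Q} Q" using ex_bij_betw_nat_finite[OF fin(2)] by blast
  define p where "p = card N"
  define n where "n = card N + card Q"
  define e where "e = (\<lambda>i. if i < p then f i else g (i - p))"
  have eN: "e i \<in> N" if "i < p" for i using that f by (auto simp: e_def p_def bij_betw_def)
  have eQ: "e i \<in> Q" if "p \<le> i" "i < n" for i using that g by (auto simp: e_def p_def n_def bij_betw_def)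
  have img: "e ` {..<n} = B"
  proof (intro equalityI subsetI)
    fix b assume "b \<in> B"
    then consider "b \<in> N" | "b \<in> Q" by (auto simp: Q_def)
    then show "b \<in> e ` {..<n}"
    proof cases
      case 1
      then have "b \<in> f ` {0..<card N}" using f by (simp add: bij_betw_def)
      then obtain i where "i < p" "b = f i" by (auto simp: p_def)
      then show ?thesis by (auto simp: e_def n_def p_def intro!: image_eqI[of _ _ i])
    next
      case 2
      then have "b \<in> g ` {0..<card Q}" using g by (simp add: bij_betw_def)
      then obtain i where "i < card Q" "b = g i" by auto
      then show ?thesis by (auto simp: e_def n_def p_def intro!: image_eqI[of _ _ "p + i"])
    qed
  next
    fix b assume "b \<in> e ` {..<n}"
    then obtain i where i: "b = e i" "i < n" by auto
    then show "b \<in> B" using eN[of i] eQ[of i] by (cases "i < p") (auto simp: N_def Q_def)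
  qed
  have inj: "e i \<noteq> e j" if "i < n" "j < n" "i \<noteq> j" for i j
  proof -
    have "card (e ` {..<n}) = card {..<n}"
      unfolding img using card_Un_disjoint[OF fin] by (auto simp: n_def N_def Q_def Un_absorb1 intro: arg_cong[where f = card])
    then have "inj_on e {..<n}" by (rule eq_card_imp_inj_on[rotated]) simp
    then show ?thesis using that by (auto dest: inj_onD)
  qed
  show ?thesis
  proof (rule that[of p n e])
    show "p \<le> n" by (simp add: p_def n_def)
    show "orthonormal_frame V ip n e (\<lambda>i. if i < p then -1 else 1)"
    proof
      show "nondegenerate_form V ip" by (rule form)
      show "span (e ` {..<n}) = V" unfolding img by (rule B)
      fix i j assume i: "i < n" and j: "j < n"
      have eB: "e i \<in> B" "e j \<in> B" using img i j by auto
      show "ip (e i) (e j) = (if i = j then if i < p then -1 else 1 else 0)"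
      proof (cases "i = j")
        case True
        then show ?thesis using eN[of i] eQ[of i] i unit[of "e i"] by (cases "i < p") (auto simp: N_def Q_def)
      next
        case False
        then show ?thesis using orth[OF eB inj[OF i j False]] by simp
      qed
    qed auto
  qed
qed

section \<open>Conformally flat models as products with a symmetric matrix\<close>

context orthonormal_frame
begin

text \<open>The form with matrix \<open>H\<close> in the frame \<open>e\<close>: the factors
  \<open>\<epsilon> i * ip x (e i)\<close> are the coordinates of \<open>x\<close>.\<close>

definition extend_form :: "(nat \<Rightarrow> nat \<Rightarrow> real) \<Rightarrow> 'a \<Rightarrow> 'a \<Rightarrow> real" where
  "extend_form H x y = (\<Sum>i<n. \<Sum>j<n. (\<epsilon> i * ip x (e i)) * (\<epsilon> j * ip y (e j)) * H i j)"

lemma bilinear_extend_form: "bilinear_on V (extend_form H)"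
  unfolding bilinear_on_def extend_form_def
  by (intro conjI ballI linear_on_intros bilinear_onD[OF bilinear] e_in) auto

lemma extend_form_basis: "k < n \<Longrightarrow> l < n \<Longrightarrow> extend_form H (e k) (e l) = H k l"
proof -
  assume k: "k < n" and l: "l < n"
  have "extend_form H (e k) (e l) = (\<Sum>i<n. \<Sum>j<n. (if i = k then 1 else 0) * ((if j = l then 1 else 0) * H i j))"
    unfolding extend_form_def using k l by (intro sum.cong refl) (auto simp: orthonormal eps_sq)
  also have "\<dots> = (\<Sum>i<n. (if i = k then 1 else 0) * H i l)"
  proof (intro sum.cong refl)
    fix i
    show "(\<Sum>j<n. (if i = k then 1 else 0) * ((if j = l then 1 else 0) * H i j)) = (if i = k then 1 else 0) * H i l"
      unfolding sum_distrib_left[symmetric] using l by (simp add: if_distrib[of "\<lambda>c. c * _"] cong: if_cong)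
  qed
  also have "\<dots> = H k l" using k by (simp add: if_distrib[of "\<lambda>c. c * _"] cong: if_cong)
  finally show ?thesis .
qed

text \<open>In dimension at least three this is the vanishing of the Weyl tensor, with the Schouten tensor
  for \<open>H\<close>; in lower dimension every curvature tensor has this shape.\<close>

lemma conformally_flat_components:
  assumes A: "algebraic_curvature_tensor V A" and W: "conformally_flat_model V ip A"
  obtains H where "\<And>i j. H i j = H j i"
    "\<And>i j k l. i < n \<Longrightarrow> j < n \<Longrightarrow> k < n \<Longrightarrow> l < n \<Longrightarrow>
      A (e i) (e j) (e k) (e l) = kulkarni_nomizu (extend_form H) ip (e i) (e j) (e k) (e l)"
proof -
  have sy: "A (e i) (e j) (e k) (e l) = - A (e j) (e i) (e k) (e l)" "A (e i) (e j) (e k) (e l) = A (e k) (e l) (e i) (e j)"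
    if "i < n" "j < n" "k < n" "l < n" for i j k l
    using A that e_in unfolding algebraic_curvature_tensor_def by blast+
  define \<eta> where "\<eta> = (\<lambda>i j. if i = j then \<epsilon> i else 0)"
  have ip: "ip (e i) (e j) = \<eta> i j" if "i < n" "j < n" for i j using orthonormal[OF that] by (simp add: \<eta>_def)
  have eta_sym: "\<eta> i j = \<eta> j i" for i j by (simp add: \<eta>_def)
  have red: "\<exists>H. (\<forall>i j. H i j = H j i) \<and> (\<forall>i<n. \<forall>j<n. \<forall>k<n. \<forall>l<n. A (e i) (e j) (e k) (e l) = H i l * \<eta> j k - H i k * \<eta> j l + \<eta> i l * H j k - \<eta> i k * H j l)"
  proof -
    consider "n \<le> 1" | "n = 2" | "3 \<le> n" by linarith
    then show ?thesis
    proof cases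
      case 1
      have "A (e i) (e j) (e k) (e l) = 0" if "i < n" "j < n" "k < n" "l < n" for i j k l
      proof -
        have "i = j" using that 1 by simp
        then show ?thesis using sy(1)[OF that] by simp
      qed
      then show ?thesis by (intro exI[of _ "\<lambda>_ _. 0"]) auto
    next
      case 2
      define a where "a = A (e 0) (e (Suc 0)) (e (Suc 0)) (e 0)"
      \<comment> \<open>Only one component \<open>a\<close> is independent. The product of
        \<open>c\<close> times the metric with the metric has the value
        \<open>2 * c * \<epsilon> 0 * \<epsilon> 1\<close> there.\<close>
      define c where "c = a * \<epsilon> 0 * \<epsilon> (Suc 0) / 2"
      have e0: "\<epsilon> 0 * \<epsilon> 0 = 1" and e1: "\<epsilon> (Suc 0) * \<epsilon> (Suc 0) = 1" using 2 by (auto intro: eps_sq)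
      have ca: "2 * c * (\<epsilon> 0 * \<epsilon> (Suc 0)) = a"
      proof -
        have "2 * c * (\<epsilon> 0 * \<epsilon> (Suc 0)) = a * (\<epsilon> 0 * \<epsilon> 0) * (\<epsilon> (Suc 0) * \<epsilon> (Suc 0))" by (simp add: c_def)
        then show ?thesis unfolding e0 e1 by simp
      qed
      have z1: "A (e i) (e i) (e k) (e l) = 0" if "i < n" "k < n" "l < n" for i k l using sy(1)[of i i k l] that by simp
      have z2: "A (e k) (e l) (e i) (e i) = 0" if "i < n" "k < n" "l < n" for i k l using sy(2)[of k l i i] z1 that by simp
      have a1: "A (e (Suc 0)) (e 0) (e (Suc 0)) (e 0) = - a" using sy(1)[of "Suc 0" 0 "Suc 0" 0] 2 by (simp add: a_def)
      have a2: "A (e 0) (e (Suc 0)) (e 0) (e (Suc 0)) = - a" using sy(1)[of 0 "Suc 0" 0 "Suc 0"] sy(2)[of "Suc 0" 0 0 "Suc 0"] 2 by (simp add: a_def)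
      have a3: "A (e (Suc 0)) (e 0) (e 0) (e (Suc 0)) = a" using sy(2)[of "Suc 0" 0 0 "Suc 0"] 2 by (simp add: a_def)
      show ?thesis
      proof (intro exI[of _ "\<lambda>i j. c * \<eta> i j"] conjI allI impI)
        fix i j k l assume "i < n" "j < n" "k < n" "l < n"
        then have mem: "i = 0 \<or> i = Suc 0" "j = 0 \<or> j = Suc 0" "k = 0 \<or> k = Suc 0" "l = 0 \<or> l = Suc 0" using 2 by auto
        have cc: "c * \<epsilon> 0 * \<epsilon> (Suc 0) = a / 2" "c * \<epsilon> (Suc 0) * \<epsilon> 0 = a / 2"
          "\<epsilon> 0 * (c * \<epsilon> (Suc 0)) = a / 2" "\<epsilon> (Suc 0) * (c * \<epsilon> 0) = a / 2"
          using ca by (simp_all add: mult_ac)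
        from mem show "A (e i) (e j) (e k) (e l) = c * \<eta> i l * \<eta> j k - c * \<eta> i k * \<eta> j l + \<eta> i l * (c * \<eta> j k) - \<eta> i k * (c * \<eta> j l)"
          by - (elim disjE, simp_all add: \<eta>_def z1 z2 a1 a2 a3 a_def[symmetric] cc 2)
      qed (simp add: eta_sym)
    next
      case 3
      define \<rho> where "\<rho> = ricci_tensor V ip A"
      define \<tau> where "\<tau> = scalar_curvature V ip A"
      define u where "u = 1 / (real n - 2)"
      \<comment> \<open>The product of the metric with itself is twice the last bracket of the Weyl
        tensor, so half of that bracket's coefficient goes into the Schouten tensor
        \<open>S\<close>.\<close>
      define v where "v = \<tau> / ((real n - 1) * (real n - 2)) / 2"
      define S where "S = (\<lambda>i j. u * \<rho> (e i) (e j) - v * \<eta> i j)"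
      have SA: "A (e i) (e j) (e k) (e l) = S i l * \<eta> j k - S i k * \<eta> j l + \<eta> i l * S j k - \<eta> i k * S j l"
        if "i < n" "j < n" "k < n" "l < n" for i j k l
      proof -
        have "weyl_tensor V ip A (e i) (e j) (e k) (e l) = 0"
          using W that e_in by (simp add: conformally_flat_model_def)
        then have "A (e i) (e j) (e k) (e l) = u * (\<rho> (e i) (e l) * \<eta> j k - \<rho> (e i) (e k) * \<eta> j l + \<eta> i l * \<rho> (e j) (e k) - \<eta> i k * \<rho> (e j) (e l))
          - 2 * v * (\<eta> i l * \<eta> j k - \<eta> i k * \<eta> j l)"
          using 3 that by (simp add: weyl_tensor_def Let_def dim ip \<rho>_def \<tau>_def u_def v_def)
        then show ?thesis by (simp add: S_def algebra_simps)
      qed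
      show ?thesis
      \<comment> \<open>Reversing the four arguments fixes \<open>A\<close> and turns the identity
        for \<open>S\<close> into that for its transpose; the average of both has the required
        symmetry.\<close>
      proof (intro exI[of _ "\<lambda>i j. (S i j + S j i) / 2"] conjI allI impI)
        fix i j k l assume i: "i < n" "j < n" "k < n" "l < n"
        have "A (e i) (e j) (e k) (e l) = A (e l) (e k) (e j) (e i)"
          using sy(1)[of i j k l] sy(2)[of j i k l] sy(1)[of k l j i] i by simp
        then show "A (e i) (e j) (e k) (e l) = (S i l + S l i) / 2 * \<eta> j k - (S i k + S k i) / 2 * \<eta> j l +
          \<eta> i l * ((S j k + S k j) / 2) - \<eta> i k * ((S j l + S l j) / 2)"
          using SA[OF i] SA[OF i(4,3,2,1)] eta_sym by (simp add: field_simps)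
      qed (simp add: add.commute)
    qed
  qed
  then obtain H where H: "\<forall>i j. H i j = H j i" "\<forall>i<n. \<forall>j<n. \<forall>k<n. \<forall>l<n. A (e i) (e j) (e k) (e l) = H i l * \<eta> j k - H i k * \<eta> j l + \<eta> i l * H j k - \<eta> i k * H j l" by blast
  show ?thesis
  proof (rule that[of H])
    show "H i j = H j i" for i j using H(1) by blast
    show "A (e i) (e j) (e k) (e l) = kulkarni_nomizu (extend_form H) ip (e i) (e j) (e k) (e l)"
      if "i < n" "j < n" "k < n" "l < n" for i j k l
      using H(2) that by (simp add: kulkarni_nomizu_def extend_form_basis ip)
  qed
qed

end

section \<open>Conformally flat metrics on a cube\<close>

definition sig :: "nat \<Rightarrow> nat \<Rightarrow> real" where
  "sig p i = (if i < p then -1 else 1)"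

definition scalar_prod :: "nat \<Rightarrow> nat \<Rightarrow> coords \<Rightarrow> coords \<Rightarrow> real" where
  "scalar_prod n p v w = (\<Sum>i<n. sig p i * (v i * w i))"

definition unit_vec :: "nat \<Rightarrow> coords" where
  "unit_vec i = (\<lambda>k. if k = i then 1 else 0)"

definition cube_chart :: "nat \<Rightarrow> real \<Rightarrow> coords chart" where
  "cube_chart n \<rho> = (cube n \<rho>, id)"

definition cube_atlas :: "nat \<Rightarrow> real \<Rightarrow> coords chart set" where
  "cube_atlas n \<rho> = {cube_chart n \<rho>}"

definition tvec :: "nat \<Rightarrow> real \<Rightarrow> coords \<Rightarrow> coords tangent" where
  "tvec n \<rho> v = (\<lambda>d. if d = cube_chart n \<rho> then v else 0)"

definition conf_metric :: "nat \<Rightarrow> nat \<Rightarrow> real \<Rightarrow> (coords \<Rightarrow> real) \<Rightarrow> coords metric_field" where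
  "conf_metric n p \<rho> F P v w = scalar_prod n p (v (cube_chart n \<rho>)) (w (cube_chart n \<rho>)) / (F P)\<^sup>2"

section \<open>The cube as a manifold with a single chart\<close>

lemma sig_sq: "sig p i * sig p i = 1" "sig p i * (sig p i * a) = a" "\<bar>sig p i\<bar> = 1"
  by (auto simp: sig_def)

lemma cube_chart_simps [simp]: "fst (cube_chart n \<rho>) = cube n \<rho>" "snd (cube_chart n \<rho>) = id"
  by (simp_all add: cube_chart_def)

lemma tvec_apply [simp]: "tvec n \<rho> v (cube_chart n \<rho>) = v"
  by (simp add: tvec_def)

lemma inv_into_id: "x \<in> U \<Longrightarrow> inv_into U id x = x"
  using inv_into_f_f[of id U x] by simp

lemma transition_cube: "x \<in> cube n \<rho> \<Longrightarrow> transition (cube_chart n \<rho>) (cube_chart n \<rho>) x k = x k"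
  by (simp add: transition_def inv_into_id)

lemma partial_deriv_transition:
  assumes "P \<in> cube n \<rho>" "i < n"
  shows "partial_deriv i (\<lambda>x. transition (cube_chart n \<rho>) (cube_chart n \<rho>) x k) P = (if i = k then 1 else 0)"
proof -
  have "partial_deriv i (\<lambda>x. transition (cube_chart n \<rho>) (cube_chart n \<rho>) x k) P = partial_deriv i (\<lambda>x. x k) P"
    by (rule partial_deriv_cong[OF assms]) (rule transition_cube)
  also have "\<dots> = (if i = k then 1 else 0)" by (simp add: partial_deriv_def)
  finally show ?thesis .
qed

lemma tangent_space_cube:
  assumes P: "P \<in> cube n \<rho>"
  shows "tangent_space n (cube_atlas n \<rho>) P = tvec n \<rho> ` {v. \<forall>k\<ge>n. v k = 0}"
proof (intro equalityI subsetI)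
  fix v assume v: "v \<in> tangent_space n (cube_atlas n \<rho>) P"
  have "v d = tvec n \<rho> (v (cube_chart n \<rho>)) d" for d
    using v P by (cases d) (auto simp: tangent_space_def cube_atlas_def tvec_def)
  then have "v = tvec n \<rho> (v (cube_chart n \<rho>))" by (rule ext)
  moreover have "v (cube_chart n \<rho>) \<in> {v. \<forall>k\<ge>n. v k = 0}" using v by (simp add: tangent_space_def cube_atlas_def)
  ultimately show "v \<in> tvec n \<rho> ` {v. \<forall>k\<ge>n. v k = 0}" by (rule image_eqI)
next
  fix v assume "v \<in> tvec n \<rho> ` {v. \<forall>k\<ge>n. v k = 0}"
  then obtain u where u: "v = tvec n \<rho> u" "\<forall>k\<ge>n. u k = 0" by blast
  have "(\<Sum>i<n. partial_deriv i (\<lambda>x. transition (cube_chart n \<rho>) (cube_chart n \<rho>) x k) P * u i) = u k" if "k < n" for k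
  proof -
    have "(\<Sum>i<n. partial_deriv i (\<lambda>x. transition (cube_chart n \<rho>) (cube_chart n \<rho>) x k) P * u i) = (\<Sum>i<n. if i = k then u k else 0)"
      by (intro sum.cong refl) (simp add: partial_deriv_transition[OF P])
    then show ?thesis using that by simp
  qed
  then show "v \<in> tangent_space n (cube_atlas n \<rho>) P"
    using u P by (auto simp: tangent_space_def cube_atlas_def tvec_def)
qed

lemma coord_vector_cube:
  assumes "P \<in> cube n \<rho>" "i < n"
  shows "coord_vector n (cube_atlas n \<rho>) (cube_chart n \<rho>) i P = tvec n \<rho> (unit_vec i)"
proof (intro ext)
  fix d k
  show "coord_vector n (cube_atlas n \<rho>) (cube_chart n \<rho>) i P d k = tvec n \<rho> (unit_vec i) d k"
    using assms by (auto simp: coord_vector_def cube_atlas_def tvec_def unit_vec_def partial_deriv_transition)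
qed

lemma tvec_add: "tvec n \<rho> (v + w) = tvec n \<rho> v + tvec n \<rho> w"
  by (auto simp: tvec_def fun_eq_iff)

lemma scaleR_fun_apply: "(c *\<^sub>R f) x = c *\<^sub>R f x"
  by (simp add: scaleR_fun_def)

lemma tvec_scale: "tvec n \<rho> (c *\<^sub>R v) = c *\<^sub>R tvec n \<rho> v"
  by (auto simp: tvec_def fun_eq_iff scaleR_fun_def)

lemma tvec_zero: "tvec n \<rho> 0 = 0"
  by (auto simp: tvec_def fun_eq_iff)

lemma tvec_sum: "tvec n \<rho> (\<Sum>i\<in>I. c i *\<^sub>R v i) = (\<Sum>i\<in>I. c i *\<^sub>R tvec n \<rho> (v i))"
  by (induction I rule: infinite_finite_induct)
     (simp_all only: sum.infinite sum.empty sum.insert tvec_zero tvec_add tvec_scale not_False_eq_True)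

lemma sum_fun_apply: "(\<Sum>i\<in>I. f i) x = (\<Sum>i\<in>I. f i x)"
  by (induction I rule: infinite_finite_induct) auto

lemma unit_vec_comb:
  assumes "\<forall>k\<ge>n. v k = 0"
  shows "v = (\<Sum>i<n. v i *\<^sub>R unit_vec i)"
proof
  fix k
  have "(\<Sum>i<n. v i *\<^sub>R unit_vec i) k = (\<Sum>i<n. if i = k then v k else 0)"
    unfolding sum_fun_apply by (intro sum.cong) (auto simp: scaleR_fun_def unit_vec_def)
  then show "v k = (\<Sum>i<n. v i *\<^sub>R unit_vec i) k" using assms by simp
qed

lemma openin_cube: "openin (Euclidean_space n) (cube n \<rho>)"
proof -
  have "openin (subtopology euclidean (topspace (Euclidean_space n))) (polybox n \<rho> \<inter> topspace (Euclidean_space n))"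
    by (rule openin_subtopology_Int) (simp add: open_polybox)
  then show ?thesis
    using subtopology_Euclidean_space[of "topspace (Euclidean_space n)" n] by (simp add: cube_def subtopology_topspace)
qed

lemma analytic_manifold_cube:
  assumes "0 < \<rho>"
  shows "analytic_manifold n (subtopology (Euclidean_space n) (cube n \<rho>)) (cube_atlas n \<rho>)"
proof -
  let ?X = "subtopology (Euclidean_space n) (cube n \<rho>)"
  have sub: "cube n \<rho> \<subseteq> topspace (Euclidean_space n)" by (simp add: cube_def)
  have top: "topspace ?X = cube n \<rho>" using sub by auto
  have "second_countable (euclidean :: coords topology)"
  proof -
    obtain B :: "coords set set" where B: "countable B" "topological_basis B" using ex_countable_basis by blast
    show ?thesis unfolding second_countable_def
    proof (intro exI[of _ B] conjI ballI allI impI)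
      show "countable B" by (rule B)
      show "openin euclidean V" if "V \<in> B" for V using topological_basis_open[OF B(2) that] by simp
      show "\<exists>V\<in>B. x \<in> V \<and> V \<subseteq> U" if "openin euclidean U \<and> x \<in> U" for U x
        using topological_basisE[OF B(2), of U x] that unfolding open_openin[symmetric] by blast
    qed
  qed
  then have sc: "second_countable ?X"
    unfolding subtopology_Euclidean_space[OF sub] by (rule second_countable_subtopology)
  have "real_analytic_on n (cube n \<rho>) (\<lambda>x. transition (cube_chart n \<rho>) (cube_chart n \<rho>) x k)" if "k < n" for k
    by (rule has_pseries_real_analytic[OF has_pseries_coord[OF that] assms]) (rule transition_cube)
  then show ?thesis
    unfolding analytic_manifold_def cube_atlas_def
    using sc openin_cube[of n \<rho>] top
    by (auto simp: Hausdorff_space_subtopology Hausdorff_Euclidean_space subtopology_subtopology cube_chart_def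
        openin_subtopology_self openin_open_subtopology homeomorphic_map_id)
qed

section \<open>Connection and curvature of the metric \<open>F^-2\<close> times the flat one\<close>

locale conformal_cube =
  fixes n p :: nat and \<rho> :: real and F :: "coords \<Rightarrow> real"
    and F1 :: "nat \<Rightarrow> coords \<Rightarrow> real" and F2 :: "nat \<Rightarrow> nat \<Rightarrow> coords \<Rightarrow> real"
  assumes rho: "0 < \<rho>" and p_le: "p \<le> n"
    and nz: "\<And>x. x \<in> cube n \<rho> \<Longrightarrow> F x \<noteq> 0"
    and F1: "\<And>x i. x \<in> cube n \<rho> \<Longrightarrow> i < n \<Longrightarrow> ((\<lambda>t. F (x(i := t))) has_real_derivative F1 i x) (at (x i))"
    and F2: "\<And>x i j. x \<in> cube n \<rho> \<Longrightarrow> i < n \<Longrightarrow> j < n \<Longrightarrow> ((\<lambda>t. F1 j (x(i := t))) has_real_derivative F2 i j x) (at (x i))"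
    and F2_sym: "\<And>x i j. x \<in> cube n \<rho> \<Longrightarrow> i < n \<Longrightarrow> j < n \<Longrightarrow> F2 i j x = F2 j i x"
begin

abbreviation "atlas \<equiv> cube_atlas n \<rho>"
abbreviation "chart \<equiv> cube_chart n \<rho>"
abbreviation "g \<equiv> conf_metric n p \<rho> F"
abbreviation "G \<equiv> metric_coeff n atlas g chart"
abbreviation "sp \<equiv> scalar_prod n p"
abbreviation "\<epsilon> \<equiv> sig p"
abbreviation "tv \<equiv> tvec n \<rho>"
abbreviation "T \<equiv> tangent_space n atlas"

definition dF :: "coords \<Rightarrow> coords \<Rightarrow> real" where
  "dF x v = (\<Sum>i<n. v i * F1 i x)"

definition hess :: "coords \<Rightarrow> coords \<Rightarrow> coords \<Rightarrow> real" where
  "hess x v w = (\<Sum>i<n. \<Sum>j<n. v i * w j * F2 i j x)"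

definition grad_sq :: "coords \<Rightarrow> real" where
  "grad_sq x = (\<Sum>i<n. \<epsilon> i * (F1 i x)\<^sup>2)"

lemma scalar_prod_unit: "i < n \<Longrightarrow> j < n \<Longrightarrow> sp (unit_vec i) (unit_vec j) = (if i = j then \<epsilon> i else 0)"
proof -
  assume i: "i < n" and j: "j < n"
  have "sp (unit_vec i) (unit_vec j) = (\<Sum>k<n. if k = i then if i = j then \<epsilon> i else 0 else 0)"
    unfolding scalar_prod_def by (intro sum.cong) (auto simp: unit_vec_def)
  also have "\<dots> = (if i = j then \<epsilon> i else 0)" using i by simp
  finally show ?thesis .
qed

lemma hess_unit_right:
  assumes "k < n"
  shows "hess x v (unit_vec k) = (\<Sum>i<n. v i * F2 i k x)"
  unfolding hess_def
proof (intro sum.cong refl)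
  fix i
  have "(\<Sum>j<n. v i * unit_vec k j * F2 i j x) = (\<Sum>j<n. if j = k then v i * F2 i k x else 0)"
    by (intro sum.cong) (auto simp: unit_vec_def)
  then show "(\<Sum>j<n. v i * unit_vec k j * F2 i j x) = v i * F2 i k x" using assms by simp
qed

lemma metric_coeff: "x \<in> cube n \<rho> \<Longrightarrow> i < n \<Longrightarrow> j < n \<Longrightarrow> G i j x = (if i = j then \<epsilon> i else 0) / (F x)\<^sup>2"
  by (simp add: metric_coeff_def inv_into_id coord_vector_cube conf_metric_def scalar_prod_unit)

lemma partial_deriv_metric_coeff:
  assumes x: "x \<in> cube n \<rho>" and "i < n" "j < n" and k: "k < n"
  shows "partial_deriv k (G i j) x = (if i = j then \<epsilon> i else 0) * (- 2 * F1 k x / F x ^ 3)"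
proof -
  let ?s = "if i = j then \<epsilon> i else 0"
  have "partial_deriv k (G i j) x = partial_deriv k (\<lambda>x. ?s / (F x)\<^sup>2) x"
    by (rule partial_deriv_cong[OF x k]) (rule metric_coeff[OF _ assms(2,3)])
  also have "\<dots> = ?s * (- 2 * F1 k x / F x ^ 3)"
    unfolding partial_deriv_def
  proof (rule DERIV_imp_deriv)
    show "((\<lambda>t. ?s / (F (x(k := t)))\<^sup>2) has_real_derivative ?s * (- 2 * F1 k x / F x ^ 3)) (at (x k))"
      by (rule derivative_eq_intros F1[OF x k] refl)+ (use nz[OF x] in \<open>auto simp: field_simps power2_eq_square power3_eq_cube\<close>)
  qed
  finally show ?thesis .
qed

text \<open>The inverse matrix is known only through its defining property, which for a diagonal
  matrix determines every entry.\<close>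

lemma inv_metric_coeff:
  assumes x: "x \<in> cube n \<rho>" and k: "k < n" and l: "l < n"
  shows "inv_matrix n (\<lambda>a b. G a b x) k l = (if k = l then \<epsilon> k * (F x)\<^sup>2 else 0)"
proof -
  define b where "b = inv_matrix n (\<lambda>a b. G a b x)"
  have diag: "(\<Sum>k<n. G i k x * b k j) = \<epsilon> i / (F x)\<^sup>2 * b i j" if "i < n" for i j and b :: "nat \<Rightarrow> nat \<Rightarrow> real"
  proof -
    have "(\<Sum>k<n. G i k x * b k j) = (\<Sum>k<n. if k = i then \<epsilon> i / (F x)\<^sup>2 * b i j else 0)"
      using that by (intro sum.cong) (auto simp: metric_coeff[OF x])
    then show ?thesis using that by simp
  qed
  have "\<exists>b. \<forall>i<n. \<forall>j<n. (\<Sum>k<n. G i k x * b k j) = (if i = j then 1 else 0)"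
  proof (intro exI[of _ "\<lambda>k l. if k = l then \<epsilon> k * (F x)\<^sup>2 else 0"] allI impI)
    fix i j assume "i < n"
    then show "(\<Sum>k<n. G i k x * (if k = j then \<epsilon> k * (F x)\<^sup>2 else 0)) = (if i = j then 1 else 0)"
      using diag[of i "\<lambda>k l. if k = l then \<epsilon> k * (F x)\<^sup>2 else 0" j] nz[OF x] by (simp add: sig_sq)
  qed
  then have "\<forall>i<n. \<forall>j<n. (\<Sum>k<n. G i k x * b k j) = (if i = j then 1 else 0)"
    unfolding b_def inv_matrix_def by (rule someI_ex)
  then have "\<epsilon> k / (F x)\<^sup>2 * b k l = (if k = l then 1 else 0)" using k l by (simp add: diag)
  then have "\<epsilon> k * (F x)\<^sup>2 * (\<epsilon> k / (F x)\<^sup>2 * b k l) = (if k = l then \<epsilon> k * (F x)\<^sup>2 else 0)" by simp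
  then show ?thesis using nz[OF x] by (simp add: b_def[symmetric] sig_sq)
qed

lemma christoffel:
  assumes x: "x \<in> cube n \<rho>" and i: "i < n" and j: "j < n" and k: "k < n"
  shows "christoffel n G i j k x = - ((if j = k then F1 i x else 0) + (if i = k then F1 j x else 0)
    - (if i = j then \<epsilon> k * \<epsilon> i * F1 k x else 0)) / F x"
proof -
  have "christoffel n G i j k x = (\<Sum>l<n. if l = k then 1 / 2 * (\<epsilon> k * (F x)\<^sup>2) *
     (partial_deriv i (G j k) x + partial_deriv j (G i k) x - partial_deriv k (G i j) x) else 0)"
    unfolding christoffel_def using k by (intro sum.cong) (auto simp: inv_metric_coeff[OF x k])
  also have "\<dots> = 1 / 2 * (\<epsilon> k * (F x)\<^sup>2) *
     (partial_deriv i (G j k) x + partial_deriv j (G i k) x - partial_deriv k (G i j) x)" using k by simp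
  also have "\<dots> = - ((if j = k then F1 i x else 0) + (if i = k then F1 j x else 0)
    - (if i = j then \<epsilon> k * \<epsilon> i * F1 k x else 0)) / F x"
    using nz[OF x] i j k
    by (simp add: partial_deriv_metric_coeff[OF x] field_simps power2_eq_square power3_eq_cube sig_sq)
  finally show ?thesis .
qed

lemma christoffel_sum:
  assumes x: "x \<in> cube n \<rho>" and k: "k < n"
  shows "(\<Sum>i<n. v i * (\<Sum>j<n. christoffel n G i j k x * w j)) =
    - (dF x v * w k + dF x w * v k - sp v w * (\<epsilon> k * F1 k x)) / F x"
proof -
  have 1: "(\<Sum>j<n. christoffel n G i j k x * w j) = - (F1 i x * w k + (if i = k then dF x w else 0) - \<epsilon> k * F1 k x * (\<epsilon> i * w i)) / F x"
    if i: "i < n" for i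
  proof -
    have "(\<Sum>j<n. christoffel n G i j k x * w j) = (\<Sum>j<n. - ((if j = k then F1 i x * w k else 0) + (if i = k then 1 else 0) * (w j * F1 j x) - (if j = i then \<epsilon> k * F1 k x * (\<epsilon> i * w i) else 0)) / F x)"
      using i k by (intro sum.cong refl) (auto simp: christoffel[OF x] algebra_simps)
    also have "\<dots> = - ((\<Sum>j<n. if j = k then F1 i x * w k else 0) + (if i = k then 1 else 0) * dF x w - (\<Sum>j<n. if j = i then \<epsilon> k * F1 k x * (\<epsilon> i * w i) else 0)) / F x"
      unfolding sum_divide_distrib[symmetric] sum_negf sum_subtractf sum.distrib dF_def sum_distrib_left[symmetric] ..
    also have "\<dots> = - (F1 i x * w k + (if i = k then dF x w else 0) - \<epsilon> k * F1 k x * (\<epsilon> i * w i)) / F x"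
      using i k by simp
    finally show ?thesis .
  qed
  have "(\<Sum>i<n. v i * (\<Sum>j<n. christoffel n G i j k x * w j)) =
     (\<Sum>i<n. - (v i * F1 i x * w k + (if i = k then dF x w * v k else 0) - \<epsilon> k * F1 k x * (\<epsilon> i * (v i * w i))) / F x)"
  proof (intro sum.cong refl)
    fix i assume "i \<in> {..<n}"
    then have i: "i < n" by simp
    show "v i * (\<Sum>j<n. christoffel n G i j k x * w j) =
       - (v i * F1 i x * w k + (if i = k then dF x w * v k else 0) - \<epsilon> k * F1 k x * (\<epsilon> i * (v i * w i))) / F x"
      unfolding 1[OF i] by (auto simp: algebra_simps)
  qed
  also have "\<dots> = - (dF x v * w k + (\<Sum>i<n. if i = k then dF x w * v k else 0) - \<epsilon> k * F1 k x * sp v w) / F x"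
    unfolding sum_divide_distrib[symmetric] sum_negf sum_subtractf sum.distrib dF_def scalar_prod_def sum_distrib_left[symmetric] sum_distrib_right[symmetric] ..
  finally show ?thesis using k by (simp add: mult_ac)
qed

lemma levi_civita_const:
  assumes x: "x \<in> cube n \<rho>" and k: "k < n"
  shows "levi_civita n G (\<lambda>_. v) (\<lambda>_. w) x k = - (dF x v * w k + dF x w * v k - sp v w * (\<epsilon> k * F1 k x)) / F x"
proof -
  have "levi_civita n G (\<lambda>_. v) (\<lambda>_. w) x k = (\<Sum>i<n. v i * (\<Sum>j<n. christoffel n G i j k x * w j))"
    by (simp add: levi_civita_def partial_deriv_def)
  then show ?thesis using christoffel_sum[OF x k] by simp
qed

lemma dF_deriv: "x \<in> cube n \<rho> \<Longrightarrow> i < n \<Longrightarrow> ((\<lambda>t. dF (x(i := t)) v) has_real_derivative (\<Sum>j<n. v j * F2 i j x)) (at (x i))"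
  unfolding dF_def by (intro DERIV_sum DERIV_cmult F2) auto

lemma partial_deriv_levi_civita:
  assumes x: "x \<in> cube n \<rho>" and i: "i < n" and k: "k < n"
  shows "partial_deriv i (\<lambda>u. levi_civita n G (\<lambda>_. v) (\<lambda>_. w) u k) x =
    - ((\<Sum>j<n. v j * F2 i j x) * w k + (\<Sum>j<n. w j * F2 i j x) * v k - sp v w * (\<epsilon> k * F2 i k x)) / F x
    + (dF x v * w k + dF x w * v k - sp v w * (\<epsilon> k * F1 k x)) / (F x)\<^sup>2 * F1 i x"
proof -
  have "partial_deriv i (\<lambda>u. levi_civita n G (\<lambda>_. v) (\<lambda>_. w) u k) x =
     partial_deriv i (\<lambda>x. - (dF x v * w k + dF x w * v k - sp v w * (\<epsilon> k * F1 k x)) / F x) x"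
    by (rule partial_deriv_cong[OF x i]) (rule levi_civita_const[OF _ k])
  also have "\<dots> = - ((\<Sum>j<n. v j * F2 i j x) * w k + (\<Sum>j<n. w j * F2 i j x) * v k - sp v w * (\<epsilon> k * F2 i k x)) / F x
    + (dF x v * w k + dF x w * v k - sp v w * (\<epsilon> k * F1 k x)) / (F x)\<^sup>2 * F1 i x"
    unfolding partial_deriv_def
    by (rule DERIV_imp_deriv, (rule derivative_eq_intros F1[OF x i] F2[OF x i k] dF_deriv[OF x i] refl)+)
       (use nz[OF x] in \<open>auto simp: field_simps power2_eq_square\<close>)
  finally show ?thesis .
qed

text \<open>The first line differentiates the numerator of the inner derivative, the second its
  denominator \<open>F\<close>. The rest are the Christoffel terms; there \<open>dW\<close> and
  \<open>sW\<close> evaluate \<open>dF\<close> and the flat product on the inner derivative.\<close>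

lemma levi_civita_levi_civita:
  assumes x: "x \<in> cube n \<rho>" and k: "k < n"
  shows "levi_civita n G (\<lambda>_. u) (levi_civita n G (\<lambda>_. v) (\<lambda>_. w)) x k =
    - (hess x u v * w k + hess x u w * v k - sp v w * (\<epsilon> k * hess x u (unit_vec k))) / F x
    + (dF x v * w k + dF x w * v k - sp v w * (\<epsilon> k * F1 k x)) / (F x)\<^sup>2 * dF x u
    + (dF x u * (dF x v * w k + dF x w * v k - sp v w * (\<epsilon> k * F1 k x))
       + (2 * dF x v * dF x w - sp v w * grad_sq x) * u k
       - (dF x v * sp u w + dF x w * sp u v - sp v w * dF x u) * (\<epsilon> k * F1 k x)) / (F x)\<^sup>2"
proof -
  define W where "W = levi_civita n G (\<lambda>_. v) (\<lambda>_. w) x"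
  have W: "W j = - (dF x v * w j + dF x w * v j - sp v w * (\<epsilon> j * F1 j x)) / F x" if "j < n" for j
    unfolding W_def by (rule levi_civita_const[OF x that])
  have dW: "dF x W = - (2 * dF x v * dF x w - sp v w * grad_sq x) / F x"
  proof -
    have "dF x W = (\<Sum>j<n. - (dF x v * (w j * F1 j x) + dF x w * (v j * F1 j x) - sp v w * (\<epsilon> j * (F1 j x)\<^sup>2)) / F x)"
      unfolding dF_def[of _ W] by (intro sum.cong refl) (simp add: W algebra_simps power2_eq_square)
    also have "\<dots> = - (dF x v * dF x w + dF x w * dF x v - sp v w * grad_sq x) / F x"
      unfolding sum_divide_distrib[symmetric] sum_negf sum_subtractf sum.distrib sum_distrib_left[symmetric] 
      by (simp add: dF_def grad_sq_def)
    finally show ?thesis by simp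
  qed
  have sW: "sp u W = - (dF x v * sp u w + dF x w * sp u v - sp v w * dF x u) / F x"
  proof -
    have "sp u W = (\<Sum>j<n. - (dF x v * (\<epsilon> j * (u j * w j)) + dF x w * (\<epsilon> j * (u j * v j)) - sp v w * (u j * F1 j x)) / F x)"
      unfolding scalar_prod_def[of _ _ _ W]
    proof (intro sum.cong refl)
      fix j assume "j \<in> {..<n}"
      then show "\<epsilon> j * (u j * W j) = - (dF x v * (\<epsilon> j * (u j * w j)) + dF x w * (\<epsilon> j * (u j * v j)) - sp v w * (u j * F1 j x)) / F x"
        by (simp add: W sig_def algebra_simps)
    qed
    also have "\<dots> = - (dF x v * sp u w + dF x w * sp u v - sp v w * dF x u) / F x"
      unfolding sum_divide_distrib[symmetric] sum_negf sum_subtractf sum.distrib sum_distrib_left[symmetric] 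
      by (simp add: dF_def scalar_prod_def)
    finally show ?thesis .
  qed
  have 1: "(\<Sum>i<n. u i * partial_deriv i (\<lambda>y. levi_civita n G (\<lambda>_. v) (\<lambda>_. w) y k) x) =
    - (hess x u v * w k + hess x u w * v k - sp v w * (\<epsilon> k * hess x u (unit_vec k))) / F x
    + (dF x v * w k + dF x w * v k - sp v w * (\<epsilon> k * F1 k x)) / (F x)\<^sup>2 * dF x u"
  proof -
    note hu = hess_unit_right[OF k, symmetric]
    have hv: "(\<Sum>i<n. u i * (\<Sum>j<n. z j * F2 i j x)) = hess x u z" for z
      by (simp add: hess_def sum_distrib_left mult_ac)
    define N where "N = (dF x v * w k + dF x w * v k - sp v w * (\<epsilon> k * F1 k x)) / (F x)\<^sup>2"
    have "(\<Sum>i<n. u i * partial_deriv i (\<lambda>y. levi_civita n G (\<lambda>_. v) (\<lambda>_. w) y k) x) =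
      (\<Sum>i<n. - ((u i * (\<Sum>j<n. v j * F2 i j x)) * w k + (u i * (\<Sum>j<n. w j * F2 i j x)) * v k - sp v w * (\<epsilon> k * (u i * F2 i k x))) / F x + N * (u i * F1 i x))"
    proof (intro sum.cong refl)
      fix i assume "i \<in> {..<n}"
      then have i: "i < n" by simp
      show "u i * partial_deriv i (\<lambda>y. levi_civita n G (\<lambda>_. v) (\<lambda>_. w) y k) x =
        - ((u i * (\<Sum>j<n. v j * F2 i j x)) * w k + (u i * (\<Sum>j<n. w j * F2 i j x)) * v k - sp v w * (\<epsilon> k * (u i * F2 i k x))) / F x + N * (u i * F1 i x)"
        unfolding partial_deriv_levi_civita[OF x i k, of v w, folded N_def] by (simp add: algebra_simps)
    qed
    also have "\<dots> = - (hess x u v * w k + hess x u w * v k - sp v w * (\<epsilon> k * hess x u (unit_vec k))) / F x + N * dF x u"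
      unfolding sum.distrib sum_divide_distrib[symmetric] sum_negf sum_subtractf sum_distrib_left[symmetric] sum_distrib_right[symmetric] hu hv dF_def ..
    finally show ?thesis by (simp add: N_def)
  qed
  have "levi_civita n G (\<lambda>_. u) (levi_civita n G (\<lambda>_. v) (\<lambda>_. w)) x k =
    (\<Sum>i<n. u i * partial_deriv i (\<lambda>y. levi_civita n G (\<lambda>_. v) (\<lambda>_. w) y k) x) +
    (\<Sum>i<n. u i * (\<Sum>j<n. christoffel n G i j k x * W j))"
    unfolding levi_civita_def[of n G "\<lambda>_. u"] W_def by (simp add: distrib_left sum.distrib)
  also have "(\<Sum>i<n. u i * (\<Sum>j<n. christoffel n G i j k x * W j)) = (dF x u * (dF x v * w k + dF x w * v k - sp v w * (\<epsilon> k * F1 k x))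
       + (2 * dF x v * dF x w - sp v w * grad_sq x) * u k
       - (dF x v * sp u w + dF x w * sp u v - sp v w * dF x u) * (\<epsilon> k * F1 k x)) / (F x)\<^sup>2"
    unfolding christoffel_sum[OF x k] dW sW W[OF k] using nz[OF x] by (simp add: field_simps power2_eq_square)
  finally show ?thesis unfolding 1 by simp
qed

lemma scalar_prod_commute: "sp v w = sp w v"
  by (simp add: scalar_prod_def mult_ac)

lemma hess_commute: "x \<in> cube n \<rho> \<Longrightarrow> hess x v w = hess x w v"
  unfolding hess_def by (subst sum.swap) (intro sum.cong refl, simp add: F2_sym)

text \<open>Constant fields have zero bracket, and antisymmetrising in \<open>u\<close> and
  \<open>v\<close> cancels all products of first derivatives of \<open>F\<close> except those
  combined in \<open>grad_sq\<close>. This is the gain from the ansatz \<open>F^-2\<close>.\<close>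

lemma curvature_operator:
  assumes x: "x \<in> cube n \<rho>" and k: "k < n"
  shows "curvature_operator n G (\<lambda>_. u) (\<lambda>_. v) (\<lambda>_. w) x k =
    (F x * (hess x v w * u k - hess x u w * v k + sp v w * (\<epsilon> k * hess x u (unit_vec k)) - sp u w * (\<epsilon> k * hess x v (unit_vec k)))
     - grad_sq x * (sp v w * u k - sp u w * v k)) / (F x)\<^sup>2"
proof -
  have "lie_bracket n (\<lambda>_. u) (\<lambda>_. v) = (\<lambda>_ _. 0)" by (auto simp: lie_bracket_def partial_deriv_def fun_eq_iff)
  then have "levi_civita n G (lie_bracket n (\<lambda>_. u) (\<lambda>_. v)) (\<lambda>_. w) x k = 0" by (simp add: levi_civita_def)
  then have "curvature_operator n G (\<lambda>_. u) (\<lambda>_. v) (\<lambda>_. w) x k =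
     levi_civita n G (\<lambda>_. u) (levi_civita n G (\<lambda>_. v) (\<lambda>_. w)) x k - levi_civita n G (\<lambda>_. v) (levi_civita n G (\<lambda>_. u) (\<lambda>_. w)) x k"
    by (simp add: curvature_operator_def)
  moreover have combine: "- a / f + b / f\<^sup>2 * s + c / f\<^sup>2 - (- a' / f + b' / f\<^sup>2 * s' + c' / f\<^sup>2) =
     (f * (a' - a) + (b * s + c - b' * s' - c')) / f\<^sup>2" if "f \<noteq> 0" for a b c s a' b' c' s' f :: real
    using that by (simp add: field_simps power2_eq_square)
  ultimately show ?thesis
    unfolding levi_civita_levi_civita[OF x k] scalar_prod_commute[of v u] hess_commute[OF x, of v u]
      combine[OF nz[OF x]]
    by (simp add: algebra_simps)
qed


section \<open>Schouten tensor, orthonormal frame and scalar curvature of the metric\<close>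

lemma in_T: "P \<in> cube n \<rho> \<Longrightarrow> \<forall>k\<ge>n. v k = 0 \<Longrightarrow> tv v \<in> T P"
  by (simp add: tangent_space_cube)

lemma T_cases:
  assumes "P \<in> cube n \<rho>" "x \<in> T P"
  obtains v where "x = tv v" "\<forall>k\<ge>n. v k = 0"
  using assms by (auto simp: tangent_space_cube)

lemma metric_tvec: "g P (tv v) (tv w) = sp v w / (F P)\<^sup>2"
  by (simp add: conf_metric_def)

definition schouten :: "coords \<Rightarrow> coords tangent \<Rightarrow> coords tangent \<Rightarrow> real" where
  "schouten P x y = hess P (x chart) (y chart) / F P
     - grad_sq P / (2 * (F P)\<^sup>2) * sp (x chart) (y chart)"

lemma curvature_tensor_tvec:
  assumes P: "P \<in> cube n \<rho>"
  shows "curvature_tensor n atlas g P (tv x) (tv y) (tv z) (tv w) =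
    kulkarni_nomizu (schouten P) (g P) (tv x) (tv y) (tv z) (tv w)"
proof -
  define r where "r = curvature_operator n G (\<lambda>_. x) (\<lambda>_. y) (\<lambda>_. z) P"
  have some_chart: "(SOME c. c \<in> atlas \<and> P \<in> fst c) = chart"
    by (rule some_equality) (auto simp: cube_atlas_def P)
  have "(\<Sum>k<n. r k *\<^sub>R coord_vector n atlas chart k P) = (\<Sum>k<n. r k *\<^sub>R tv (unit_vec k))"
    using P by (intro sum.cong) (auto simp: coord_vector_cube)
  also have "\<dots> = tv (\<Sum>k<n. r k *\<^sub>R unit_vec k)" by (rule tvec_sum[symmetric])
  finally have "curvature_tensor n atlas g P (tv x) (tv y) (tv z) (tv w) =
     sp (\<Sum>k<n. r k *\<^sub>R unit_vec k) w / (F P)\<^sup>2"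
    unfolding curvature_tensor_def Let_def some_chart tvec_apply cube_chart_simps id_apply r_def[symmetric] by (simp only: metric_tvec)
  also have "sp (\<Sum>k<n. r k *\<^sub>R unit_vec k) w = (\<Sum>k<n. \<epsilon> k * (r k * w k))"
  proof -
    have "(\<Sum>i<n. r i *\<^sub>R unit_vec i) k = r k" if "k < n" for k
    proof -
      have "(\<Sum>i<n. r i *\<^sub>R unit_vec i) k = (\<Sum>i<n. if i = k then r k else 0)"
        unfolding sum_fun_apply by (intro sum.cong) (auto simp: scaleR_fun_def unit_vec_def)
      then show ?thesis using that by simp
    qed
    then show ?thesis by (simp add: scalar_prod_def)
  qed
  also have "\<dots> = (F P * (hess P y z * sp x w - hess P x z * sp y w + sp y z * hess P x w - sp x z * hess P y w)
     - grad_sq P * (sp y z * sp x w - sp x z * sp y w)) / (F P)\<^sup>2"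
  proof -
    have hw: "(\<Sum>k<n. hess P v (unit_vec k) * w k) = hess P v w" for v
    proof -
      have "(\<Sum>k<n. hess P v (unit_vec k) * w k) = (\<Sum>k<n. \<Sum>i<n. v i * w k * F2 i k P)"
        by (intro sum.cong refl) (simp add: hess_unit_right sum_distrib_left sum_distrib_right mult_ac)
      also have "\<dots> = hess P v w" unfolding hess_def by (rule sum.swap)
      finally show ?thesis .
    qed
    have "(\<Sum>k<n. \<epsilon> k * (r k * w k)) = (\<Sum>k<n. (F P * (hess P y z * (\<epsilon> k * (x k * w k)) - hess P x z * (\<epsilon> k * (y k * w k))
        + sp y z * (hess P x (unit_vec k) * w k) - sp x z * (hess P y (unit_vec k) * w k))
        - grad_sq P * (sp y z * (\<epsilon> k * (x k * w k)) - sp x z * (\<epsilon> k * (y k * w k)))) / (F P)\<^sup>2)"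
    proof (intro sum.cong refl)
      fix k assume "k \<in> {..<n}"
      then have k: "k < n" by simp
      have "\<epsilon> k = 1 \<or> \<epsilon> k = -1" by (simp add: sig_def)
      then show "\<epsilon> k * (r k * w k) = (F P * (hess P y z * (\<epsilon> k * (x k * w k)) - hess P x z * (\<epsilon> k * (y k * w k))
        + sp y z * (hess P x (unit_vec k) * w k) - sp x z * (hess P y (unit_vec k) * w k))
        - grad_sq P * (sp y z * (\<epsilon> k * (x k * w k)) - sp x z * (\<epsilon> k * (y k * w k)))) / (F P)\<^sup>2"
        unfolding r_def curvature_operator[OF P k] by (auto simp: algebra_simps)
    qed
    also have "\<dots> = (F P * (hess P y z * sp x w - hess P x z * sp y w
        + sp y z * (\<Sum>k<n. hess P x (unit_vec k) * w k) - sp x z * (\<Sum>k<n. hess P y (unit_vec k) * w k))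
        - grad_sq P * (sp y z * sp x w - sp x z * sp y w)) / (F P)\<^sup>2"
      unfolding sum_divide_distrib[symmetric] sum_subtractf sum.distrib sum_distrib_left[symmetric] scalar_prod_def ..
    finally show ?thesis unfolding hw .
  qed
  also have "\<dots> / (F P)\<^sup>2 = kulkarni_nomizu (schouten P) (g P) (tv x) (tv y) (tv z) (tv w)"
    unfolding kulkarni_nomizu_def schouten_def metric_tvec tvec_apply
  proof -
    \<comment> \<open>Replacing \<open>1 / F P\<close> by \<open>i\<close> and
      \<open>grad_sq P\<close> by \<open>2 * h\<close> turns the claim into a polynomial identity
      modulo \<open>f * i = 1\<close>.\<close>
    fix a b c d q xz xw yz yw :: real
    define f where "f = F P"
    define i where "i = 1 / f"
    have fi: "f * i = 1" using nz[OF P] by (simp add: f_def i_def)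
    have div: "t / f = t * i" "t / f\<^sup>2 = t * i\<^sup>2" "t / (2 * f\<^sup>2) = t / 2 * i\<^sup>2" for t
      by (simp_all add: i_def power_divide)
    define h where "h = q / 2"
    have q: "q = 2 * h" by (simp add: h_def)
    show "(F P * (a * xw - b * yw + yz * c - xz * d) - q * (yz * xw - xz * yw)) / (F P)\<^sup>2 / (F P)\<^sup>2 =
      (c / F P - q / (2 * (F P)\<^sup>2) * xw) * (yz / (F P)\<^sup>2) - (b / F P - q / (2 * (F P)\<^sup>2) * xz) * (yw / (F P)\<^sup>2)
      + xw / (F P)\<^sup>2 * (a / F P - q / (2 * (F P)\<^sup>2) * yz) - xz / (F P)\<^sup>2 * (d / F P - q / (2 * (F P)\<^sup>2) * yw)"
      unfolding f_def[symmetric] div h_def[symmetric] unfolding q using fi by algebra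
  qed
  finally show ?thesis .
qed

lemma linear_on_chart: "linear_on V (\<lambda>x. sp (x chart) v)" "linear_on V (\<lambda>x. sp v (x chart))"
  "linear_on V (\<lambda>x. hess P (x chart) v)" "linear_on V (\<lambda>x. hess P v (x chart))"
  unfolding linear_on_def scalar_prod_def hess_def
  by (simp_all add: scaleR_fun_def sum.distrib algebra_simps sum_distrib_left)

lemma nondegenerate_form_metric:
  assumes P: "P \<in> cube n \<rho>"
  shows "nondegenerate_form (T P) (g P)"
  unfolding nondegenerate_form_def
proof (intro conjI ballI impI)
  show "linear_on (T P) (\<lambda>x. g P x y)" "linear_on (T P) (\<lambda>x. g P y x)" for y
    unfolding conf_metric_def divide_inverse by (intro linear_on_mult_right linear_on_chart)+
  show "g P x y = g P y x" for x y by (simp add: conf_metric_def scalar_prod_commute)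
  fix x assume x: "x \<in> T P" and z: "\<forall>y\<in>T P. g P x y = 0"
  obtain v where v: "x = tv v" "\<forall>k\<ge>n. v k = 0" using T_cases[OF P x] .
  have "v k = 0" for k
  proof (cases "k < n")
    case True
    have "tv (unit_vec k) \<in> T P" using True by (intro in_T[OF P]) (simp add: unit_vec_def)
    then have "sp v (unit_vec k) = 0" using z nz[OF P] by (auto simp: v metric_tvec)
    moreover have "sp v (unit_vec k) = (\<Sum>i<n. if i = k then \<epsilon> k * v k else 0)"
      unfolding scalar_prod_def by (intro sum.cong) (auto simp: unit_vec_def)
    ultimately have "\<epsilon> k * v k = 0" using True by simp
    then show ?thesis by (simp add: sig_def split: if_splits)
  qed (use v in auto)
  then have "v = 0" by (simp add: fun_eq_iff)
  then show "x = 0" by (simp only: v tvec_zero)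
qed

text \<open>The factor \<open>F P\<close> on the coordinate vectors undoes the \<open>F^-2\<close>
  of the metric.\<close>

lemma orthonormal_frame_metric:
  assumes P: "P \<in> cube n \<rho>"
  shows "orthonormal_frame (T P) (g P) n (\<lambda>i. F P *\<^sub>R tv (unit_vec i)) \<epsilon>"
proof
  let ?e = "\<lambda>i. F P *\<^sub>R tv (unit_vec i)"
  show form: "nondegenerate_form (T P) (g P)" by (rule nondegenerate_form_metric[OF P])
  have uT: "tv (unit_vec i) \<in> T P" if "i < n" for i using that by (intro in_T[OF P]) (simp add: unit_vec_def)
  have subsp: "subspace (T P)"
    unfolding subspace_def tangent_space_cube[OF P]
  proof (intro conjI ballI allI)
    show "0 \<in> tv ` {v. \<forall>k\<ge>n. v k = 0}"
      by (rule image_eqI[of _ _ 0]) (simp_all only: tvec_zero mem_Collect_eq zero_fun_apply simp_thms)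
  next
    fix x y assume "x \<in> tv ` {v. \<forall>k\<ge>n. v k = 0}" "y \<in> tv ` {v. \<forall>k\<ge>n. v k = 0}"
    then obtain v w where "x = tv v" "y = tv w" "\<forall>k\<ge>n. v k = 0" "\<forall>k\<ge>n. w k = 0" by blast
    then show "x + y \<in> tv ` {v. \<forall>k\<ge>n. v k = 0}"
      by (intro image_eqI[of _ _ "v + w"]) (simp_all only: tvec_add mem_Collect_eq plus_fun_apply, simp)
  next
    fix c :: real and x assume "x \<in> tv ` {v. \<forall>k\<ge>n. v k = 0}"
    then obtain v where "x = tv v" "\<forall>k\<ge>n. v k = 0" by blast
    then show "c *\<^sub>R x \<in> tv ` {v. \<forall>k\<ge>n. v k = 0}"
      by (intro image_eqI[of _ _ "c *\<^sub>R v"]) (simp_all only: tvec_scale mem_Collect_eq scaleR_fun_apply, simp)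
  qed
  show "span (?e ` {..<n}) = T P"
  proof
    show "span (?e ` {..<n}) \<subseteq> T P" using uT subsp by (intro span_minimal) (auto intro: subspace_scale)
    show "T P \<subseteq> span (?e ` {..<n})"
    proof
      fix x assume "x \<in> T P"
      then obtain v where v: "x = tv v" "\<forall>k\<ge>n. v k = 0" using T_cases[OF P] by blast
      have "x = (\<Sum>i<n. v i *\<^sub>R tv (unit_vec i))"
        unfolding v(1) tvec_sum[symmetric] unit_vec_comb[OF v(2), symmetric] ..
      also have "\<dots> = (\<Sum>i<n. (v i / F P) *\<^sub>R ?e i)" using nz[OF P] by simp
      also have "\<dots> \<in> span (?e ` {..<n})" by (intro span_sum span_scale span_base imageI)
      finally show "x \<in> span (?e ` {..<n})" .
    qed
  qed
  fix i j assume i: "i < n" and j: "j < n"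
  note lin = bilinear_onD[OF nondegenerate_form_bilinear[OF form], unfolded linear_on_def]
  have "g P (?e i) (?e j) = F P * (F P * g P (tv (unit_vec i)) (tv (unit_vec j)))"
    using lin(1)[of "?e j"] lin(2)[of "tv (unit_vec i)"] uT[OF i] uT[OF j] subspace_scale[OF subsp uT[OF j]] by simp
  then show "g P (?e i) (?e j) = (if i = j then \<epsilon> i else 0)"
    using nz[OF P] i j by (simp add: metric_tvec scalar_prod_unit power2_eq_square)
qed (simp add: sig_sq)

lemma bilinear_schouten: "bilinear_on (T P) (schouten P)"
  unfolding bilinear_on_def schouten_def divide_inverse[of "hess _ _ _"]
  by (intro conjI ballI linear_on_diff linear_on_mult_left linear_on_mult_right linear_on_chart)

lemma curvature_tensor_T:
  assumes P: "P \<in> cube n \<rho>" and "x \<in> T P" "y \<in> T P" "z \<in> T P" "w \<in> T P"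
  shows "curvature_tensor n atlas g P x y z w = kulkarni_nomizu (schouten P) (g P) x y z w"
  using curvature_tensor_tvec[OF P] assms(2-5) unfolding tangent_space_cube[OF P] by auto

text \<open>The square of the scale \<open>F P\<close> of the orthonormal frame clears the
  denominators of \<open>schouten\<close>. Up to the constant \<open>2 * (real n - 1)\<close> there
  remains the left-hand side of the equation that \<open>F\<close> will solve.\<close>

lemma scalar_curvature_metric:
  assumes P: "P \<in> cube n \<rho>"
  shows "scalar_curvature (T P) (g P) (curvature_tensor n atlas g P) =
    2 * (real n - 1) * (F P * (\<Sum>i<n. \<epsilon> i * F2 i i P) - real n / 2 * grad_sq P)"
proof -
  interpret orthonormal_frame "T P" "g P" n "\<lambda>i. F P *\<^sub>R tv (unit_vec i)" \<epsilon>
    by (rule orthonormal_frame_metric[OF P])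
  have sch: "\<epsilon> i * schouten P (F P *\<^sub>R tv (unit_vec i)) (F P *\<^sub>R tv (unit_vec i)) = F P * (\<epsilon> i * F2 i i P) - grad_sq P / 2"
    if i: "i < n" for i
  proof -
    have "hess P (F P *\<^sub>R unit_vec i) (F P *\<^sub>R unit_vec i) = (\<Sum>k<n. \<Sum>l<n. if k = i then if l = i then (F P)\<^sup>2 * F2 i i P else 0 else 0)"
      unfolding hess_def by (intro sum.cong refl) (auto simp: unit_vec_def scaleR_fun_def power2_eq_square)
    also have "\<dots> = (\<Sum>k<n. if k = i then (F P)\<^sup>2 * F2 i i P else 0)" using i by (intro sum.cong refl) simp
    finally have h: "hess P (F P *\<^sub>R unit_vec i) (F P *\<^sub>R unit_vec i) = (F P)\<^sup>2 * F2 i i P" using i by simp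
    have "sp (F P *\<^sub>R unit_vec i) (F P *\<^sub>R unit_vec i) = (F P)\<^sup>2 * sp (unit_vec i) (unit_vec i)"
      unfolding scalar_prod_def sum_distrib_left by (intro sum.cong refl) (simp add: scaleR_fun_def power2_eq_square)
    then have s: "sp (F P *\<^sub>R unit_vec i) (F P *\<^sub>R unit_vec i) = (F P)\<^sup>2 * \<epsilon> i" by (simp add: scalar_prod_unit i)
    have "\<epsilon> i = 1 \<or> \<epsilon> i = -1" by (simp add: sig_def)
    then show ?thesis
      unfolding tvec_scale[symmetric] schouten_def tvec_apply h s using nz[OF P] by (auto simp: power2_eq_square)
  qed
  have "scalar_curvature (T P) (g P) (curvature_tensor n atlas g P) = 2 * (real n - 1) *
     (\<Sum>i<n. \<epsilon> i * schouten P (F P *\<^sub>R tv (unit_vec i)) (F P *\<^sub>R tv (unit_vec i)))"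
    by (rule scalar_curvature_kulkarni_nomizu[OF bilinear_schouten curvature_tensor_T[OF P]])
  also have "(\<Sum>i<n. \<epsilon> i * schouten P (F P *\<^sub>R tv (unit_vec i)) (F P *\<^sub>R tv (unit_vec i))) =
     (\<Sum>i<n. F P * (\<epsilon> i * F2 i i P) - grad_sq P / 2)" by (intro sum.cong refl sch) auto
  also have "\<dots> = F P * (\<Sum>i<n. \<epsilon> i * F2 i i P) - real n / 2 * grad_sq P"
    by (simp add: sum_subtractf sum_distrib_left)
  finally show ?thesis .
qed

lemma has_signature_metric: "P \<in> cube n \<rho> \<Longrightarrow> has_signature (T P) (g P) p (n - p)"
proof -
  assume P: "P \<in> cube n \<rho>"
  interpret orthonormal_frame "T P" "g P" n "\<lambda>i. F P *\<^sub>R tv (unit_vec i)" \<epsilon>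
    by (rule orthonormal_frame_metric[OF P])
  show ?thesis unfolding has_signature_def dim
    using p_le basis orthonormal by (intro conjI exI[of _ "\<lambda>i. F P *\<^sub>R tv (unit_vec i)"]) (auto simp: sig_def)
qed

text \<open>The regularity class stays a parameter because the metric itself is to be analytic,
  whereas its flat companion enters as a smooth metric.\<close>

lemma pseudo_riemannian_metric:
  assumes "\<And>i j. i < n \<Longrightarrow> j < n \<Longrightarrow> reg n (cube n \<rho>) (G i j)"
  shows "pseudo_riemannian_metric_on reg n atlas (cube n \<rho>) g"
  unfolding pseudo_riemannian_metric_on_def
proof (intro conjI ballI allI impI)
  show "nondegenerate_form (T P) (g P)" if "P \<in> cube n \<rho>" for P by (rule nondegenerate_form_metric[OF that])
  show "\<exists>p q. \<forall>P\<in>cube n \<rho>. has_signature (T P) (g P) p q" using has_signature_metric by blast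
  show "reg n (snd c ` (fst c \<inter> cube n \<rho>)) (metric_coeff n atlas g c i j)" if "c \<in> atlas" "i < n" "j < n" for c i j
    using that assms by (simp add: cube_atlas_def)
qed

end

section \<open>The realization theorem\<close>

lemma conformally_flat_manifold_cube:
  assumes F: "conformal_cube n p \<rho> F F1 F2" and G: "has_pseries n \<rho> c G"
    and inv: "\<And>x. x \<in> cube n \<rho> \<Longrightarrow> G x * F x = 1"
  shows "conformally_flat_manifold n (subtopology (Euclidean_space n) (cube n \<rho>)) (cube_atlas n \<rho>) (conf_metric n p \<rho> F)"
proof -
  interpret K: conformal_cube n p \<rho> F F1 F2 by (rule F)
  \<comment> \<open>The flat metric is the same construction for the constant function one with zero
    derivatives, so its vanishing curvature comes from the same formulas.\<close>
  interpret Z: conformal_cube n p \<rho> "\<lambda>_. 1" "\<lambda>_ _. 0" "\<lambda>_ _ _. 0"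
    by standard (use K.rho K.p_le in auto)
  let ?X = "subtopology (Euclidean_space n) (cube n \<rho>)"
  have top: "topspace ?X = cube n \<rho>" by (auto simp: cube_def)
  \<comment> \<open>The conformal factor \<open>1 / F^2\<close>, written through the series of the
    reciprocal so that its smoothness is at hand.\<close>
  define h where "h = (\<lambda>x. G x * G x)"
  have h: "has_pseries n \<rho> (conv c c) h" unfolding h_def by (rule has_pseries_mult[OF G G])
  have G_eq: "G x = 1 / F x" if "x \<in> cube n \<rho>" for x using inv[OF that] K.nz[OF that] by (simp add: field_simps)
  have sm: "pseudo_riemannian_metric_on smooth_fun_on n (cube_atlas n \<rho>) (cube n \<rho>) (conf_metric n p \<rho> (\<lambda>_. 1))"
  proof (rule Z.pseudo_riemannian_metric)
    fix i j assume "i < n" "j < n"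
    then show "smooth_fun_on n (cube n \<rho>) (metric_coeff n (cube_atlas n \<rho>) (conf_metric n p \<rho> (\<lambda>_. 1)) (cube_chart n \<rho>) i j)"
      by (intro has_pseries_smooth[OF has_pseries_const K.rho, of n _ "if i = j then sig p i else 0"]) (simp add: Z.metric_coeff)
  qed
  have flat: "flat_on n (cube_atlas n \<rho>) (cube n \<rho>) (conf_metric n p \<rho> (\<lambda>_. 1))"
    unfolding flat_on_def
    by (simp add: Z.curvature_tensor_T kulkarni_nomizu_def Z.schouten_def Z.hess_def Z.grad_sq_def)
  show ?thesis unfolding conformally_flat_manifold_def top
  proof (rule ballI, intro exI conjI)
    show "openin ?X (cube n \<rho>)" using openin_topspace[of ?X] by (simp only: top)
    show "P \<in> cube n \<rho>" if "P \<in> cube n \<rho>" for P by (rule that)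
    show "\<forall>Q\<in>cube n \<rho>. 0 < h Q"
    proof
      fix Q assume "Q \<in> cube n \<rho>"
      then show "0 < h Q" using K.nz[of Q] zero_less_power2[of "F Q"] by (simp add: h_def G_eq power2_eq_square)
    qed
    have "smooth_fun_on n (cube n \<rho>) (\<lambda>x. h (inv_into (cube n \<rho>) id x))"
      by (rule has_pseries_smooth[OF h K.rho]) (simp add: inv_into_id)
    then show "\<forall>c\<in>cube_atlas n \<rho>. smooth_fun_on n (snd c ` (fst c \<inter> cube n \<rho>)) (\<lambda>x. h (inv_into (fst c) (snd c) x))"
      by (simp add: cube_atlas_def)
    show "\<forall>Q\<in>cube n \<rho>. \<forall>v\<in>tangent_space n (cube_atlas n \<rho>) Q. \<forall>w\<in>tangent_space n (cube_atlas n \<rho>) Q.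
        conf_metric n p \<rho> F Q v w = h Q * conf_metric n p \<rho> (\<lambda>_. 1) Q v w"
      by (simp add: conf_metric_def h_def G_eq power2_eq_square)
  qed (rule sm flat)+
qed

text \<open>The manifold is the cube on which the series of \<open>F\<close> and of
  \<open>1 / F\<close> converge, with the identity as its only chart, and \<open>P\<close> is the
  origin.\<close>

theorem theorem1p3:
  fixes V :: "'v::real_vector set"
    and ip :: "'v \<Rightarrow> 'v \<Rightarrow> real"
    and A :: "'v \<Rightarrow> 'v \<Rightarrow> 'v \<Rightarrow> 'v \<Rightarrow> real"
  assumes "curvature_model V ip A"
    and "conformally_flat_model V ip A"
  shows "\<exists>(n :: nat) (X :: (nat \<Rightarrow> real) topology) (C :: (nat \<Rightarrow> real) chart set)
            (g :: (nat \<Rightarrow> real) metric_field) (P :: nat \<Rightarrow> real).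
           analytic_pseudo_riemannian_manifold n X C g \<and>
           conformally_flat_manifold n X C g \<and>
           P \<in> topspace X \<and>
           constant_scalar_curvature n X C g \<and>
           isomorphic_models V ip A
             (tangent_space n C P) (g P) (curvature_tensor n C g P)"
proof -
  have fd: "fin_dim_space V" and form: "nondegenerate_form V ip" and A: "algebraic_curvature_tensor V A"
    using assms(1) by (auto simp: curvature_model_def)
  obtain n p e where p: "p \<le> n" and "orthonormal_frame V ip n e (\<lambda>i. if i < p then -1 else 1)"
    using orthonormal_frame_exists[OF fd form] .
  then have "orthonormal_frame V ip n e (sig p)" by (simp only: sig_def[abs_def])
  then interpret M: orthonormal_frame V ip n e "sig p" .
  obtain H where H_sym: "\<And>i j. H i j = H j i"
    and AH: "\<And>i j k l. i < n \<Longrightarrow> j < n \<Longrightarrow> k < n \<Longrightarrow> l < n \<Longrightarrow>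
      A (e i) (e j) (e k) (e l) = kulkarni_nomizu (M.extend_form H) ip (e i) (e j) (e k) (e l)"
    using M.conformally_flat_components[OF A assms(2)] by blast
  show ?thesis
  proof (rule yamabe_solution[of n "sig p" H, OF sig_sq(3) H_sym])
    fix \<rho> F G c
    assume \<rho>: "0 < \<rho>" and F: "has_pseries n \<rho> c F" and "\<exists>g. has_pseries n \<rho> g G"
      and GF: "\<And>x. x \<in> polybox n \<rho> \<Longrightarrow> G x * F x = 1"
      and eq: "\<And>x. x \<in> polybox n \<rho> \<Longrightarrow> F x * (\<Sum>i<n. sig p i * partial_deriv i (partial_deriv i F) x)
        - real n / 2 * (\<Sum>i<n. sig p i * (partial_deriv i F x)\<^sup>2) = (\<Sum>i<n. sig p i * H i i)"
      and sym: "\<And>x i j. x \<in> polybox n \<rho> \<Longrightarrow> i < n \<Longrightarrow> j < n \<Longrightarrow>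
        partial_deriv i (partial_deriv j F) x = partial_deriv j (partial_deriv i F) x"
      and F_0: "F 0 = 1" and F1_0: "\<And>i. i < n \<Longrightarrow> partial_deriv i F 0 = 0"
      and F2_0: "\<And>i j. i < n \<Longrightarrow> j < n \<Longrightarrow> partial_deriv i (partial_deriv j F) 0 = H i j"
    then obtain d where G: "has_pseries n \<rho> d G" by blast
    have sub: "x \<in> polybox n \<rho>" if "x \<in> cube n \<rho>" for x using that by (simp add: cube_def)
    have K: "conformal_cube n p \<rho> F (\<lambda>i. partial_deriv i F) (\<lambda>i j. partial_deriv i (partial_deriv j F))"
    proof
      fix x i j assume x: "x \<in> cube n \<rho>"
      show "F x \<noteq> 0" using GF[OF sub[OF x]] by auto
      assume i: "i < n"
      show "((\<lambda>t. F (x(i := t))) has_real_derivative partial_deriv i F x) (at (x i))"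
        by (rule has_pseries_partial_deriv(2)[OF F \<rho> i sub[OF x]])
      assume j: "j < n"
      show "((\<lambda>t. partial_deriv j F (x(i := t))) has_real_derivative partial_deriv i (partial_deriv j F) x) (at (x i))"
        by (rule has_pseries_partial_deriv(2)[OF has_pseries_partial_deriv(1)[OF F \<rho> j] \<rho> i sub[OF x]])
      show "partial_deriv i (partial_deriv j F) x = partial_deriv j (partial_deriv i F) x"
        by (rule sym[OF sub[OF x] i j])
    qed (rule \<rho> p)+
    then interpret K: conformal_cube n p \<rho> F "\<lambda>i. partial_deriv i F" "\<lambda>i j. partial_deriv i (partial_deriv j F)" .
    let ?X = "subtopology (Euclidean_space n) (cube n \<rho>)"
    let ?C = "cube_atlas n \<rho>"
    let ?g = "conf_metric n p \<rho> F"
    have top: "topspace ?X = cube n \<rho>" by (auto simp: cube_def)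
    have P0: "0 \<in> cube n \<rho>" using \<rho> by (simp add: cube_def polybox_def topspace_Euclidean_space)
    have G_eq: "G x = 1 / F x" if "x \<in> cube n \<rho>" for x
      using GF[OF sub[OF that]] K.nz[OF that] by (simp add: field_simps)
    \<comment> \<open>The coefficients are constant multiples of \<open>1 / F^2\<close>. Having
      \<open>1 / F\<close> as a series \<open>G\<close> on the same box makes them analytic on the
      whole cube.\<close>
    have "pseudo_riemannian_metric_on real_analytic_on n ?C (cube n \<rho>) ?g"
    proof (rule K.pseudo_riemannian_metric)
      fix i j assume "i < n" "j < n"
      then show "real_analytic_on n (cube n \<rho>) (metric_coeff n ?C ?g (cube_chart n \<rho>) i j)"
        by (intro has_pseries_real_analytic[OF has_pseries_scale[OF has_pseries_mult[OF G G]] \<rho>, of _ "if i = j then sig p i else 0"])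
           (simp add: K.metric_coeff G_eq power2_eq_square)
    qed
    then have analytic: "analytic_pseudo_riemannian_manifold n ?X ?C ?g"
      unfolding analytic_pseudo_riemannian_manifold_def top using analytic_manifold_cube[OF \<rho>] by blast
    have flat: "conformally_flat_manifold n ?X ?C ?g"
      by (rule conformally_flat_manifold_cube[OF K G]) (rule GF[OF sub])
    have csc: "constant_scalar_curvature n ?X ?C ?g"
      unfolding constant_scalar_curvature_def top
    proof (intro exI ballI)
      fix Q assume Q: "Q \<in> cube n \<rho>"
      show "scalar_curvature (tangent_space n ?C Q) (?g Q) (curvature_tensor n ?C ?g Q) = 2 * (real n - 1) * (\<Sum>i<n. sig p i * H i i)"
        unfolding K.scalar_curvature_metric[OF Q] K.grad_sq_def eq[OF sub[OF Q]] ..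
    qed
    \<comment> \<open>The coordinates of \<open>x\<close> in the frame \<open>e\<close>. The map
      \<open>\<phi>\<close> sends \<open>e\<close> to the coordinate frame at the origin, which is
      orthonormal because \<open>F 0 = 1\<close>.\<close>
    define \<psi> where "\<psi> = (\<lambda>x i. if i < n then sig p i * ip x (e i) else 0)"
    define \<phi> where "\<phi> = (\<lambda>x. tvec n \<rho> (\<psi> x))"
    have ip_exp: "ip x y = scalar_prod n p (\<psi> x) (\<psi> y)" if "x \<in> V" "y \<in> V" for x y
    proof -
      have "ip x y = (\<Sum>i<n. sig p i * ip y (e i) * ip x (e i))"
        by (rule M.linear_expand[OF bilinear_onD(2)[OF M.bilinear that(1)] that(2)])
      also have "\<dots> = scalar_prod n p (\<psi> x) (\<psi> y)"
        unfolding scalar_prod_def by (intro sum.cong refl) (simp add: \<psi>_def sig_sq mult_ac)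
      finally show ?thesis .
    qed
    \<comment> \<open>At the origin \<open>F = 1\<close> and \<open>dF = 0\<close> reduce
      \<open>schouten\<close> to the Hessian of \<open>F\<close>, which is \<open>H\<close>.\<close>
    have S_eq: "K.schouten 0 (\<phi> x) (\<phi> y) = M.extend_form H x y" for x y
    proof -
      have "K.grad_sq 0 = 0" by (simp add: K.grad_sq_def F1_0)
      moreover have "K.hess 0 (\<psi> x) (\<psi> y) = M.extend_form H x y"
        unfolding K.hess_def M.extend_form_def by (intro sum.cong refl) (simp add: \<psi>_def F2_0)
      ultimately show ?thesis by (simp add: K.schouten_def \<phi>_def F_0)
    qed
    have g_eq: "?g 0 (\<phi> x) (\<phi> y) = ip x y" if "x \<in> V" "y \<in> V" for x y
      using ip_exp[OF that] by (simp add: \<phi>_def K.metric_tvec F_0)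
    have lin: "linear_on V \<phi>"
      unfolding linear_on_def
    proof (intro conjI ballI allI)
      note l = bilinear_onD(1)[OF M.bilinear M.e_in, unfolded linear_on_def]
      fix x y assume "x \<in> V" "y \<in> V"
      then have "\<psi> (x + y) = \<psi> x + \<psi> y" using l by (auto simp: \<psi>_def fun_eq_iff algebra_simps)
      then show "\<phi> (x + y) = \<phi> x + \<phi> y" by (simp only: \<phi>_def tvec_add)
    next
      note l = bilinear_onD(1)[OF M.bilinear M.e_in, unfolded linear_on_def]
      fix a x assume "x \<in> V"
      then have "\<psi> (a *\<^sub>R x) = a *\<^sub>R \<psi> x" using l by (auto simp: \<psi>_def fun_eq_iff scaleR_fun_def)
      then show "\<phi> (a *\<^sub>R x) = a *\<^sub>R \<phi> x" by (simp only: \<phi>_def tvec_scale)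
    qed
    have "bij_betw \<phi> V (tangent_space n ?C 0)"
    proof (rule bij_betw_imageI)
      show "inj_on \<phi> V"
      proof (rule inj_onI)
        fix x y assume x: "x \<in> V" and y: "y \<in> V" and "\<phi> x = \<phi> y"
        then have "\<psi> x = \<psi> y" by (metis \<phi>_def tvec_apply)
        then have "sig p i * ip x (e i) = sig p i * ip y (e i)" if "i < n" for i
          using that by (auto simp: \<psi>_def fun_eq_iff split: if_splits)
        then have "(\<Sum>i<n. (sig p i * ip x (e i)) *\<^sub>R e i) = (\<Sum>i<n. (sig p i * ip y (e i)) *\<^sub>R e i)"
          by (intro sum.cong refl arg_cong2[where f = scaleR]) auto
        then show "x = y" using M.expand[OF x] M.expand[OF y] by metis
      qed
      show "\<phi> ` V = tangent_space n ?C 0"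
      proof (intro equalityI subsetI)
        fix t assume "t \<in> tangent_space n ?C 0"
        then obtain v where v: "t = tvec n \<rho> v" "\<forall>k\<ge>n. v k = 0" using K.T_cases[OF P0] by blast
        have "\<psi> (\<Sum>i<n. v i *\<^sub>R e i) = v"
          using v(2) by (auto simp: \<psi>_def fun_eq_iff M.ip_comb sig_sq mult.left_commute[of "sig p _"])
        then show "t \<in> \<phi> ` V" using M.comb_in[of v] by (force simp: \<phi>_def v(1))
      qed (auto simp: \<phi>_def \<psi>_def intro!: K.in_T[OF P0])
    qed
    moreover have "curvature_tensor n ?C ?g 0 (\<phi> x) (\<phi> y) (\<phi> z) (\<phi> w) = A x y z w"
      if "x \<in> V" "y \<in> V" "z \<in> V" "w \<in> V" for x y z w
    proof -
      have "curvature_tensor n ?C ?g 0 (\<phi> x) (\<phi> y) (\<phi> z) (\<phi> w) = kulkarni_nomizu (K.schouten 0) (?g 0) (\<phi> x) (\<phi> y) (\<phi> z) (\<phi> w)"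
        unfolding \<phi>_def by (rule K.curvature_tensor_tvec[OF P0])
      also have "\<dots> = kulkarni_nomizu (M.extend_form H) ip x y z w"
        using that by (simp add: kulkarni_nomizu_def S_eq g_eq)
      also have "\<dots> = A x y z w"
        by (rule M.curvature_eqI[OF A M.bilinear_extend_form AH that, symmetric])
      finally show ?thesis .
    qed
    ultimately have "isomorphic_models V ip A (tangent_space n ?C 0) (?g 0) (curvature_tensor n ?C ?g 0)"
      unfolding isomorphic_models_def using lin g_eq by blast
    then show ?thesis using analytic flat csc P0 top by blast
  qed
qed

end
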